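(* Let $S$ be a nonzero Noetherian ring, let $1\le t\le m\le n$, let $X$ be a generic $m\times n$ matrix over $S$, and let $I=I_t(X)\subseteq S[X]$. Then $I$ satisfies $G_\infty$ if and only if one of the following conditions holds: (i) $t=1$; (ii) $t=m=n$; (iii) $m=n$ and $t=n-1$; (iv) $n=m+1$ and $t=m$; (v) $n=m+2$ and $t=m$; (vi) $m=2$, $n=5$, and $t=2$. If $3\le t=m$ and $n=m+3$, then the maximal $s$ for which $I$ satisfies $G_s$ is $s=18$. In all other cases, the maximal $s$ for which $I$ satisfies $G_s$ is $s=(m-t+2)(n-t+2)$.
   Context: A generic matrix over $S$ is a matrix whose entries are distinct indeterminates over $S$; $S[X]$ is the polynomial ring over $S$ in the entries of $X$. $I_t(X)$ is the ideal generated by the $t\times t$ minors. An ideal $I$ of a Noetherian ring $R$ satisfies $G_s$ if $\mu_{R_{\mathfrak p}}(I_{\mathfrak p})\le\dim R_{\mathfrak p}$ for every prime $\mathfrak p\in V(I)$ with $\dim R_{\mathfrak p}\le s-1$, where $\mu$ is the minimal number of generators; $I$ satisfies $G_\infty$ if it satisfies $G_s$ for every $s$. *)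

theory Defs
  imports
    "HOL-Algebra.Indexed_Polynomials"
    "HOL-Algebra.QuotRing"
    "HOL-Combinatorics.Permutations"
    "HOL-Library.Extended_Nat"
begin

section \<open>Polynomial rings in a set of indeterminates\<close>

text \<open>The library provides the carrier, addition, constants and indeterminates of polynomials
  with indeterminates indexed by a set \<open>V\<close> (as functions from monomials, that is multisets
  over \<open>V\<close>, to coefficients), but no multiplication and no ring record.\<close>

definition indexed_mult ::
    "('a, 'b) ring_scheme \<Rightarrow> ('c multiset \<Rightarrow> 'a) \<Rightarrow> ('c multiset \<Rightarrow> 'a) \<Rightarrow> ('c multiset \<Rightarrow> 'a)" where
  "indexed_mult R P Q =
     (\<lambda>m. \<Oplus>\<^bsub>R\<^esub>x\<in>{x. fst x + snd x = m}. P (fst x) \<otimes>\<^bsub>R\<^esub> Q (snd x))"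

definition indexed_poly_ring :: "('a, 'b) ring_scheme \<Rightarrow> 'c set \<Rightarrow> ('c multiset \<Rightarrow> 'a) ring" where
  "indexed_poly_ring R V =
     \<lparr>carrier = ring.indexed_pset R V (carrier R),
      monoid.mult = indexed_mult R,
      one = ring.indexed_const R \<one>\<^bsub>R\<^esub>,
      zero = ring.indexed_const R \<zero>\<^bsub>R\<^esub>,
      add = ring.indexed_padd R\<rparr>"


section \<open>Minors and determinantal ideals\<close>

text \<open>Matrices are functions of a row and a column index, both counted from 0.\<close>

definition det_ring :: "('a, 'b) ring_scheme \<Rightarrow> nat \<Rightarrow> (nat \<Rightarrow> nat \<Rightarrow> 'a) \<Rightarrow> 'a" where
  "det_ring R t A =
     (\<Oplus>\<^bsub>R\<^esub>\<pi>\<in>{\<pi>. \<pi> permutes {..<t}}.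
        (if evenperm \<pi> then (\<Otimes>\<^bsub>R\<^esub>i\<in>{..<t}. A i (\<pi> i))
         else \<ominus>\<^bsub>R\<^esub> (\<Otimes>\<^bsub>R\<^esub>i\<in>{..<t}. A i (\<pi> i))))"

definition minors ::
    "('a, 'b) ring_scheme \<Rightarrow> nat \<Rightarrow> nat \<Rightarrow> nat \<Rightarrow> (nat \<Rightarrow> nat \<Rightarrow> 'a) \<Rightarrow> 'a set" where
  "minors R m n t A =
     {det_ring R t (\<lambda>i j. A (r i) (c j)) | r c.
        strict_mono_on {..<t} r \<and> r ` {..<t} \<subseteq> {..<m} \<and>
        strict_mono_on {..<t} c \<and> c ` {..<t} \<subseteq> {..<n}}"

definition determinantal_ideal ::
    "('a, 'b) ring_scheme \<Rightarrow> nat \<Rightarrow> nat \<Rightarrow> nat \<Rightarrow> (nat \<Rightarrow> nat \<Rightarrow> 'a) \<Rightarrow> 'a set" where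
  "determinantal_ideal R m n t A = Idl\<^bsub>R\<^esub> (minors R m n t A)"

text \<open>The ring \<open>S[X]\<close> and the ideal \<open>I\<^sub>t(X)\<close> for a generic \<open>m \<times> n\<close> matrix \<open>X\<close>: the entry
  of \<open>X\<close> in position \<open>(i, j)\<close> is the indeterminate with index \<open>(i, j)\<close>.\<close>

definition generic_ring ::
    "('a, 'b) ring_scheme \<Rightarrow> nat \<Rightarrow> nat \<Rightarrow> ((nat \<times> nat) multiset \<Rightarrow> 'a) ring" where
  "generic_ring S m n = indexed_poly_ring S ({..<m} \<times> {..<n})"

definition generic_matrix ::
    "('a, 'b) ring_scheme \<Rightarrow> nat \<Rightarrow> nat \<Rightarrow> ((nat \<times> nat) multiset \<Rightarrow> 'a)" where
  "generic_matrix S i j = ring.indexed_var S (i, j)"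

definition generic_determinantal_ideal ::
    "('a, 'b) ring_scheme \<Rightarrow> nat \<Rightarrow> nat \<Rightarrow> nat \<Rightarrow> ((nat \<times> nat) multiset \<Rightarrow> 'a) set" where
  "generic_determinantal_ideal S m n t =
     determinantal_ideal (generic_ring S m n) m n t (generic_matrix S)"


section \<open>Localization at a prime ideal\<close>

definition loc_rel ::
    "('a, 'b) ring_scheme \<Rightarrow> 'a set \<Rightarrow> (('a \<times> 'a) \<times> ('a \<times> 'a)) set" where
  "loc_rel R p =
     {((a, s), (b, t)) | a s b t.
        a \<in> carrier R \<and> b \<in> carrier R \<and> s \<in> carrier R - p \<and> t \<in> carrier R - p \<and>
        (\<exists>u \<in> carrier R - p. u \<otimes>\<^bsub>R\<^esub> (a \<otimes>\<^bsub>R\<^esub> t) = u \<otimes>\<^bsub>R\<^esub> (b \<otimes>\<^bsub>R\<^esub> s))}"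

definition loc_frac :: "('a, 'b) ring_scheme \<Rightarrow> 'a set \<Rightarrow> 'a \<Rightarrow> 'a \<Rightarrow> ('a \<times> 'a) set" where
  "loc_frac R p a s = loc_rel R p `` {(a, s)}"

definition localization :: "('a, 'b) ring_scheme \<Rightarrow> 'a set \<Rightarrow> ('a \<times> 'a) set ring" where
  "localization R p =
     \<lparr>carrier = (carrier R \<times> (carrier R - p)) // loc_rel R p,
      monoid.mult = (\<lambda>A B. \<Union>(a, s)\<in>A. \<Union>(b, t)\<in>B. loc_frac R p (a \<otimes>\<^bsub>R\<^esub> b) (s \<otimes>\<^bsub>R\<^esub> t)),
      one = loc_frac R p \<one>\<^bsub>R\<^esub> \<one>\<^bsub>R\<^esub>,
      zero = loc_frac R p \<zero>\<^bsub>R\<^esub> \<one>\<^bsub>R\<^esub>,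
      add = (\<lambda>A B. \<Union>(a, s)\<in>A. \<Union>(b, t)\<in>B.
               loc_frac R p (a \<otimes>\<^bsub>R\<^esub> t \<oplus>\<^bsub>R\<^esub> b \<otimes>\<^bsub>R\<^esub> s) (s \<otimes>\<^bsub>R\<^esub> t))\<rparr>"

definition localized_ideal :: "('a, 'b) ring_scheme \<Rightarrow> 'a set \<Rightarrow> 'a set \<Rightarrow> ('a \<times> 'a) set set" where
  "localized_ideal R p I = Idl\<^bsub>localization R p\<^esub> ((\<lambda>a. loc_frac R p a \<one>\<^bsub>R\<^esub>) ` I)"


section \<open>Krull dimension, numbers of generators and the condition \<open>G\<^sub>s\<close>\<close>

definition krull_dim :: "('a, 'b) ring_scheme \<Rightarrow> enat" where
  "krull_dim R =
     Sup {enat k | k. \<exists>c :: nat \<Rightarrow> 'a set.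
            (\<forall>i\<le>k. primeideal (c i) R) \<and> (\<forall>i<k. c i \<subset> c (Suc i))}"

definition min_gens :: "('a, 'b) ring_scheme \<Rightarrow> 'a set \<Rightarrow> enat" where
  "min_gens R I = Inf {enat (card A) | A. A \<subseteq> carrier R \<and> finite A \<and> Idl\<^bsub>R\<^esub> A = I}"

text \<open>The bound \<open>dim R\<^sub>p \<le> s - 1\<close> is written additively to avoid truncated subtraction at \<open>s = 0\<close>.\<close>

definition satisfies_G :: "('a, 'b) ring_scheme \<Rightarrow> 'a set \<Rightarrow> nat \<Rightarrow> bool" where
  "satisfies_G R I s \<longleftrightarrow>
     (\<forall>p. primeideal p R \<and> I \<subseteq> p \<and> krull_dim (localization R p) + 1 \<le> enat s \<longrightarrow>
        min_gens (localization R p) (localized_ideal R p I) \<le> krull_dim (localization R p))"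

definition satisfies_G_infinity :: "('a, 'b) ring_scheme \<Rightarrow> 'a set \<Rightarrow> bool" where
  "satisfies_G_infinity R I \<longleftrightarrow> (\<forall>s. satisfies_G R I s)"

definition maximal_G :: "('a, 'b) ring_scheme \<Rightarrow> 'a set \<Rightarrow> nat \<Rightarrow> bool" where
  "maximal_G R I s \<longleftrightarrow> satisfies_G R I s \<and> (\<forall>s'. satisfies_G R I s' \<longrightarrow> s' \<le> s)"

end

theory Submission
  imports Defs
begin

text \<open>Let \<open>p\<close> be a prime of \<open>S[X]\<close> containing \<open>I\<^sub>t(X)\<close>, and let \<open>k < t\<close> be the number of
  elimination steps that can be made with pivots outside \<open>p\<close>. Fraction-free elimination shows that
  locally at \<open>p\<close> the ideal \<open>I\<^sub>t(X)\<close> is generated by the minors of size \<open>t - k\<close> of an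
  \<open>(m - k) \<times> (n - k)\<close> matrix \<open>Z\<close> with entries in \<open>p\<close>; every entry is linear, with
  coefficient a product of pivots, in its own variable. Hence the ideal has at most
  \<open>N\<^sub>k = (m - k choose t - k) (n - k choose t - k)\<close> local generators, and freeing the variables of \<open>Z\<close> one
  by one produces a chain of primes showing that \<open>dim S[X]\<^sub>p \<ge> D\<^sub>k = (m - k) (n - k)\<close>.

  Conversely, over a minimal prime of \<open>S\<close> the equations \<open>Z = 0\<close> can be solved after \<open>k\<close> generic
  elimination steps, and at the resulting prime both bounds are attained: differentiating a relation
  between the minors of \<open>Z\<close> puts its coefficients into \<open>p\<close>, and a count of monomials bounds the
  length of chains of primes below \<open>p\<close>. So \<open>G\<^sub>s\<close> holds iff \<open>N\<^sub>k \<le> D\<^sub>k\<close> or \<open>s \<le> D\<^sub>k\<close> for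
  every \<open>k < t\<close>, which is a question about binomial coefficients.\<close>

section \<open>Determinants over a commutative ring\<close>

text \<open>With a = m - t, b = n - t and e = t - k the two bounds read N = (a+e choose e)(b+e
  choose e) and D = (a+e)(b+e). Since D grows with e, the largest s is D at the smallest e with N >
  D. For e = 1 always N = D. For e = 2 one has N > D iff (a+1)(b+1) > 4, whence the generic value
  (m-t+2)(n-t+2). The pair a = 0, b = 3 passes e = 2 with 10 = 10 and fails at e = 3 with 20 > 18,
  whence the value 18 and the isolated 2 x 5 case. The obstacle is that S is an arbitrary Noetherian
  ring: pivots may be zero divisors, and primes of S[X] may contract to primes of positive height.
  Elimination therefore never divides; it compares ideals up to powers of pivots, which become units
  at p. The dimension need not equal D at a general prime, but one-sided estimates suffice: if p
  violates the condition, then D is at most the dimension, which is below s and below the number of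
  generators, which is at most N; so D < s and D < N for some k.\<close>

lemma (in abelian_monoid) finsum_product:
  assumes "finite A" "finite B" "\<And>a b. a \<in> A \<Longrightarrow> b \<in> B \<Longrightarrow> f (a, b) \<in> carrier G"
  shows "(\<Oplus>x\<in>A \<times> B. f x) = (\<Oplus>a\<in>A. \<Oplus>b\<in>B. f (a, b))"
  using assms(1,3)
proof (induction A)
  case empty
  then show ?case by simp
next
  case (insert a A)
  have eq: "insert a A \<times> B = (\<lambda>b. (a, b)) ` B \<union> A \<times> B" by auto
  have "(\<Oplus>x\<in>insert a A \<times> B. f x) = (\<Oplus>x\<in>(\<lambda>b. (a, b)) ` B. f x) \<oplus> (\<Oplus>x\<in>A \<times> B. f x)"
    unfolding eq using insert assms(2) by (intro finsum_Un_disjoint) auto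
  also have "(\<Oplus>x\<in>(\<lambda>b. (a, b)) ` B. f x) = (\<Oplus>b\<in>B. f (a, b))"
    using insert.prems by (intro finsum_reindex) (auto simp: inj_on_def)
  also have "(\<Oplus>x\<in>A \<times> B. f x) = (\<Oplus>a\<in>A. \<Oplus>b\<in>B. f (a, b))"
    using insert by simp
  finally show ?case using insert by simp
qed

lemma (in abelian_monoid) finsum_swap:
  assumes "finite A" "finite B" "\<And>a b. a \<in> A \<Longrightarrow> b \<in> B \<Longrightarrow> f a b \<in> carrier G"
  shows "(\<Oplus>a\<in>A. \<Oplus>b\<in>B. f a b) = (\<Oplus>b\<in>B. \<Oplus>a\<in>A. f a b)"
  using assms(1,3)
proof (induction A)
  case empty
  then show ?case by simp
next
  case (insert a A)
  have "(\<Oplus>b\<in>B. \<Oplus>a\<in>insert a A. f a b) = (\<Oplus>b\<in>B. f a b \<oplus> (\<Oplus>a\<in>A. f a b))"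
    using insert by (intro finsum_cong') (auto intro!: finsum_closed)
  thus ?case using insert assms(2)
    by (simp add: finsum_addf Pi_def)
qed

context cring begin

definition signed_term :: "nat \<Rightarrow> (nat \<Rightarrow> nat \<Rightarrow> 'a) \<Rightarrow> (nat \<Rightarrow> nat) \<Rightarrow> 'a" where
  "signed_term t A \<pi> = (if evenperm \<pi> then (\<Otimes>i\<in>{..<t}. A i (\<pi> i))
         else \<ominus> (\<Otimes>i\<in>{..<t}. A i (\<pi> i)))"

lemma det_ring_signed_term: "det_ring R t A = (\<Oplus>\<pi>\<in>{\<pi>. \<pi> permutes {..<t}}. signed_term t A \<pi>)"
  unfolding det_ring_def signed_term_def ..

lemma permutes_lessThan: "\<pi> permutes {..<t} \<Longrightarrow> \<forall>i<t. \<pi> i < (t::nat)"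
  using permutes_in_image[of \<pi> "{..<t}"] by simp

text \<open>Inverse of a permutation as a function, kept apart from the \<open>inv\<close> of units
  in a ring.\<close>

abbreviation (input) pinv :: "(nat \<Rightarrow> nat) \<Rightarrow> nat \<Rightarrow> nat" where
  "pinv \<equiv> inv_into UNIV"

lemma prod_entries_closed:
  fixes t :: nat
  assumes "\<And>i j. i < t \<Longrightarrow> j < t \<Longrightarrow> A i j \<in> carrier R" "\<pi> permutes {..<t}"
  shows "(\<Otimes>i\<in>{..<t}. A i (\<pi> i)) \<in> carrier R"
  using assms(1) permutes_lessThan[OF assms(2)] by (intro finprod_closed) auto

lemma signed_term_closed:
  assumes "\<And>i j. i < t \<Longrightarrow> j < t \<Longrightarrow> A i j \<in> carrier R" "\<pi> permutes {..<t}"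
  shows "signed_term t A \<pi> \<in> carrier R"
  using prod_entries_closed[of t A \<pi>] assms unfolding signed_term_def by auto

lemma det_ring_closed:
  assumes "\<And>i j. i < t \<Longrightarrow> j < t \<Longrightarrow> A i j \<in> carrier R"
  shows "det_ring R t A \<in> carrier R"
  unfolding det_ring_signed_term using signed_term_closed[of t A] assms by (intro finsum_closed) auto

lemma signed_term_cong:
  assumes "\<And>i j. i < t \<Longrightarrow> j < t \<Longrightarrow> A i j = B i j" "\<And>i j. i < t \<Longrightarrow> j < t \<Longrightarrow> B i j \<in> carrier R"
    "\<pi> permutes {..<t}"
  shows "signed_term t A \<pi> = signed_term t B \<pi>"
proof -
  have "(\<Otimes>i\<in>{..<t}. A i (\<pi> i)) = (\<Otimes>i\<in>{..<t}. B i (\<pi> i))"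
    using assms by (intro finprod_cong') (auto dest: permutes_lessThan)
  thus ?thesis unfolding signed_term_def by simp
qed

lemma det_ring_cong:
  assumes "\<And>i j. i < t \<Longrightarrow> j < t \<Longrightarrow> A i j = B i j" "\<And>i j. i < t \<Longrightarrow> j < t \<Longrightarrow> B i j \<in> carrier R"
  shows "det_ring R t A = det_ring R t B"
  unfolding det_ring_signed_term
  using assms by (intro finsum_cong') (auto intro: signed_term_cong signed_term_closed)

lemma permutes_zero: "{\<pi>. \<pi> permutes {..<(0::nat)}} = {id}"
  by auto

lemma det_ring_0: "det_ring R 0 A = \<one>"
  unfolding det_ring_signed_term permutes_zero by (simp add: signed_term_def)

text \<open>Reindexing by inversion of permutations, which preserves parity; the product over rows
  turns into the product over columns when i is replaced by \<pi> i.\<close>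

lemma det_ring_transpose:
  assumes "\<And>i j. i < t \<Longrightarrow> j < t \<Longrightarrow> A i j \<in> carrier R"
  shows "det_ring R t (\<lambda>i j. A j i) = det_ring R t A"
proof -
  have inj: "inj_on pinv {\<pi>. \<pi> permutes {..<t}}"
    by (metis (no_types, lifting) inj_onI mem_Collect_eq permutes_inv_inv)
  have im: "pinv ` {\<pi>. \<pi> permutes {..<t}} = {\<pi>. \<pi> permutes {..<t}}"
  proof (intro equalityI subsetI)
    fix \<pi> assume "\<pi> \<in> {\<pi>. \<pi> permutes {..<t}}"
    thus "\<pi> \<in> pinv ` {\<pi>. \<pi> permutes {..<t}}"
      by (intro image_eqI[of _ _ "pinv \<pi>"]) (simp_all add: permutes_inv permutes_inv_inv)
  qed (auto intro: permutes_inv)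
  have "signed_term t (\<lambda>i j. A j i) (pinv \<pi>) = signed_term t A \<pi>" if \<pi>: "\<pi> permutes {..<t}" for \<pi>
  proof -
    have "(\<Otimes>i\<in>{..<t}. A (pinv \<pi> i) i) = (\<Otimes>i\<in>\<pi> ` {..<t}. A (pinv \<pi> i) i)"
      using permutes_image[OF \<pi>] by simp
    also have "\<dots> = (\<Otimes>i\<in>{..<t}. A (pinv \<pi> (\<pi> i)) (\<pi> i))"
      using assms permutes_lessThan[OF \<pi>] permutes_lessThan[OF permutes_inv[OF \<pi>]]
      by (intro finprod_reindex permutes_inj_on[OF \<pi>]) auto
    also have "\<dots> = (\<Otimes>i\<in>{..<t}. A i (\<pi> i))"
      by (simp add: permutes_inverses(2)[OF \<pi>])
    finally show ?thesis
      unfolding signed_term_def using evenperm_inv[OF permutation_permutes[THEN iffD2]] \<pi>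
      by (metis finite_lessThan)
  qed
  note eq = this
  have stc: "signed_term t A \<pi> \<in> carrier R" "signed_term t (\<lambda>i j. A j i) \<pi> \<in> carrier R"
    if "\<pi> permutes {..<t}" for \<pi>
    using that assms by (auto intro: signed_term_closed)
  have "det_ring R t (\<lambda>i j. A j i) = (\<Oplus>\<pi>\<in>pinv ` {\<pi>. \<pi> permutes {..<t}}. signed_term t (\<lambda>i j. A j i) \<pi>)"
    unfolding det_ring_signed_term im ..
  also have "\<dots> = (\<Oplus>\<pi>\<in>{\<pi>. \<pi> permutes {..<t}}. signed_term t (\<lambda>i j. A j i) (pinv \<pi>))"
    using stc by (intro finsum_reindex inj) (auto simp: permutes_inv)
  also have "\<dots> = (\<Oplus>\<pi>\<in>{\<pi>. \<pi> permutes {..<t}}. signed_term t A \<pi>)"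
    using stc eq by (intro finsum_cong') auto
  finally show ?thesis unfolding det_ring_signed_term .
qed

lemma permutes_permutation: "\<pi> permutes {..<(t::nat)} \<Longrightarrow> permutation \<pi>"
  using permutation_permutes by blast

lemma finsum_a_inv:
  assumes "finite Y" "f \<in> Y \<rightarrow> carrier R"
  shows "(\<Oplus>x\<in>Y. \<ominus> f x) = \<ominus> (\<Oplus>x\<in>Y. f x)"
  using assms by (induction Y) (auto simp: Pi_def minus_add)

lemma det_ring_permute_rows:
  assumes "\<And>i j. i < t \<Longrightarrow> j < t \<Longrightarrow> A i j \<in> carrier R" and \<tau>: "\<tau> permutes {..<t}"
  shows "det_ring R t (\<lambda>i j. A (\<tau> i) j) = (if evenperm \<tau> then det_ring R t A else \<ominus> det_ring R t A)"
proof -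
  let ?P = "{\<pi>. \<pi> permutes {..<t}}"
  have stc: "signed_term t A \<pi> \<in> carrier R" if "\<pi> \<in> ?P" for \<pi>
    using that assms by (intro signed_term_closed) auto
  have inj: "inj_on (\<lambda>\<pi>. \<pi> \<circ> \<tau>) ?P"
    using permutes_surj[OF \<tau>] by (auto simp: inj_on_def fun_eq_iff surj_def) metis
  have im: "(\<lambda>\<pi>. \<pi> \<circ> \<tau>) ` ?P = ?P"
    using image_compose_permutations_right[OF \<tau>] by (auto simp: image_def Collect_conj_eq)
  have eq: "signed_term t (\<lambda>i j. A (\<tau> i) j) (\<pi> \<circ> \<tau>) =
      (if evenperm \<tau> then signed_term t A \<pi> else \<ominus> signed_term t A \<pi>)" if \<pi>: "\<pi> \<in> ?P" for \<pi>
  proof -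
    have "(\<Otimes>i\<in>{..<t}. A i (\<pi> i)) = (\<Otimes>i\<in>\<tau> ` {..<t}. A i (\<pi> i))"
      using permutes_image[OF \<tau>] by simp
    also have "\<dots> = (\<Otimes>i\<in>{..<t}. A (\<tau> i) (\<pi> (\<tau> i)))"
      using assms(1) \<pi> permutes_lessThan[of \<pi> t] permutes_lessThan[OF \<tau>]
      by (intro finprod_reindex permutes_inj_on[OF \<tau>]) auto
    finally have e: "(\<Otimes>i\<in>{..<t}. A (\<tau> i) ((\<pi> \<circ> \<tau>) i)) = (\<Otimes>i\<in>{..<t}. A i (\<pi> i))" by simp
    show ?thesis
      unfolding signed_term_def e
      using evenperm_comp[OF permutes_permutation permutes_permutation[OF \<tau>]] \<pi>
        prod_entries_closed[of t A \<pi>] assms by auto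
  qed
  have "det_ring R t (\<lambda>i j. A (\<tau> i) j) = (\<Oplus>\<pi>\<in>(\<lambda>\<pi>. \<pi> \<circ> \<tau>) ` ?P. signed_term t (\<lambda>i j. A (\<tau> i) j) \<pi>)"
    unfolding det_ring_signed_term im ..
  also have "\<dots> = (\<Oplus>\<pi>\<in>?P. signed_term t (\<lambda>i j. A (\<tau> i) j) (\<pi> \<circ> \<tau>))"
    using assms permutes_lessThan[OF \<tau>]
    by (intro finsum_reindex inj) (auto intro!: signed_term_closed permutes_compose)
  also have "\<dots> = (\<Oplus>\<pi>\<in>?P. if evenperm \<tau> then signed_term t A \<pi> else \<ominus> signed_term t A \<pi>)"
    using stc eq by (intro finsum_cong') auto
  also have "\<dots> = (if evenperm \<tau> then det_ring R t A else \<ominus> det_ring R t A)"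
    using stc finsum_a_inv[of ?P "signed_term t A"]
    unfolding det_ring_signed_term Pi_def by (simp add: finite_permutations)
  finally show ?thesis .
qed

text \<open>Composition with the transposition of i and j matches even with odd permutations and
  negates their terms. Antisymmetry alone would only give 2 det = 0, which is too weak in
  characteristic two.\<close>

lemma det_ring_equal_rows:
  assumes cl: "\<And>i j. i < t \<Longrightarrow> j < t \<Longrightarrow> A i j \<in> carrier R"
    and ij: "i < t" "j < t" "i \<noteq> j" and eq: "\<And>l. l < t \<Longrightarrow> A i l = A j l"
  shows "det_ring R t A = \<zero>"
proof -
  let ?P = "{\<pi>. \<pi> permutes {..<t}}" and ?\<tau> = "transpose i j"
  let ?E = "{\<pi>\<in>?P. evenperm \<pi>}" and ?O = "{\<pi>\<in>?P. \<not> evenperm \<pi>}"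
  have \<tau>: "?\<tau> permutes {..<t}" using ij by (intro permutes_swap_id) auto
  have stc: "signed_term t A \<pi> \<in> carrier R" if "\<pi> permutes {..<t}" for \<pi>
    using that cl by (intro signed_term_closed) auto
  have odd: "evenperm (\<pi> \<circ> ?\<tau>) \<longleftrightarrow> \<not> evenperm \<pi>" if "\<pi> \<in> ?P" for \<pi>
    using evenperm_comp[OF permutes_permutation permutes_permutation[OF \<tau>]] that ij(3)
    by (auto simp: evenperm_swap)
  have inv2: "\<pi> \<circ> ?\<tau> \<circ> ?\<tau> = \<pi>" for \<pi> :: "nat \<Rightarrow> nat" by (auto simp: fun_eq_iff)
  have inj: "inj_on (\<lambda>\<pi>. \<pi> \<circ> ?\<tau>) ?E" by (metis (no_types, lifting) inj_onI inv2)
  have im: "(\<lambda>\<pi>. \<pi> \<circ> ?\<tau>) ` ?E = ?O"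
  proof (intro equalityI subsetI)
    fix \<pi> assume "\<pi> \<in> ?O"
    hence "\<pi> \<circ> ?\<tau> \<in> ?E" using odd[of \<pi>] permutes_compose[OF \<tau>, of \<pi>] by simp
    thus "\<pi> \<in> (\<lambda>\<pi>. \<pi> \<circ> ?\<tau>) ` ?E" by (intro image_eqI[of _ _ "\<pi> \<circ> ?\<tau>"]) (simp_all add: inv2)
  next
    fix \<pi> assume "\<pi> \<in> (\<lambda>\<pi>. \<pi> \<circ> ?\<tau>) ` ?E"
    then obtain \<sigma> where s: "\<sigma> \<in> ?E" "\<pi> = \<sigma> \<circ> ?\<tau>" by blast
    have "\<pi> permutes {..<t}" unfolding s(2) using s(1) by (intro permutes_compose[OF \<tau>]) auto
    thus "\<pi> \<in> ?O" using odd[of \<sigma>] s by simp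
  qed
  have st: "signed_term t A (\<pi> \<circ> ?\<tau>) = \<ominus> signed_term t A \<pi>" if \<pi>: "\<pi> \<in> ?E" for \<pi>
  proof -
    have "(\<Otimes>l\<in>{..<t}. A l (\<pi> l)) = (\<Otimes>l\<in>?\<tau> ` {..<t}. A l (\<pi> l))"
      using permutes_image[OF \<tau>] by simp
    also have "\<dots> = (\<Otimes>l\<in>{..<t}. A (?\<tau> l) (\<pi> (?\<tau> l)))"
      using cl \<pi> permutes_lessThan[of \<pi> t] permutes_lessThan[OF \<tau>]
      by (intro finprod_reindex permutes_inj_on[OF \<tau>]) auto
    also have "\<dots> = (\<Otimes>l\<in>{..<t}. A l (\<pi> (?\<tau> l)))"
      using cl \<pi> ij eq permutes_lessThan[OF \<tau>] permutes_lessThan[of \<pi> t]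
      by (intro finprod_cong') (auto simp: transpose_def)
    finally show ?thesis unfolding signed_term_def using odd \<pi> by simp
  qed
  have finE: "finite ?E" and finO: "finite ?O"
    using finite_permutations[of "{..<t}"] by auto
  have "det_ring R t A = (\<Oplus>\<pi>\<in>?E \<union> ?O. signed_term t A \<pi>)"
    unfolding det_ring_signed_term by (intro arg_cong2[where f="finsum R"]) auto
  also have "\<dots> = (\<Oplus>\<pi>\<in>?E. signed_term t A \<pi>) \<oplus> (\<Oplus>\<pi>\<in>?O. signed_term t A \<pi>)"
    using stc cl finE finO by (intro finsum_Un_disjoint) auto
  also have "(\<Oplus>\<pi>\<in>?O. signed_term t A \<pi>) = (\<Oplus>\<pi>\<in>(\<lambda>\<pi>. \<pi> \<circ> ?\<tau>) ` ?E. signed_term t A \<pi>)"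
    by (simp only: im)
  also have "\<dots> = (\<Oplus>\<pi>\<in>?E. signed_term t A (\<pi> \<circ> ?\<tau>))"
    using stc cl permutes_compose[OF \<tau>]
    by (intro finsum_reindex inj) (auto simp: image_subset_iff)
  also have "\<dots> = (\<Oplus>\<pi>\<in>?E. \<ominus> signed_term t A \<pi>)"
    using stc cl st by (intro finsum_cong') auto
  also have "\<dots> = \<ominus> (\<Oplus>\<pi>\<in>?E. signed_term t A \<pi>)"
    using stc cl finE by (intro finsum_a_inv) auto
  finally show ?thesis
    using stc cl by (simp add: r_neg finsum_closed Pi_def)
qed

lemma det_ring_row_linear:
  assumes cl: "\<And>i j. i < t \<Longrightarrow> j < t \<Longrightarrow> A i j \<in> carrier R" and k: "k < t"
    and f: "\<And>j. j < t \<Longrightarrow> f j \<in> carrier R" and g: "\<And>j. j < t \<Longrightarrow> g j \<in> carrier R"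
    and c: "c \<in> carrier R" and d: "d \<in> carrier R"
  shows "det_ring R t (A(k := \<lambda>j. c \<otimes> f j \<oplus> d \<otimes> g j)) =
    c \<otimes> det_ring R t (A(k := f)) \<oplus> d \<otimes> det_ring R t (A(k := g))"
proof -
  let ?P = "{\<pi>. \<pi> permutes {..<t}}"
  have prod: "(\<Otimes>i\<in>{..<t}. (A(k := h)) i (\<pi> i)) = h (\<pi> k) \<otimes> (\<Otimes>i\<in>{..<t}-{k}. A i (\<pi> i))"
    if "\<pi> \<in> ?P" "\<And>j. j < t \<Longrightarrow> h j \<in> carrier R" for \<pi> h
  proof -
    have "{..<t} = insert k ({..<t} - {k})" using k by auto
    hence "(\<Otimes>i\<in>{..<t}. (A(k := h)) i (\<pi> i)) = (\<Otimes>i\<in>insert k ({..<t} - {k}). (A(k := h)) i (\<pi> i))"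
      by simp
    also have "\<dots> = h (\<pi> k) \<otimes> (\<Otimes>i\<in>{..<t}-{k}. (A(k := h)) i (\<pi> i))"
      using that(2) cl k permutes_lessThan[of \<pi> t] that(1) by (subst finprod_insert) auto
    also have "(\<Otimes>i\<in>{..<t}-{k}. (A(k := h)) i (\<pi> i)) = (\<Otimes>i\<in>{..<t}-{k}. A i (\<pi> i))"
      using that(1) cl permutes_lessThan[of \<pi> t] by (intro finprod_cong') auto
    finally show ?thesis .
  qed
  have cl': "\<And>i j. i < t \<Longrightarrow> j < t \<Longrightarrow> (A(k := h)) i j \<in> carrier R" if "\<And>j. j < t \<Longrightarrow> h j \<in> carrier R" for h
    using that cl by auto
  have stf: "signed_term t (A(k := f)) \<pi> \<in> carrier R" if "\<pi> permutes {..<t}" for \<pi>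
    using cl'[OF f] that by (intro signed_term_closed) 
  have stg: "signed_term t (A(k := g)) \<pi> \<in> carrier R" if "\<pi> permutes {..<t}" for \<pi>
    using cl'[OF g] that by (intro signed_term_closed) 
  have st: "signed_term t (A(k := \<lambda>j. c \<otimes> f j \<oplus> d \<otimes> g j)) \<pi> =
     c \<otimes> signed_term t (A(k := f)) \<pi> \<oplus> d \<otimes> signed_term t (A(k := g)) \<pi>" if \<pi>: "\<pi> \<in> ?P" for \<pi>
  proof -
    have p: "\<pi> k < t" using \<pi> k by (auto dest: permutes_lessThan)
    have "(\<Otimes>i\<in>{..<t}-{k}. A i (\<pi> i)) \<in> carrier R"
      using cl \<pi> permutes_lessThan[of \<pi> t] by (intro finprod_closed) auto
    moreover have "f (\<pi> k) \<in> carrier R" "g (\<pi> k) \<in> carrier R" using f g p by auto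
    ultimately show ?thesis
      using prod[OF \<pi>, of f] prod[OF \<pi>, of g] prod[OF \<pi>, of "\<lambda>j. c \<otimes> f j \<oplus> d \<otimes> g j"] f g c d
      unfolding signed_term_def by (auto simp: l_distr m_assoc r_minus minus_add)
  qed
  have "det_ring R t (A(k := \<lambda>j. c \<otimes> f j \<oplus> d \<otimes> g j)) =
     (\<Oplus>\<pi>\<in>?P. c \<otimes> signed_term t (A(k := f)) \<pi> \<oplus> d \<otimes> signed_term t (A(k := g)) \<pi>)"
    unfolding det_ring_signed_term
    using stf stg c d st by (intro finsum_cong') auto
  also have "\<dots> = (\<Oplus>\<pi>\<in>?P. c \<otimes> signed_term t (A(k := f)) \<pi>) \<oplus> (\<Oplus>\<pi>\<in>?P. d \<otimes> signed_term t (A(k := g)) \<pi>)"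
    using stf stg c d by (intro finsum_addf) auto
  also have "(\<Oplus>\<pi>\<in>?P. c \<otimes> signed_term t (A(k := f)) \<pi>) = c \<otimes> det_ring R t (A(k := f))"
    unfolding det_ring_signed_term
    using stf c by (intro finsum_rdistr[symmetric]) (auto simp: finite_permutations)
  also have "(\<Oplus>\<pi>\<in>?P. d \<otimes> signed_term t (A(k := g)) \<pi>) = d \<otimes> det_ring R t (A(k := g))"
    unfolding det_ring_signed_term
    using stg d by (intro finsum_rdistr[symmetric]) (auto simp: finite_permutations)
  finally show ?thesis .
qed

text \<open>Rows in \<open>K\<close> are scaled by \<open>u\<close> before a multiple of row k is
  subtracted, which avoids division and costs one factor \<open>u\<close> per row. Treating one row
  at a time, linearity splits off a determinant in which row k occurs twice, and this vanishes; k
  outside \<open>K\<close> keeps the subtracted row unchanged throughout.\<close>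

lemma det_ring_row_operations:
  assumes cl: "\<And>i j. i < t \<Longrightarrow> j < t \<Longrightarrow> A i j \<in> carrier R" and k: "k < t" "k \<notin> K" and K: "K \<subseteq> {..<t}"
    and u: "u \<in> carrier R" and y: "\<And>i. i \<in> K \<Longrightarrow> y i \<in> carrier R"
  shows "det_ring R t (\<lambda>i j. if i \<in> K then u \<otimes> A i j \<ominus> y i \<otimes> A k j else A i j)
    = u [^] card K \<otimes> det_ring R t A"
proof -
  have "finite K" using K finite_subset by blast
  thus ?thesis using K y k(2)
  proof (induction K)
    case empty
    then show ?case using det_ring_closed[of t A] cl by simp
  next
    case (insert l K)
    let ?B = "\<lambda>i j. if i \<in> K then u \<otimes> A i j \<ominus> y i \<otimes> A k j else A i j"
    have l: "l < t" "l \<noteq> k" "y l \<in> carrier R" using insert by auto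
    have clB: "\<And>i j. i < t \<Longrightarrow> j < t \<Longrightarrow> ?B i j \<in> carrier R" using cl k u insert by auto
    have "det_ring R t (\<lambda>i j. if i \<in> insert l K then u \<otimes> A i j \<ominus> y i \<otimes> A k j else A i j)
      = det_ring R t (?B(l := \<lambda>j. u \<otimes> A l j \<oplus> (\<ominus> y l) \<otimes> A k j))"
      using cl k u insert by (intro det_ring_cong) (auto simp: l_minus minus_eq)
    also have "\<dots> = u \<otimes> det_ring R t (?B(l := A l)) \<oplus> (\<ominus> y l) \<otimes> det_ring R t (?B(l := A k))"
      using cl k u l clB by (intro det_ring_row_linear) auto
    also have "det_ring R t (?B(l := A l)) = det_ring R t ?B"
      using clB insert.hyps by (intro det_ring_cong) auto
    also have "det_ring R t (?B(l := A k)) = \<zero>"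
      using clB cl k l insert by (intro det_ring_equal_rows[of t _ l k]) auto
    also have "det_ring R t ?B = u [^] card K \<otimes> det_ring R t A"
      using insert by simp
    finally show ?case
      using insert.hyps u l det_ring_closed[of t A] cl by (simp add: m_ac)
  qed
qed

lemma det_ring_column_operations:
  assumes cl: "\<And>i j. i < t \<Longrightarrow> j < t \<Longrightarrow> A i j \<in> carrier R" and k: "k < t" "k \<notin> K" and K: "K \<subseteq> {..<t}"
    and u: "u \<in> carrier R" and y: "\<And>i. i \<in> K \<Longrightarrow> y i \<in> carrier R"
  shows "det_ring R t (\<lambda>i j. if j \<in> K then u \<otimes> A i j \<ominus> y j \<otimes> A i k else A i j)
    = u [^] card K \<otimes> det_ring R t A"
proof -
  have "det_ring R t (\<lambda>i j. if j \<in> K then u \<otimes> A i j \<ominus> y j \<otimes> A i k else A i j)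
    = det_ring R t (\<lambda>i j. if i \<in> K then u \<otimes> A j i \<ominus> y i \<otimes> A j k else A j i)"
    using cl k u y
    by (intro det_ring_transpose[of t "\<lambda>i j. if i \<in> K then u \<otimes> A j i \<ominus> y i \<otimes> A j k else A j i"]) auto
  also have "\<dots> = u [^] card K \<otimes> det_ring R t (\<lambda>i j. A j i)"
    by (rule det_ring_row_operations[of t "\<lambda>i j. A j i" k K u y, OF _ k K u y]) (simp add: cl)
  also have "det_ring R t (\<lambda>i j. A j i) = det_ring R t A"
    by (rule det_ring_transpose[of t A, OF cl])
  finally show ?thesis .
qed

text \<open>Expansion along the last row. Column b is removed by letting column t take its place, so
  every sign with b \<noteq> t is -1 instead of alternating. Each permutation of
  \<open>{..<Suc t}\<close> is uniquely \<open>transpose t b \<circ> \<sigma>\<close> with \<sigma>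
  fixing t, and b is the image of t.\<close>

lemma det_ring_laplace:
  assumes cl: "\<And>i j. i < Suc t \<Longrightarrow> j < Suc t \<Longrightarrow> A i j \<in> carrier R"
  shows "det_ring R (Suc t) A = (\<Oplus>b\<in>{..<Suc t}. (if b = t then \<one> else \<ominus> \<one>) \<otimes>
     (A t b \<otimes> det_ring R t (\<lambda>i j. A i (transpose t b j))))"
proof -
  let ?P = "{\<pi>. \<pi> permutes {..<t}}" and ?P' = "{\<pi>. \<pi> permutes {..<Suc t}}"
  let ?h = "\<lambda>(b, \<sigma>). transpose t b \<circ> \<sigma>"
  have ins: "{..<Suc t} = insert t {..<t}" by auto
  have im: "?P' = ?h ` ({..<Suc t} \<times> ?P)"
    using permutes_insert[of t "{..<t}"] unfolding ins[symmetric] by (auto simp: image_def)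
  have fix_t: "\<sigma> t = t" if "\<sigma> \<in> ?P" for \<sigma>
    using that by (auto simp: permutes_def)
  have inj: "inj_on ?h ({..<Suc t} \<times> ?P)"
  proof (rule inj_onI, clarify)
    fix b \<sigma> b' \<sigma>'
    assume s: "\<sigma> permutes {..<t}" "\<sigma>' permutes {..<t}" and e: "transpose t b \<circ> \<sigma> = transpose t b' \<circ> \<sigma>'"
    have "(transpose t b \<circ> \<sigma>) t = (transpose t b' \<circ> \<sigma>') t" using e by simp
    hence b: "b = b'" using fix_t[of \<sigma>] fix_t[of \<sigma>'] s by simp
    have "\<sigma> x = \<sigma>' x" for x
    proof -
      have "\<sigma> x = transpose t b ((transpose t b \<circ> \<sigma>) x)" by simp
      also have "\<dots> = transpose t b ((transpose t b' \<circ> \<sigma>') x)" by (simp only: e)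
      also have "\<dots> = \<sigma>' x" by (simp add: b)
      finally show ?thesis .
    qed
    thus "b = b' \<and> \<sigma> = \<sigma>'" using b by (simp add: fun_eq_iff)
  qed
  have tr: "transpose t b j < Suc t" if "b < Suc t" "j < Suc t" for b j
    using that by (auto simp: transpose_def)
  have clb: "\<And>i j. i < t \<Longrightarrow> j < t \<Longrightarrow> A i (transpose t b j) \<in> carrier R" if "b < Suc t" for b
    using cl tr that by auto
  have st: "signed_term (Suc t) A (?h (b, \<sigma>)) = (if b = t then \<one> else \<ominus> \<one>) \<otimes>
     (A t b \<otimes> signed_term t (\<lambda>i j. A i (transpose t b j)) \<sigma>)" if b: "b < Suc t" and \<sigma>: "\<sigma> \<in> ?P" for b \<sigma>
  proof -
    have lt: "\<sigma> i < t" if "i < t" for i using \<sigma> that by (auto dest: permutes_lessThan)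
    have "(\<Otimes>i\<in>{..<Suc t}. A i ((transpose t b \<circ> \<sigma>) i)) = A t b \<otimes> (\<Otimes>i\<in>{..<t}. A i (transpose t b (\<sigma> i)))"
      unfolding ins using cl b \<sigma> lt tr fix_t[OF \<sigma>] by (subst finprod_insert) (auto simp: less_SucI)
    moreover have "evenperm (transpose t b \<circ> \<sigma>) \<longleftrightarrow> ((b = t) \<longleftrightarrow> evenperm \<sigma>)"
      using evenperm_comp[of "transpose t b" \<sigma>] permutes_permutation[of \<sigma> t] \<sigma>
      by (auto simp: evenperm_swap permutation_swap_id)
    moreover have "(\<Otimes>i\<in>{..<t}. A i (transpose t b (\<sigma> i))) \<in> carrier R" "A t b \<in> carrier R"
      using cl b lt tr by (auto simp: less_SucI)
    ultimately show ?thesis unfolding signed_term_def by (auto simp: l_minus r_minus)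
  qed
  have stc: "signed_term t (\<lambda>i j. A i (transpose t b j)) \<sigma> \<in> carrier R" if "b < Suc t" "\<sigma> permutes {..<t}" for b \<sigma>
    using that clb by (intro signed_term_closed) auto
  have stc': "signed_term (Suc t) A \<sigma> \<in> carrier R" if "\<sigma> permutes {..<Suc t}" for \<sigma>
    using that cl by (intro signed_term_closed) auto
  have Atb: "A t b \<in> carrier R" if "b < Suc t" for b using cl that by auto
  have "det_ring R (Suc t) A = (\<Oplus>x\<in>{..<Suc t} \<times> ?P. signed_term (Suc t) A (?h x))"
    unfolding det_ring_signed_term im
  proof (intro finsum_reindex inj)
    show "signed_term (Suc t) A \<in> ?h ` ({..<Suc t} \<times> ?P) \<rightarrow> carrier R"
      unfolding im[symmetric] using stc' by auto
  qed
  also have "\<dots> = (\<Oplus>x\<in>{..<Suc t} \<times> ?P. (if fst x = t then \<one> else \<ominus> \<one>) \<otimes>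
     (A t (fst x) \<otimes> signed_term t (\<lambda>i j. A i (transpose t (fst x) j)) (snd x)))"
  proof (intro finsum_cong')
    fix x assume x: "x \<in> {..<Suc t} \<times> ?P"
    show "signed_term (Suc t) A (?h x) = (if fst x = t then \<one> else \<ominus> \<one>) \<otimes>
     (A t (fst x) \<otimes> signed_term t (\<lambda>i j. A i (transpose t (fst x) j)) (snd x))"
      using st[of "fst x" "snd x"] x by (simp only: prod.collapse) auto
  qed (use stc Atb in \<open>auto intro!: m_closed\<close>)
  also have "\<dots> = (\<Oplus>b\<in>{..<Suc t}. \<Oplus>\<sigma>\<in>?P. (if b = t then \<one> else \<ominus> \<one>) \<otimes>
     (A t b \<otimes> signed_term t (\<lambda>i j. A i (transpose t b j)) \<sigma>))"
    using stc Atb by (subst finsum_product) (auto intro!: m_closed simp: finite_permutations)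
  also have "\<dots> = (\<Oplus>b\<in>{..<Suc t}. (if b = t then \<one> else \<ominus> \<one>) \<otimes>
     (A t b \<otimes> det_ring R t (\<lambda>i j. A i (transpose t b j))))"
  proof (intro finsum_cong')
    fix b assume b: "b \<in> {..<Suc t}"
    have c: "(\<lambda>\<sigma>. signed_term t (\<lambda>i j. A i (transpose t b j)) \<sigma>) \<in> ?P \<rightarrow> carrier R"
      using stc b by auto
    have a: "A t b \<in> carrier R" using cl b by auto
    show "(\<Oplus>\<sigma>\<in>?P. (if b = t then \<one> else \<ominus> \<one>) \<otimes>
     (A t b \<otimes> signed_term t (\<lambda>i j. A i (transpose t b j)) \<sigma>)) = (if b = t then \<one> else \<ominus> \<one>) \<otimes>
     (A t b \<otimes> det_ring R t (\<lambda>i j. A i (transpose t b j)))"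
      unfolding det_ring_signed_term using a c
      by (simp add: finsum_rdistr finite_permutations Pi_def)
  qed (use cl clb in \<open>auto intro!: m_closed det_ring_closed\<close>)
  finally show ?thesis .
qed

section \<open>Minors and pivoting\<close>

text \<open>The index functions are arbitrary, with repetitions and in any order: passing to
  subtuples or appending a pivot row then needs no sorting. The generated ideal is not affected, as
  repetitions give zero and reordering only changes the sign.\<close>

definition tuple_minors :: "(nat \<Rightarrow> nat \<Rightarrow> 'a) \<Rightarrow> nat set \<Rightarrow> nat set \<Rightarrow> nat \<Rightarrow> 'a set" where
  "tuple_minors M A B t =
     {det_ring R t (\<lambda>i j. M (\<rho> i) (\<gamma> j)) | \<rho> \<gamma>. \<rho> ` {..<t} \<subseteq> A \<and> \<gamma> ` {..<t} \<subseteq> B}"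

lemma tuple_minorsI:
  assumes "\<And>i. i < t \<Longrightarrow> \<rho> i \<in> A" "\<And>j. j < t \<Longrightarrow> \<gamma> j \<in> B"
  shows "det_ring R t (\<lambda>i j. M (\<rho> i) (\<gamma> j)) \<in> tuple_minors M A B t"
  using assms unfolding tuple_minors_def by blast

lemma tuple_minorsE:
  assumes "x \<in> tuple_minors M A B t"
  obtains \<rho> \<gamma> where "x = det_ring R t (\<lambda>i j. M (\<rho> i) (\<gamma> j))"
    "\<And>i. i < t \<Longrightarrow> \<rho> i \<in> A" "\<And>j. j < t \<Longrightarrow> \<gamma> j \<in> B"
proof -
  from assms obtain \<rho> \<gamma> where "x = det_ring R t (\<lambda>i j. M (\<rho> i) (\<gamma> j))"
    "\<rho> ` {..<t} \<subseteq> A" "\<gamma> ` {..<t} \<subseteq> B"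
    unfolding tuple_minors_def by auto
  thus thesis using that[of \<rho> \<gamma>] by (auto simp: image_subset_iff)
qed

lemma tuple_minors_carrier:
  assumes "\<And>i j. i \<in> A \<Longrightarrow> j \<in> B \<Longrightarrow> M i j \<in> carrier R"
  shows "tuple_minors M A B t \<subseteq> carrier R"
  using assms unfolding tuple_minors_def by (auto simp: image_subset_iff intro!: det_ring_closed)

lemma det_ring_zero_row:
  assumes "\<And>i j. i < t \<Longrightarrow> j < t \<Longrightarrow> A i j \<in> carrier R" "k < t" "\<And>j. j < t \<Longrightarrow> A k j = \<zero>"
  shows "det_ring R t A = \<zero>"
proof -
  have "det_ring R t A = det_ring R t (A(k := \<lambda>j. \<zero> \<otimes> A k j \<oplus> \<zero> \<otimes> A k j))"
    using assms by (intro det_ring_cong) auto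
  also have "\<dots> = \<zero> \<otimes> det_ring R t (A(k := A k)) \<oplus> \<zero> \<otimes> det_ring R t (A(k := A k))"
    using assms by (intro det_ring_row_linear) auto
  also have "\<dots> = \<zero>" using det_ring_closed[of t A] assms by simp
  finally show ?thesis .
qed

lemma det_ring_zero_column:
  assumes "\<And>i j. i < t \<Longrightarrow> j < t \<Longrightarrow> A i j \<in> carrier R" "k < t" "\<And>i. i < t \<Longrightarrow> A i k = \<zero>"
  shows "det_ring R t A = \<zero>"
  using det_ring_zero_row[of t "\<lambda>i j. A j i" k] det_ring_transpose[of t A] assms by simp

lemma det_ring_row_unit:
  assumes cl: "\<And>i j. i < Suc t \<Longrightarrow> j < Suc t \<Longrightarrow> A i j \<in> carrier R"
    and z: "\<And>j. j < t \<Longrightarrow> A t j = \<zero>"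
  shows "det_ring R (Suc t) A = A t t \<otimes> det_ring R t A"
proof -
  have tr: "transpose t b j < Suc t" if "b < Suc t" "j < Suc t" for b j
    using that by (auto simp: transpose_def)
  have d: "det_ring R t (\<lambda>i j. A i (transpose t b j)) \<in> carrier R" if "b < Suc t" for b
    using cl tr that by (intro det_ring_closed) auto
  have e: "det_ring R t (\<lambda>i j. A i (transpose t t j)) = det_ring R t A"
    using cl by (intro det_ring_cong) auto
  have dA: "det_ring R t A \<in> carrier R" using cl by (intro det_ring_closed) auto
  have ins: "{..<Suc t} = insert t {..<t}" by auto
  have "det_ring R (Suc t) A = (\<Oplus>b\<in>insert t {..<t}. (if b = t then \<one> else \<ominus> \<one>) \<otimes>
     (A t b \<otimes> det_ring R t (\<lambda>i j. A i (transpose t b j))))"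
    using det_ring_laplace[of t A, OF cl] unfolding ins .
  also have "\<dots> = A t t \<otimes> det_ring R t A \<oplus> (\<Oplus>b\<in>{..<t}. (if b = t then \<one> else \<ominus> \<one>) \<otimes>
     (A t b \<otimes> det_ring R t (\<lambda>i j. A i (transpose t b j))))"
    using cl d e dA by (subst finsum_insert) (auto simp: less_SucI)
  also have "(\<Oplus>b\<in>{..<t}. (if b = t then \<one> else \<ominus> \<one>) \<otimes>
     (A t b \<otimes> det_ring R t (\<lambda>i j. A i (transpose t b j)))) = (\<Oplus>b\<in>{..<t}. \<zero>)"
    using d z by (intro finsum_cong') (auto simp: less_SucI)
  finally show ?thesis using cl d[of t] e by simp
qed

lemma finsum_ideal_closed:
  assumes "ideal I R" "finite F" "\<And>x. x \<in> F \<Longrightarrow> f x \<in> I"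
  shows "(\<Oplus>x\<in>F. f x) \<in> I"
proof -
  interpret I: ideal I R by fact
  show ?thesis using assms(2,3)
    by (induction F) (auto simp: I.Icarr Pi_def)
qed

text \<open>Laplace expansion along row k in the form of a membership test. A transposition moves
  row k to the last place and changes the determinant only by a sign, to which ideals are
  insensitive.\<close>

lemma det_ring_laplace_ideal:
  assumes I: "ideal I R" and cl: "\<And>i j. i < Suc t \<Longrightarrow> j < Suc t \<Longrightarrow> A i j \<in> carrier R" and k: "k < Suc t"
    and mem: "\<And>f g. (\<And>i. i < t \<Longrightarrow> f i < Suc t \<and> f i \<noteq> k) \<Longrightarrow> (\<And>j. j < t \<Longrightarrow> g j < Suc t) \<Longrightarrow>
        det_ring R t (\<lambda>i j. A (f i) (g j)) \<in> I"
  shows "det_ring R (Suc t) A \<in> I"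
proof -
  interpret I: ideal I R by fact
  let ?\<tau> = "transpose k t"
  have \<tau>: "?\<tau> permutes {..<Suc t}" using k by (intro permutes_swap_id) auto
  have tr: "transpose t b j < Suc t" if "b < Suc t" "j < Suc t" for b j
    using that by (auto simp: transpose_def)
  have tr2: "?\<tau> i < Suc t" if "i < Suc t" for i
    using that k by (auto simp: transpose_def)
  have "det_ring R (Suc t) (\<lambda>i j. A (?\<tau> i) j) \<in> I"
  proof (subst det_ring_laplace)
    show "(\<Oplus>b\<in>{..<Suc t}. (if b = t then \<one> else \<ominus> \<one>) \<otimes>
     (A (?\<tau> t) b \<otimes> det_ring R t (\<lambda>i j. A (?\<tau> i) (transpose t b j)))) \<in> I"
    proof (rule finsum_ideal_closed[OF I])
      fix b assume b: "b \<in> {..<Suc t}"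
      have "det_ring R t (\<lambda>i j. A (?\<tau> i) (transpose t b j)) \<in> I"
        using b k by (intro mem) (auto simp: transpose_def)
      thus "(if b = t then \<one> else \<ominus> \<one>) \<otimes>
        (A (?\<tau> t) b \<otimes> det_ring R t (\<lambda>i j. A (?\<tau> i) (transpose t b j))) \<in> I"
        using b cl k by (intro I.I_l_closed) auto
    qed simp
  qed (use cl tr2 in auto)
  moreover have "det_ring R (Suc t) A \<in> carrier R" using cl by (rule det_ring_closed)
  ultimately show ?thesis
    using det_ring_permute_rows[of "Suc t" A, OF cl \<tau>] I.a_inv_closed[of "\<ominus> det_ring R (Suc t) A"]
    by (simp split: if_splits)
qed

lemma det_ring_laplace_column_ideal:
  assumes I: "ideal I R" and cl: "\<And>i j. i < Suc t \<Longrightarrow> j < Suc t \<Longrightarrow> A i j \<in> carrier R" and k: "k < Suc t"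
    and mem: "\<And>f g. (\<And>i. i < t \<Longrightarrow> f i < Suc t) \<Longrightarrow> (\<And>j. j < t \<Longrightarrow> g j < Suc t \<and> g j \<noteq> k) \<Longrightarrow>
        det_ring R t (\<lambda>i j. A (f i) (g j)) \<in> I"
  shows "det_ring R (Suc t) A \<in> I"
proof -
  have "det_ring R (Suc t) (\<lambda>i j. A j i) \<in> I"
  proof (rule det_ring_laplace_ideal[OF I _ k])
    fix f g assume f: "\<And>i. i < t \<Longrightarrow> f i < Suc t \<and> f i \<noteq> k" and g: "\<And>j. j < t \<Longrightarrow> g j < Suc t"
    have "det_ring R t (\<lambda>i j. A (g j) (f i)) = det_ring R t (\<lambda>i j. A (g i) (f j))"
      using f g cl by (intro det_ring_transpose[of t "\<lambda>i j. A (g i) (f j)"]) auto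
    thus "det_ring R t (\<lambda>i j. A (g j) (f i)) \<in> I" using mem[of g f] f g by simp
  qed (use cl in auto)
  thus ?thesis using det_ring_transpose[of "Suc t" A] cl by simp
qed

text \<open>The 2 x 2 minor on rows a, i and columns b, j, that is, \<open>M a b\<close> times the
  entry of the Schur complement. It vanishes for i = a and for j = b.\<close>

definition pivoted :: "(nat \<Rightarrow> nat \<Rightarrow> 'a) \<Rightarrow> nat \<Rightarrow> nat \<Rightarrow> nat \<Rightarrow> nat \<Rightarrow> 'a" where
  "pivoted M a b i j = M a b \<otimes> M i j \<ominus> M a j \<otimes> M i b"

lemma pivoted_closed:
  assumes "\<And>i j. i \<in> A \<Longrightarrow> j \<in> B \<Longrightarrow> M i j \<in> carrier R" "a \<in> A" "b \<in> B" "i \<in> A" "j \<in> B"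
  shows "pivoted M a b i j \<in> carrier R"
  using assms unfolding pivoted_def by simp

text \<open>Border the minor by row a and column b and clear the other columns. The pivoted minor
  appears, the last row becomes (0, ..., 0, M a b), and so \<open>M a b\<close> times x equals the
  t-th power of \<open>M a b\<close> times the bordered minor. The factor \<open>M a b\<close> stays
  on the left, since it may be a zero divisor.\<close>

lemma pivot_times_pivoted_minor:
  assumes cl: "\<And>i j. i \<in> A \<Longrightarrow> j \<in> B \<Longrightarrow> M i j \<in> carrier R" and ab: "a \<in> A" "b \<in> B"
    and m: "x \<in> tuple_minors (pivoted M a b) A B t"
  shows "M a b \<otimes> x \<in> Idl (tuple_minors M A B (Suc t))"
proof -
  obtain \<rho> \<gamma> where x: "x = det_ring R t (\<lambda>i j. pivoted M a b (\<rho> i) (\<gamma> j))"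
    and \<rho>: "\<And>i. i < t \<Longrightarrow> \<rho> i \<in> A" and \<gamma>: "\<And>i. i < t \<Longrightarrow> \<gamma> i \<in> B"
    by (rule tuple_minorsE[OF m]) blast
  interpret I: ideal "Idl (tuple_minors M A B (Suc t))" R
    by (intro genideal_ideal tuple_minors_carrier cl)
  let ?\<rho> = "\<rho>(t := a)" and ?\<gamma> = "\<gamma>(t := b)"
  let ?N = "\<lambda>i j. M (?\<rho> i) (?\<gamma> j)"
  have \<rho>': "?\<rho> i \<in> A" if "i < Suc t" for i using \<rho> ab that by (cases "i = t") auto
  have \<gamma>': "?\<gamma> i \<in> B" if "i < Suc t" for i using \<gamma> ab that by (cases "i = t") auto
  have clN: "\<And>i j. i < Suc t \<Longrightarrow> j < Suc t \<Longrightarrow> ?N i j \<in> carrier R" using \<rho>' \<gamma>' cl by blast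
  have u: "M a b \<in> carrier R" using cl ab by simp
  let ?N' = "\<lambda>i j. if j \<in> {..<t} then M a b \<otimes> ?N i j \<ominus> M a (\<gamma> j) \<otimes> ?N i t else ?N i j"
  have "det_ring R (Suc t) ?N' = M a b [^] card {..<t} \<otimes> det_ring R (Suc t) ?N"
    using clN u cl ab \<gamma> by (intro det_ring_column_operations) auto
  moreover have "det_ring R (Suc t) ?N' = ?N' t t \<otimes> det_ring R t ?N'"
  proof (rule det_ring_row_unit)
    show "?N' t j = \<zero>" if "j < t" for j
      using that \<gamma>[OF that] cl ab by (simp add: minus_eq r_neg m_comm)
    show "\<And>i j. i < Suc t \<Longrightarrow> j < Suc t \<Longrightarrow> ?N' i j \<in> carrier R"
      using u \<rho> \<gamma> cl ab by (auto simp: less_Suc_eq)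
  qed
  moreover have "det_ring R t ?N' = x"
    unfolding x using \<rho> \<gamma> cl ab pivoted_closed[of A B M a b]
    by (intro det_ring_cong) (auto simp: pivoted_def)
  moreover have "det_ring R (Suc t) ?N \<in> Idl (tuple_minors M A B (Suc t))"
    using \<rho>' \<gamma>' tuple_minors_carrier[of A B M "Suc t"] cl
    by (intro subsetD[OF genideal_self] tuple_minorsI) auto
  ultimately show ?thesis using u I.I_l_closed[of "det_ring R (Suc t) ?N" "M a b [^] card {..<t}"] by simp
qed

text \<open>The given minor need not involve row a or column b, so it is bordered in a way that does
  not change its value. The exponent \<open>Suc t\<close> counts the columns that are
  cleared.\<close>

lemma minor_times_pivot_power:
  assumes cl: "\<And>i j. i \<in> A \<Longrightarrow> j \<in> B \<Longrightarrow> M i j \<in> carrier R" and ab: "a \<in> A" "b \<in> B"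
    and m: "x \<in> tuple_minors M A B (Suc t)"
  shows "M a b [^] Suc t \<otimes> x \<in> Idl (tuple_minors (pivoted M a b) (A - {a}) (B - {b}) t)"
    (is "_ \<in> ?J")
proof -
  let ?M = "pivoted M a b"
  obtain \<rho> \<gamma> where x: "x = det_ring R (Suc t) (\<lambda>i j. M (\<rho> i) (\<gamma> j))"
    and \<rho>: "\<And>i. i < Suc t \<Longrightarrow> \<rho> i \<in> A" and \<gamma>: "\<And>i. i < Suc t \<Longrightarrow> \<gamma> i \<in> B"
    by (rule tuple_minorsE[OF m]) blast
  have cl': "\<And>i j. i \<in> A \<Longrightarrow> j \<in> B \<Longrightarrow> ?M i j \<in> carrier R"
    using pivoted_closed[of A B M a b] cl ab by blast
  have tmc: "tuple_minors ?M (A - {a}) (B - {b}) t \<subseteq> carrier R"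
    using cl' by (intro tuple_minors_carrier) auto
  have I: "ideal ?J R" using tmc by (rule genideal_ideal)
  interpret I: ideal ?J R by fact
  have u: "M a b \<in> carrier R" using cl ab by simp
  \<comment> \<open>Pivoted entries in row a or column b are zero, so minors that touch them vanish
    and only \<open>A - {a}\<close> and \<open>B - {b}\<close> matter.\<close>
  have sub: "det_ring R t (\<lambda>i j. ?M (f i) (g j)) \<in> ?J"
    if f: "\<And>i. i < t \<Longrightarrow> f i \<in> A" and g: "\<And>i. i < t \<Longrightarrow> g i \<in> B" for f g
  proof (cases "(\<exists>i<t. f i = a) \<or> (\<exists>j<t. g j = b)")
    case True
    hence "det_ring R t (\<lambda>i j. ?M (f i) (g j)) = \<zero>"
    proof
      assume "\<exists>i<t. f i = a"
      then obtain i where "i < t" "f i = a" by auto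
      thus ?thesis using f g cl' cl ab
        by (intro det_ring_zero_row[of t _ i]) (auto simp: pivoted_def minus_eq r_neg m_comm)
    next
      assume "\<exists>j<t. g j = b"
      then obtain j where "j < t" "g j = b" by auto
      thus ?thesis using f g cl' cl ab
        by (intro det_ring_zero_column[of t _ j]) (auto simp: pivoted_def minus_eq r_neg)
    qed
    thus ?thesis by simp
  next
    case False
    thus ?thesis using f g by (intro subsetD[OF genideal_self[OF tmc]] tuple_minorsI) auto
  qed
  have full: "det_ring R (Suc t) (\<lambda>i j. ?M (\<rho> i) (\<gamma> j)) \<in> ?J"
  proof (rule det_ring_laplace_ideal[OF I, of _ _ t])
    fix f g assume "\<And>i. i < t \<Longrightarrow> f i < Suc t \<and> f i \<noteq> t" "\<And>j. j < t \<Longrightarrow> g j < Suc t"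
    thus "det_ring R t (\<lambda>i j. ?M (\<rho> (f i)) (\<gamma> (g j))) \<in> ?J" using \<rho> \<gamma> by (intro sub) auto
  qed (use \<rho> \<gamma> cl' in auto)
  \<comment> \<open>border the minor by the column \<open>b\<close> and the row \<open>(0, \<dots>, 0, 1)\<close>, then clear with column operations\<close>
  let ?N = "\<lambda>i j. if i < Suc t then (if j < Suc t then M (\<rho> i) (\<gamma> j) else M (\<rho> i) b)
                  else (if j < Suc t then \<zero> else \<one>)"
  let ?N' = "\<lambda>i j. if j \<in> {..<Suc t} then M a b \<otimes> ?N i j \<ominus> M a (\<gamma> j) \<otimes> ?N i (Suc t) else ?N i j"
  have clN: "\<And>i j. i < Suc (Suc t) \<Longrightarrow> j < Suc (Suc t) \<Longrightarrow> ?N i j \<in> carrier R"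
    using \<rho> \<gamma> cl ab by auto
  have clN': "\<And>i j. i < Suc (Suc t) \<Longrightarrow> j < Suc (Suc t) \<Longrightarrow> ?N' i j \<in> carrier R"
    using \<rho> \<gamma> cl ab u by auto
  have "det_ring R (Suc (Suc t)) ?N = ?N (Suc t) (Suc t) \<otimes> det_ring R (Suc t) ?N"
    using clN by (intro det_ring_row_unit) auto
  also have "det_ring R (Suc t) ?N = x"
    unfolding x using \<rho> \<gamma> cl by (intro det_ring_cong) auto
  finally have e1: "det_ring R (Suc (Suc t)) ?N = x"
    using \<rho> \<gamma> cl by (simp add: x det_ring_closed)
  have "det_ring R (Suc (Suc t)) ?N' = M a b [^] card {..<Suc t} \<otimes> det_ring R (Suc (Suc t)) ?N"
    using clN u cl ab \<gamma> by (intro det_ring_column_operations) auto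
  hence e2: "det_ring R (Suc (Suc t)) ?N' = M a b [^] Suc t \<otimes> x" unfolding e1 by simp
  have "det_ring R (Suc (Suc t)) ?N' \<in> ?J"
  proof (subst det_ring_laplace)
    show "(\<Oplus>b'\<in>{..<Suc (Suc t)}. (if b' = Suc t then \<one> else \<ominus> \<one>) \<otimes>
     (?N' (Suc t) b' \<otimes> det_ring R (Suc t) (\<lambda>i j. ?N' i (transpose (Suc t) b' j)))) \<in> ?J"
    proof (rule finsum_ideal_closed[OF I])
      fix b' assume b': "b' \<in> {..<Suc (Suc t)}"
      have N'eq: "?N' i j = ?M (\<rho> i) (\<gamma> j)" if "i < Suc t" "j < Suc t" for i j
        using that by (simp add: pivoted_def)
      have trl: "transpose (Suc t) b' j < Suc (Suc t)" if "j < Suc t" for j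
        using that b' by (auto simp: transpose_def)
      have "det_ring R (Suc t) (\<lambda>i j. ?N' i (transpose (Suc t) b' j)) \<in> ?J"
      proof (cases "b' = Suc t")
        case True
        have "det_ring R (Suc t) (\<lambda>i j. ?N' i (transpose (Suc t) b' j)) = det_ring R (Suc t) (\<lambda>i j. ?M (\<rho> i) (\<gamma> j))"
          using True \<rho> \<gamma> cl' N'eq by (intro det_ring_cong) auto
        thus ?thesis using full by simp
      next
        case False
        hence b'': "b' < Suc t" using b' by auto
        \<comment> \<open>Position b' now holds the bordering column \<open>M (\<rho> i) b\<close>,
          the only one that is not pivoted; expanding along it leaves t-minors of pivoted
          entries.\<close>
        show ?thesis
        proof (rule det_ring_laplace_column_ideal[OF I _ b''])
          fix f g assume f: "\<And>i. i < t \<Longrightarrow> f i < Suc t" and g: "\<And>j. j < t \<Longrightarrow> g j < Suc t \<and> g j \<noteq> b'"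
          have tg: "transpose (Suc t) b' (g j) = g j" if "j < t" for j
            using g[OF that] by (auto simp: transpose_def)
          have "det_ring R t (\<lambda>i j. ?N' (f i) (transpose (Suc t) b' (g j))) =
                det_ring R t (\<lambda>i j. ?M (\<rho> (f i)) (\<gamma> (g j)))"
          proof (rule det_ring_cong)
            fix i j assume ij: "i < t" "j < t"
            show "?N' (f i) (transpose (Suc t) b' (g j)) = ?M (\<rho> (f i)) (\<gamma> (g j))"
              unfolding tg[OF ij(2)] using N'eq[of "f i" "g j"] f g ij by blast
            show "?M (\<rho> (f i)) (\<gamma> (g j)) \<in> carrier R" using f g ij \<rho> \<gamma> by (intro cl') auto
          qed
          also have "\<dots> \<in> ?J" using f g \<rho> \<gamma> by (intro sub) auto
          finally show "det_ring R t (\<lambda>i j. ?N' (f i) (transpose (Suc t) b' (g j))) \<in> ?J" .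
        next
          fix i j assume "i < Suc t" "j < Suc t"
          thus "?N' i (transpose (Suc t) b' j) \<in> carrier R"
            using clN'[of i "transpose (Suc t) b' j"] trl by simp
        qed
      qed
      thus "(if b' = Suc t then \<one> else \<ominus> \<one>) \<otimes>
        (?N' (Suc t) b' \<otimes> det_ring R (Suc t) (\<lambda>i j. ?N' i (transpose (Suc t) b' j))) \<in> ?J"
        using b' clN'[of "Suc t" b'] by (intro I.I_l_closed) auto
    qed simp
  qed (use clN' in auto)
  thus ?thesis unfolding e2 .
qed

section \<open>Minors indexed by pairs of subsets\<close>

definition subset_minor :: "(nat \<Rightarrow> nat \<Rightarrow> 'a) \<Rightarrow> nat \<Rightarrow> nat set \<times> nat set \<Rightarrow> 'a" where
  "subset_minor M t UV =
     det_ring R t (\<lambda>i j. M (sorted_list_of_set (fst UV) ! i) (sorted_list_of_set (snd UV) ! j))"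

definition subset_pairs :: "nat set \<Rightarrow> nat set \<Rightarrow> nat \<Rightarrow> (nat set \<times> nat set) set" where
  "subset_pairs A B t = {U. U \<subseteq> A \<and> card U = t} \<times> {V. V \<subseteq> B \<and> card V = t}"

lemma finite_subset_pairs: "finite A \<Longrightarrow> finite B \<Longrightarrow> finite (subset_pairs A B t)"
  unfolding subset_pairs_def by simp

lemma card_subset_pairs:
  "finite A \<Longrightarrow> finite B \<Longrightarrow> card (subset_pairs A B t) = (card A choose t) * (card B choose t)"
  unfolding subset_pairs_def by (simp add: card_cartesian_product n_subsets)

lemma nth_sorted_list_of_subset:
  assumes "finite A" "U \<subseteq> A" "card U = t" "i < t"
  shows "sorted_list_of_set U ! i \<in> A"
proof -
  have "finite U" using assms finite_subset by blast
  thus ?thesis using nth_mem[of i "sorted_list_of_set U"] assms by auto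
qed

lemma subset_minor_tuple:
  assumes "finite A" "finite B" "UV \<in> subset_pairs A B t"
  shows "subset_minor M t UV \<in> tuple_minors M A B t"
  unfolding subset_minor_def using assms nth_sorted_list_of_subset[of A "fst UV" t]
    nth_sorted_list_of_subset[of B "snd UV" t]
  by (intro tuple_minorsI) (auto simp: subset_pairs_def)

lemma sorting_permutation:
  fixes \<rho> :: "nat \<Rightarrow> nat"
  assumes inj: "inj_on \<rho> {..<t}"
  obtains \<tau> where "\<tau> permutes {..<t}" "\<And>i. i < t \<Longrightarrow> sorted_list_of_set (\<rho> ` {..<t}) ! \<tau> i = \<rho> i"
proof -
  let ?l = "sorted_list_of_set (\<rho> ` {..<t})"
  have len: "length ?l = t" using card_image[OF inj] by simp
  have ex: "\<exists>j<t. \<rho> i = ?l ! j" if "i < t" for i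
  proof -
    have "\<rho> i \<in> set ?l" using that by simp
    thus ?thesis unfolding in_set_conv_nth len by metis
  qed
  \<comment> \<open>The position of \<open>\<rho> i\<close> in the sorted list; above t the
    identity, as \<open>permutes\<close> requires.\<close>
  define \<tau> where "\<tau> i = (if i < t then SOME j. j < t \<and> \<rho> i = ?l ! j else i)" for i
  have \<tau>: "\<tau> i < t \<and> \<rho> i = ?l ! \<tau> i" if "i < t" for i
    using someI_ex[OF ex[OF that]] that unfolding \<tau>_def by auto
  have "inj_on \<tau> {..<t}"
    using inj \<tau> unfolding inj_on_def by (metis lessThan_iff)
  moreover have "\<tau> ` {..<t} \<subseteq> {..<t}" using \<tau> by auto
  ultimately have "bij_betw \<tau> {..<t} {..<t}"
    using endo_inj_surj[of "{..<t}" \<tau>] by (simp add: bij_betw_def)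
  then have "\<tau> permutes {..<t}" by (rule bij_imp_permutes) (simp add: \<tau>_def)
  moreover have "?l ! \<tau> i = \<rho> i" if "i < t" for i by (rule conjunct2[OF \<tau>[OF that], symmetric])
  ultimately show thesis by (rule that)
qed

text \<open>A repeated row or column makes the minor vanish; otherwise sorting rows and columns
  changes only its sign. This replaces the redundant tuples by a generating family whose size is a
  product of binomial coefficients.\<close>

lemma tuple_minor_in_subset_ideal:
  assumes fin: "finite A" "finite B" and cl: "\<And>i j. i \<in> A \<Longrightarrow> j \<in> B \<Longrightarrow> M i j \<in> carrier R"
    and mem: "x \<in> tuple_minors M A B t"
  shows "x \<in> Idl (subset_minor M t ` subset_pairs A B t)"
proof -
  let ?S = "subset_minor M t ` subset_pairs A B t"
  obtain \<rho> \<gamma> where x: "x = det_ring R t (\<lambda>i j. M (\<rho> i) (\<gamma> j))"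
    and \<rho>: "\<And>i. i < t \<Longrightarrow> \<rho> i \<in> A" and \<gamma>: "\<And>i. i < t \<Longrightarrow> \<gamma> i \<in> B"
    by (rule tuple_minorsE[OF mem]) blast
  have sc: "?S \<subseteq> carrier R"
    using subset_minor_tuple[OF fin] tuple_minors_carrier[of A B M t] cl by blast
  interpret I: ideal "Idl ?S" R using sc by (rule genideal_ideal)
  show ?thesis
  proof (cases "inj_on \<rho> {..<t} \<and> inj_on \<gamma> {..<t}")
    case True
    obtain \<tau> where \<tau>: "\<tau> permutes {..<t}" "\<And>i. i < t \<Longrightarrow> sorted_list_of_set (\<rho> ` {..<t}) ! \<tau> i = \<rho> i"
      using sorting_permutation True by blast
    obtain \<sigma> where \<sigma>: "\<sigma> permutes {..<t}" "\<And>i. i < t \<Longrightarrow> sorted_list_of_set (\<gamma> ` {..<t}) ! \<sigma> i = \<gamma> i"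
      using sorting_permutation True by blast
    let ?U = "\<rho> ` {..<t}" and ?V = "\<gamma> ` {..<t}"
    let ?u = "\<lambda>i. sorted_list_of_set ?U ! i" and ?v = "\<lambda>i. sorted_list_of_set ?V ! i"
    have UV: "(?U, ?V) \<in> subset_pairs A B t"
      using True \<rho> \<gamma> by (auto simp: subset_pairs_def card_image)
    have u: "?u i \<in> A" "?v i \<in> B" if "i < t" for i
      using nth_sorted_list_of_subset[of A ?U t i] nth_sorted_list_of_subset[of B ?V t i] that fin UV
      by (auto simp: subset_pairs_def)
    have lt: "\<sigma> i < t" "\<tau> i < t" if "i < t" for i
      using permutes_lessThan[OF \<sigma>(1)] permutes_lessThan[OF \<tau>(1)] that by auto
    define D where "D = det_ring R t (\<lambda>i j. M (?u i) (?v j))"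
    have "D = subset_minor M t (?U, ?V)" unfolding D_def subset_minor_def by simp
    hence D: "D \<in> Idl ?S" using UV genideal_self[OF sc] by blast
    have "x = det_ring R t (\<lambda>i j. M (?u (\<tau> i)) (?v (\<sigma> j)))"
      unfolding x using \<tau>(2) \<sigma>(2) \<rho> \<gamma> cl by (intro det_ring_cong) auto
    also have "\<dots> = (if evenperm \<tau> then det_ring R t (\<lambda>i j. M (?u i) (?v (\<sigma> j)))
        else \<ominus> det_ring R t (\<lambda>i j. M (?u i) (?v (\<sigma> j))))"
      by (rule det_ring_permute_rows[of t "\<lambda>i j. M (?u i) (?v (\<sigma> j))", OF _ \<tau>(1)]) (simp add: u lt cl)
    also have "det_ring R t (\<lambda>i j. M (?u i) (?v (\<sigma> j))) = det_ring R t (\<lambda>i j. M (?u j) (?v (\<sigma> i)))"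
      by (rule det_ring_transpose[of t "\<lambda>i j. M (?u j) (?v (\<sigma> i))"]) (simp add: u lt cl)
    also have "\<dots> = (if evenperm \<sigma> then det_ring R t (\<lambda>i j. M (?u j) (?v i))
        else \<ominus> det_ring R t (\<lambda>i j. M (?u j) (?v i)))"
      by (rule det_ring_permute_rows[of t "\<lambda>i j. M (?u j) (?v i)", OF _ \<sigma>(1)]) (simp add: u lt cl)
    also have "det_ring R t (\<lambda>i j. M (?u j) (?v i)) = D"
      unfolding D_def by (rule det_ring_transpose[of t "\<lambda>i j. M (?u i) (?v j)"]) (simp add: u lt cl)
    finally show ?thesis using D by (auto split: if_splits simp: I.a_inv_closed)
  next
    case False
    have "x = \<zero>"
    proof (cases "inj_on \<rho> {..<t}")
      case False
      then obtain i j where "i < t" "j < t" "i \<noteq> j" "\<rho> i = \<rho> j" unfolding inj_on_def by auto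
      thus ?thesis unfolding x using \<rho> \<gamma> cl by (intro det_ring_equal_rows[of t _ i j]) auto
    next
      case True
      then obtain i j where "i < t" "j < t" "i \<noteq> j" "\<gamma> i = \<gamma> j" using False unfolding inj_on_def by auto
      hence "det_ring R t (\<lambda>i j. M (\<rho> j) (\<gamma> i)) = \<zero>"
        using \<rho> \<gamma> cl by (intro det_ring_equal_rows[of t _ i j]) auto
      moreover have "det_ring R t (\<lambda>i j. M (\<rho> j) (\<gamma> i)) = x"
        unfolding x by (rule det_ring_transpose[of t "\<lambda>i j. M (\<rho> i) (\<gamma> j)"]) (simp add: \<rho> \<gamma> cl)
      ultimately show ?thesis by simp
    qed
    thus ?thesis by simp
  qed
qed

lemma Idl_tuple_minors:
  assumes "finite A" "finite B" "\<And>i j. i \<in> A \<Longrightarrow> j \<in> B \<Longrightarrow> M i j \<in> carrier R"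
  shows "Idl (tuple_minors M A B t) = Idl (subset_minor M t ` subset_pairs A B t)"
proof
  have c: "tuple_minors M A B t \<subseteq> carrier R" using assms(3) by (rule tuple_minors_carrier)
  have sub: "subset_minor M t ` subset_pairs A B t \<subseteq> tuple_minors M A B t"
    using subset_minor_tuple[OF assms(1,2)] by blast
  show "Idl (tuple_minors M A B t) \<subseteq> Idl (subset_minor M t ` subset_pairs A B t)"
    using tuple_minor_in_subset_ideal[of A B M] assms sub c by (intro genideal_minimal genideal_ideal) auto
  show "Idl (subset_minor M t ` subset_pairs A B t) \<subseteq> Idl (tuple_minors M A B t)"
    using sub c genideal_self[OF c] by (intro genideal_minimal genideal_ideal) auto
qed

text \<open>The minors with strictly increasing index functions lie between the subset minors and
  the tuple minors, whose ideals agree.\<close>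

lemma Idl_minors:
  assumes "\<And>i j. i < m \<Longrightarrow> j < n \<Longrightarrow> M i j \<in> carrier R"
  shows "Idl (minors R m n t M) = Idl (tuple_minors M {..<m} {..<n} t)"
proof
  have c: "tuple_minors M {..<m} {..<n} t \<subseteq> carrier R" using assms by (intro tuple_minors_carrier) auto
  have sub: "minors R m n t M \<subseteq> tuple_minors M {..<m} {..<n} t"
    unfolding minors_def tuple_minors_def by blast
  show "Idl (minors R m n t M) \<subseteq> Idl (tuple_minors M {..<m} {..<n} t)"
    using sub c genideal_self[OF c] by (intro genideal_minimal genideal_ideal) auto
  have mono: "strict_mono_on {..<t} ((!) (sorted_list_of_set U))" if "finite U" "card U = t" for U :: "nat set"
    using that strict_sorted_list_of_set[of U]
    by (auto simp: strict_mono_on_def sorted_wrt_iff_nth_less)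
  have sub2: "subset_minor M t ` subset_pairs {..<m} {..<n} t \<subseteq> minors R m n t M"
  proof
    fix x assume "x \<in> subset_minor M t ` subset_pairs {..<m} {..<n} t"
    then obtain U V where x: "x = subset_minor M t (U, V)" and UV: "U \<subseteq> {..<m}" "card U = t" "V \<subseteq> {..<n}" "card V = t"
      by (auto simp: subset_pairs_def)
    have fin: "finite U" "finite V" using UV finite_subset by blast+
    have "(!) (sorted_list_of_set U) ` {..<t} \<subseteq> {..<m}" "(!) (sorted_list_of_set V) ` {..<t} \<subseteq> {..<n}"
      using nth_sorted_list_of_subset[of "{..<m}" U t] nth_sorted_list_of_subset[of "{..<n}" V t] UV by auto
    thus "x \<in> minors R m n t M"
      unfolding minors_def x subset_minor_def
      by (intro CollectI exI[of _ "(!) (sorted_list_of_set U)"] exI[of _ "(!) (sorted_list_of_set V)"])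
        (use mono[OF fin(1) UV(2)] mono[OF fin(2) UV(4)] in simp)
  qed
  show "Idl (tuple_minors M {..<m} {..<n} t) \<subseteq> Idl (minors R m n t M)"
  proof (subst Idl_tuple_minors)
    show "Idl (subset_minor M t ` subset_pairs {..<m} {..<n} t) \<subseteq> Idl (minors R m n t M)"
      using sub2 sub c genideal_self[of "minors R m n t M"]
      by (intro genideal_minimal genideal_ideal) auto
  qed (use assms in auto)
qed

section \<open>Linear systems modulo a prime ideal\<close>

text \<open>Gaussian elimination over the domain R/q, carried out with representatives in R and by
  induction on the equations. An equation with all coefficients in q holds automatically; otherwise
  a coefficient outside q serves as pivot and cross multiplication removes its unknown from the
  other equations. The result is used both to find relations between monomials and to compare
  numbers of generators.\<close>

lemma exists_nontrivial_solution_mod_prime: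
  assumes q: "primeideal q R" and K: "finite K" and "finite J" "card K < card J"
    and "\<And>k i. k \<in> K \<Longrightarrow> i \<in> J \<Longrightarrow> c k i \<in> carrier R"
  shows "\<exists>v \<in> J \<rightarrow> carrier R. (\<exists>i\<in>J. v i \<notin> q) \<and> (\<forall>k\<in>K. (\<Oplus>i\<in>J. c k i \<otimes> v i) \<in> q)"
  using K assms(3-5)
proof (induction K arbitrary: J c)
  case empty
  interpret q: primeideal q R by fact
  obtain i where "i \<in> J" using empty by fastforce
  moreover have "\<one> \<notin> q" using q.I_notcarr q.one_imp_carrier by auto
  ultimately show ?case by (intro bexI[of _ "\<lambda>_. \<one>"]) auto
next
  case (insert k0 K)
  interpret q: primeideal q R by fact
  have cl: "\<And>k i. k \<in> insert k0 K \<Longrightarrow> i \<in> J \<Longrightarrow> c k i \<in> carrier R" using insert.prems by blast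
  show ?case
  proof (cases "\<forall>i\<in>J. c k0 i \<in> q")
    case True
    have "card K < card J" using insert by simp
    then obtain v where v: "v \<in> J \<rightarrow> carrier R" "\<exists>i\<in>J. v i \<notin> q" "\<forall>k\<in>K. (\<Oplus>i\<in>J. c k i \<otimes> v i) \<in> q"
      using insert.IH[of J c] insert.prems(1) cl by auto
    have "(\<Oplus>i\<in>J. c k0 i \<otimes> v i) \<in> q"
      using True v(1) insert.prems(1) by (intro finsum_ideal_closed q.I_r_closed q.is_ideal) auto
    thus ?thesis using v by (intro bexI[of _ v]) auto
  next
    case False
    then obtain i0 where i0: "i0 \<in> J" "c k0 i0 \<notin> q" by blast
    let ?p = "c k0 i0" and ?J = "J - {i0}"
    have p: "?p \<in> carrier R" using cl i0 by simp
    have fJ: "finite ?J" using insert.prems by simp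
    have "card K < card ?J" using insert i0 by simp
    moreover have "?p \<otimes> c k i \<ominus> c k i0 \<otimes> c k0 i \<in> carrier R" if "k \<in> K" "i \<in> ?J" for k i
      using that cl i0 by simp
    ultimately obtain v where v: "v \<in> ?J \<rightarrow> carrier R" "\<exists>i\<in>?J. v i \<notin> q"
      "\<forall>k\<in>K. (\<Oplus>i\<in>?J. (?p \<otimes> c k i \<ominus> c k i0 \<otimes> c k0 i) \<otimes> v i) \<in> q"
      using insert.IH[OF fJ, of "\<lambda>k i. ?p \<otimes> c k i \<ominus> c k i0 \<otimes> c k0 i"] by blast
    define s where "s k = (\<Oplus>i\<in>?J. c k i \<otimes> v i)" for k
    have vc: "v i \<in> carrier R" if "i \<in> ?J" for i using v(1) that by auto
    have sc: "s k \<in> carrier R" if "k \<in> insert k0 K" for k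
      unfolding s_def using cl vc that by (intro finsum_closed) auto
    \<comment> \<open>Instead of dividing by the pivot to solve equation \<open>k0\<close> for the
      unknown \<open>i0\<close>, all other unknowns are multiplied by it; as the pivot is outside q,
      an entry of v outside q stays outside.\<close>
    define w where "w i = (if i = i0 then \<ominus> s k0 else ?p \<otimes> v i)" for i
    have wc: "w i \<in> carrier R" if "i \<in> J" for i
      unfolding w_def using vc sc p that by auto
    have sum: "(\<Oplus>i\<in>J. c k i \<otimes> w i) = c k i0 \<otimes> (\<ominus> s k0) \<oplus> ?p \<otimes> s k" if k: "k \<in> insert k0 K" for k
    proof -
      have ckc: "c k i \<in> carrier R" if "i \<in> J" for i using cl k that by blast
      have "J = insert i0 ?J" using i0 by auto
      hence "(\<Oplus>i\<in>J. c k i \<otimes> w i) = (\<Oplus>i\<in>insert i0 ?J. c k i \<otimes> w i)" by simp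
      also have "\<dots> = c k i0 \<otimes> w i0 \<oplus> (\<Oplus>i\<in>?J. c k i \<otimes> w i)"
        using fJ ckc wc i0 by (intro finsum_insert) auto
      also have "(\<Oplus>i\<in>?J. c k i \<otimes> w i) = (\<Oplus>i\<in>?J. ?p \<otimes> (c k i \<otimes> v i))"
        using ckc vc p by (intro finsum_cong') (auto simp: w_def m_lcomm)
      also have "\<dots> = ?p \<otimes> s k"
        unfolding s_def using fJ ckc vc p by (intro finsum_rdistr[symmetric]) auto
      finally show ?thesis by (simp add: w_def)
    qed
    have "(\<Oplus>i\<in>J. c k i \<otimes> w i) \<in> q" if k: "k \<in> K" for k
    proof -
      have ckc: "c k i \<in> carrier R" if "i \<in> J" for i using cl k that by blast
      have c0c: "c k0 i \<in> carrier R" if "i \<in> J" for i using cl that by blast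
      have "(\<Oplus>i\<in>?J. (?p \<otimes> c k i \<ominus> c k i0 \<otimes> c k0 i) \<otimes> v i)
          = (\<Oplus>i\<in>?J. ?p \<otimes> (c k i \<otimes> v i) \<oplus> (\<ominus> c k i0) \<otimes> (c k0 i \<otimes> v i))"
        using ckc c0c vc p i0 by (intro finsum_cong') (auto simp: minus_eq l_distr l_minus m_assoc)
      also have "\<dots> = (\<Oplus>i\<in>?J. ?p \<otimes> (c k i \<otimes> v i)) \<oplus> (\<Oplus>i\<in>?J. (\<ominus> c k i0) \<otimes> (c k0 i \<otimes> v i))"
        using ckc c0c vc p i0 by (intro finsum_addf) auto
      also have "(\<Oplus>i\<in>?J. ?p \<otimes> (c k i \<otimes> v i)) = ?p \<otimes> s k"
        unfolding s_def using fJ ckc vc p by (intro finsum_rdistr[symmetric]) auto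
      also have "(\<Oplus>i\<in>?J. (\<ominus> c k i0) \<otimes> (c k0 i \<otimes> v i)) = (\<ominus> c k i0) \<otimes> s k0"
        unfolding s_def using fJ ckc c0c vc p i0 by (intro finsum_rdistr[symmetric]) auto
      finally have "?p \<otimes> s k \<oplus> (\<ominus> c k i0) \<otimes> s k0 \<in> q" using v(3) k by (metis (no_types, lifting))
      moreover have "c k i0 \<in> carrier R" using ckc i0 by simp
      ultimately show ?thesis using sum[of k] k sc p by (simp add: l_minus r_minus a_comm)
    qed
    moreover have "(\<Oplus>i\<in>J. c k0 i \<otimes> w i) \<in> q"
      using sum[of k0] sc[of k0] p by (simp add: r_minus l_neg)
    moreover have "\<exists>i\<in>J. w i \<notin> q"
    proof -
      obtain i where i: "i \<in> ?J" "v i \<notin> q" using v(2) by blast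
      hence "w i \<notin> q" using q.I_prime[of ?p "v i"] p vc i0 by (auto simp: w_def)
      thus ?thesis using i by blast
    qed
    ultimately show ?thesis using wc by (intro bexI[of _ w]) auto
  qed
qed

end

section \<open>Localization at a prime ideal\<close>

text \<open>The operations of \<open>localization\<close> are unions over all representatives of two
  classes; once the result is independent of the representatives, the union collapses to a single
  class.\<close>

lemma UN_constant_on:
  assumes "x0 \<in> A" "\<And>x. x \<in> A \<Longrightarrow> f x = c" shows "(\<Union>x\<in>A. f x) = c"
  using assms by auto

context primeideal begin

abbreviation loc_denominators :: "'a set" where "loc_denominators \<equiv> carrier R - I"
abbreviation loc :: "('a \<times> 'a) set ring" where "loc \<equiv> localization R I"
abbreviation frac :: "'a \<Rightarrow> 'a \<Rightarrow> ('a \<times> 'a) set" where "frac \<equiv> loc_frac R I"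
abbreviation emb :: "'a \<Rightarrow> ('a \<times> 'a) set" where "emb a \<equiv> frac a \<one>"

lemma one_denominator: "\<one> \<in> loc_denominators"
  using I_notcarr one_imp_carrier by auto

lemma mult_denominator: "s \<in> loc_denominators \<Longrightarrow> t \<in> loc_denominators \<Longrightarrow> s \<otimes> t \<in> loc_denominators"
  using I_prime by auto

text \<open>The middle denominator t enters the multiplier because it need not be
  cancellable.\<close>

lemma loc_rel_trans:
  assumes "a \<in> carrier R" "b \<in> carrier R" "c \<in> carrier R"
    "s \<in> loc_denominators" "t \<in> loc_denominators" "w \<in> loc_denominators"
    "u \<in> loc_denominators" "v \<in> loc_denominators"
    and 1: "u \<otimes> (a \<otimes> t) = u \<otimes> (b \<otimes> s)" and 2: "v \<otimes> (b \<otimes> w) = v \<otimes> (c \<otimes> t)"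
  shows "(u \<otimes> v \<otimes> t) \<otimes> (a \<otimes> w) = (u \<otimes> v \<otimes> t) \<otimes> (c \<otimes> s)"
proof -
  have "(u \<otimes> v \<otimes> t) \<otimes> (a \<otimes> w) = v \<otimes> w \<otimes> (u \<otimes> (a \<otimes> t))" using assms(1-8) by (simp add: m_ac)
  also have "\<dots> = u \<otimes> s \<otimes> (v \<otimes> (b \<otimes> w))" unfolding 1 using assms(1-8) by (simp add: m_ac)
  also have "\<dots> = (u \<otimes> v \<otimes> t) \<otimes> (c \<otimes> s)" unfolding 2 using assms(1-8) by (simp add: m_ac)
  finally show ?thesis .
qed

lemma equiv_loc_rel: "equiv (carrier R \<times> loc_denominators) (loc_rel R I)"
proof (rule equivI)
  show "loc_rel R I \<subseteq> (carrier R \<times> loc_denominators) \<times> (carrier R \<times> loc_denominators)"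
    unfolding loc_rel_def by auto
  show "refl_on (carrier R \<times> loc_denominators) (loc_rel R I)"
    unfolding loc_rel_def refl_on_def using one_denominator by auto
  show "sym (loc_rel R I)"
    unfolding loc_rel_def sym_def by (auto, metis DiffI)
  show "trans (loc_rel R I)"
  proof (rule transI, clarify)
    fix a s b t c w
    assume "((a, s), (b, t)) \<in> loc_rel R I" "((b, t), (c, w)) \<in> loc_rel R I"
    then obtain u v where c: "a \<in> carrier R" "b \<in> carrier R" "c \<in> carrier R"
      "s \<in> loc_denominators" "t \<in> loc_denominators" "w \<in> loc_denominators" "u \<in> loc_denominators" "v \<in> loc_denominators"
      "u \<otimes> (a \<otimes> t) = u \<otimes> (b \<otimes> s)" "v \<otimes> (b \<otimes> w) = v \<otimes> (c \<otimes> t)"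
      unfolding loc_rel_def by auto
    from loc_rel_trans[OF c] mult_denominator[OF mult_denominator[OF c(7,8)] c(5)] c(1-6)
    show "((a, s), (c, w)) \<in> loc_rel R I" unfolding loc_rel_def by blast
  qed
qed

lemma frac_eq_iff:
  assumes "a \<in> carrier R" "b \<in> carrier R" "s \<in> loc_denominators" "t \<in> loc_denominators"
  shows "frac a s = frac b t \<longleftrightarrow> (\<exists>u\<in>loc_denominators. u \<otimes> (a \<otimes> t) = u \<otimes> (b \<otimes> s))"
proof -
  have "frac a s = frac b t \<longleftrightarrow> ((a, s), (b, t)) \<in> loc_rel R I"
    unfolding loc_frac_def using equiv_loc_rel assms by (intro eq_equiv_class_iff) auto
  thus ?thesis unfolding loc_rel_def using assms by auto
qed

lemma frac_eqI:
  assumes "a \<in> carrier R" "b \<in> carrier R" "s \<in> loc_denominators" "t \<in> loc_denominators" "a \<otimes> t = b \<otimes> s"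
  shows "frac a s = frac b t"
  using assms one_denominator by (subst frac_eq_iff) auto

lemma frac_mem_iff: "(b, t) \<in> frac a s \<longleftrightarrow> a \<in> carrier R \<and> b \<in> carrier R \<and> s \<in> loc_denominators \<and>
    t \<in> loc_denominators \<and> (\<exists>u\<in>loc_denominators. u \<otimes> (a \<otimes> t) = u \<otimes> (b \<otimes> s))"
  unfolding loc_frac_def loc_rel_def by auto

lemma frac_self: "a \<in> carrier R \<Longrightarrow> s \<in> loc_denominators \<Longrightarrow> (a, s) \<in> frac a s"
  unfolding frac_mem_iff using one_denominator by auto

lemma loc_carrier: "carrier loc = {frac a s | a s. a \<in> carrier R \<and> s \<in> loc_denominators}"
  unfolding localization_def quotient_def loc_frac_def by auto

lemma frac_closed: "a \<in> carrier R \<Longrightarrow> s \<in> loc_denominators \<Longrightarrow> frac a s \<in> carrier loc"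
  unfolding loc_carrier by blast

lemma loc_cases:
  assumes "x \<in> carrier loc"
  obtains a s where "x = frac a s" "a \<in> carrier R" "s \<in> loc_denominators"
  using assms unfolding loc_carrier by blast

lemma frac_mult:
  assumes a: "a \<in> carrier R" "s \<in> loc_denominators" and b: "b \<in> carrier R" "t \<in> loc_denominators"
  shows "frac a s \<otimes>\<^bsub>loc\<^esub> frac b t = frac (a \<otimes> b) (s \<otimes> t)"
proof -
  have "frac (a' \<otimes> b') (s' \<otimes> t') = frac (a \<otimes> b) (s \<otimes> t)"
    if "(a', s') \<in> frac a s" "(b', t') \<in> frac b t" for a' s' b' t'
  proof -
    from that obtain u v where c: "a' \<in> carrier R" "b' \<in> carrier R" "s' \<in> loc_denominators" "t' \<in> loc_denominators"
      "u \<in> loc_denominators" "v \<in> loc_denominators"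
      and 1: "u \<otimes> (a \<otimes> s') = u \<otimes> (a' \<otimes> s)" and 2: "v \<otimes> (b \<otimes> t') = v \<otimes> (b' \<otimes> t)"
      unfolding frac_mem_iff by blast
    have "(u \<otimes> v) \<otimes> ((a' \<otimes> b') \<otimes> (s \<otimes> t)) = (u \<otimes> (a' \<otimes> s)) \<otimes> (v \<otimes> (b' \<otimes> t))"
      using a b c by (simp add: m_ac)
    also have "\<dots> = (u \<otimes> v) \<otimes> ((a \<otimes> b) \<otimes> (s' \<otimes> t'))"
      unfolding 1[symmetric] 2[symmetric] using a b c by (simp add: m_ac)
    finally show ?thesis
      using frac_eq_iff[of "a' \<otimes> b'" "a \<otimes> b" "s' \<otimes> t'" "s \<otimes> t"] mult_denominator a b c
      by (metis m_closed)
  qed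
  hence "(\<Union>(b', t')\<in>frac b t. frac (a' \<otimes> b') (s' \<otimes> t')) = frac (a \<otimes> b) (s \<otimes> t)"
    if "(a', s') \<in> frac a s" for a' s'
    using frac_self[OF b] that by (intro UN_constant_on) auto
  thus ?thesis unfolding localization_def using frac_self[OF a]
    by (simp, intro UN_constant_on) auto
qed

lemma frac_add:
  assumes a: "a \<in> carrier R" "s \<in> loc_denominators" and b: "b \<in> carrier R" "t \<in> loc_denominators"
  shows "frac a s \<oplus>\<^bsub>loc\<^esub> frac b t = frac (a \<otimes> t \<oplus> b \<otimes> s) (s \<otimes> t)"
proof -
  have "frac (a' \<otimes> t' \<oplus> b' \<otimes> s') (s' \<otimes> t') = frac (a \<otimes> t \<oplus> b \<otimes> s) (s \<otimes> t)"
    if "(a', s') \<in> frac a s" "(b', t') \<in> frac b t" for a' s' b' t'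
  proof -
    from that obtain u v where c: "a' \<in> carrier R" "b' \<in> carrier R" "s' \<in> loc_denominators" "t' \<in> loc_denominators"
      "u \<in> loc_denominators" "v \<in> loc_denominators"
      and 1: "u \<otimes> (a \<otimes> s') = u \<otimes> (a' \<otimes> s)" and 2: "v \<otimes> (b \<otimes> t') = v \<otimes> (b' \<otimes> t)"
      unfolding frac_mem_iff by blast
    have "(u \<otimes> v) \<otimes> ((a' \<otimes> t' \<oplus> b' \<otimes> s') \<otimes> (s \<otimes> t)) =
        v \<otimes> t \<otimes> t' \<otimes> (u \<otimes> (a' \<otimes> s)) \<oplus> u \<otimes> s \<otimes> s' \<otimes> (v \<otimes> (b' \<otimes> t))"
      using a b c by (simp add: m_ac l_distr r_distr)
    also have "\<dots> = (u \<otimes> v) \<otimes> ((a \<otimes> t \<oplus> b \<otimes> s) \<otimes> (s' \<otimes> t'))"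
      unfolding 1[symmetric] 2[symmetric] using a b c by (simp add: m_ac l_distr r_distr)
    finally show ?thesis
      using frac_eq_iff[of "a' \<otimes> t' \<oplus> b' \<otimes> s'" "a \<otimes> t \<oplus> b \<otimes> s" "s' \<otimes> t'" "s \<otimes> t"] mult_denominator a b c
      by (metis DiffD1 add.m_closed m_closed)
  qed
  hence "(\<Union>(b', t')\<in>frac b t. frac (a' \<otimes> t' \<oplus> b' \<otimes> s') (s' \<otimes> t')) = frac (a \<otimes> t \<oplus> b \<otimes> s) (s \<otimes> t)"
    if "(a', s') \<in> frac a s" for a' s'
    using frac_self[OF b] that by (intro UN_constant_on) auto
  thus ?thesis unfolding localization_def using frac_self[OF a]
    by (simp, intro UN_constant_on) auto
qed

lemma loc_one: "\<one>\<^bsub>loc\<^esub> = frac \<one> \<one>" and loc_zero: "\<zero>\<^bsub>loc\<^esub> = frac \<zero> \<one>"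
  unfolding localization_def by simp_all

lemma loc_cring: "cring loc"
proof (rule cringI)
  show "abelian_group loc"
  proof (rule abelian_groupI)
    fix x y z assume x: "x \<in> carrier loc" and y: "y \<in> carrier loc"
    then obtain a s b t where e: "x = frac a s" "y = frac b t"
      and c: "a \<in> carrier R" "s \<in> loc_denominators" "b \<in> carrier R" "t \<in> loc_denominators"
      by (elim loc_cases) blast
    show "x \<oplus>\<^bsub>loc\<^esub> y \<in> carrier loc"
      unfolding e frac_add[OF c] using c mult_denominator[of s t] by (intro frac_closed) auto
    show "x \<oplus>\<^bsub>loc\<^esub> y = y \<oplus>\<^bsub>loc\<^esub> x"
      unfolding e using c by (simp add: frac_add a_comm m_comm)
    { assume z: "z \<in> carrier loc"
      then obtain d w where ez: "z = frac d w" and cz: "d \<in> carrier R" "w \<in> loc_denominators"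
        by (elim loc_cases) blast
      show "x \<oplus>\<^bsub>loc\<^esub> y \<oplus>\<^bsub>loc\<^esub> z = x \<oplus>\<^bsub>loc\<^esub> (y \<oplus>\<^bsub>loc\<^esub> z)"
        unfolding e ez using c cz mult_denominator[of s t] mult_denominator[of t w]
        by (simp add: frac_add m_ac l_distr r_distr a_ac) }
  next
    show "\<zero>\<^bsub>loc\<^esub> \<in> carrier loc" unfolding loc_zero using one_denominator by (intro frac_closed) auto
  next
    fix x assume "x \<in> carrier loc"
    then obtain a s where e: "x = frac a s" and c: "a \<in> carrier R" "s \<in> loc_denominators"
      by (elim loc_cases) blast
    show "\<zero>\<^bsub>loc\<^esub> \<oplus>\<^bsub>loc\<^esub> x = x"
      unfolding e loc_zero using c one_denominator by (subst frac_add) auto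
    have "frac (\<ominus> a) s \<oplus>\<^bsub>loc\<^esub> x = frac ((\<ominus> a) \<otimes> s \<oplus> a \<otimes> s) (s \<otimes> s)"
      unfolding e using c by (intro frac_add) auto
    also have "\<dots> = \<zero>\<^bsub>loc\<^esub>"
      unfolding loc_zero using c one_denominator mult_denominator[of s s]
      by (intro frac_eqI) (auto simp: l_minus l_neg)
    finally show "\<exists>y\<in>carrier loc. y \<oplus>\<^bsub>loc\<^esub> x = \<zero>\<^bsub>loc\<^esub>" using c frac_closed[of "\<ominus> a" s] by blast
  qed
  show "comm_monoid loc"
  proof (rule comm_monoidI)
    fix x y z assume x: "x \<in> carrier loc" and y: "y \<in> carrier loc"
    then obtain a s b t where e: "x = frac a s" "y = frac b t"
      and c: "a \<in> carrier R" "s \<in> loc_denominators" "b \<in> carrier R" "t \<in> loc_denominators"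
      by (elim loc_cases) blast
    show "x \<otimes>\<^bsub>loc\<^esub> y \<in> carrier loc"
      unfolding e frac_mult[OF c] using c mult_denominator[of s t] by (intro frac_closed) auto
    show "x \<otimes>\<^bsub>loc\<^esub> y = y \<otimes>\<^bsub>loc\<^esub> x"
      unfolding e using c by (simp add: frac_mult m_comm)
    { assume z: "z \<in> carrier loc"
      then obtain d w where ez: "z = frac d w" and cz: "d \<in> carrier R" "w \<in> loc_denominators"
        by (elim loc_cases) blast
      show "x \<otimes>\<^bsub>loc\<^esub> y \<otimes>\<^bsub>loc\<^esub> z = x \<otimes>\<^bsub>loc\<^esub> (y \<otimes>\<^bsub>loc\<^esub> z)"
        unfolding e ez using c cz mult_denominator[of s t] mult_denominator[of t w]
        by (simp add: frac_mult m_ac) }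
  next
    show "\<one>\<^bsub>loc\<^esub> \<in> carrier loc" unfolding loc_one using one_denominator by (intro frac_closed) auto
  next
    fix x assume "x \<in> carrier loc"
    then obtain a s where e: "x = frac a s" and c: "a \<in> carrier R" "s \<in> loc_denominators"
      by (elim loc_cases) blast
    show "\<one>\<^bsub>loc\<^esub> \<otimes>\<^bsub>loc\<^esub> x = x"
      unfolding e loc_one using c one_denominator by (subst frac_mult) auto
  qed
  fix x y z assume x: "x \<in> carrier loc" "y \<in> carrier loc" "z \<in> carrier loc"
  then obtain a s b t d w where e: "x = frac a s" "y = frac b t" "z = frac d w"
    and c: "a \<in> carrier R" "s \<in> loc_denominators" "b \<in> carrier R" "t \<in> loc_denominators" "d \<in> carrier R" "w \<in> loc_denominators"
    by (elim loc_cases) blast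
  have m: "s \<otimes> t \<in> loc_denominators" "s \<otimes> w \<in> loc_denominators" "t \<otimes> w \<in> loc_denominators"
     "s \<otimes> t \<otimes> w \<in> loc_denominators" "s \<otimes> w \<otimes> (t \<otimes> w) \<in> loc_denominators"
    using c mult_denominator by metis+
  have "(x \<oplus>\<^bsub>loc\<^esub> y) \<otimes>\<^bsub>loc\<^esub> z = frac ((a \<otimes> t \<oplus> b \<otimes> s) \<otimes> d) (s \<otimes> t \<otimes> w)"
    unfolding e using c m by (simp add: frac_add frac_mult)
  also have "\<dots> = frac (a \<otimes> d \<otimes> (t \<otimes> w) \<oplus> b \<otimes> d \<otimes> (s \<otimes> w)) (s \<otimes> w \<otimes> (t \<otimes> w))"
    using c m by (intro frac_eqI) (auto simp: m_ac l_distr r_distr)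
  also have "\<dots> = x \<otimes>\<^bsub>loc\<^esub> z \<oplus>\<^bsub>loc\<^esub> y \<otimes>\<^bsub>loc\<^esub> z"
    unfolding e using c m by (simp add: frac_add frac_mult)
  finally show "(x \<oplus>\<^bsub>loc\<^esub> y) \<otimes>\<^bsub>loc\<^esub> z = x \<otimes>\<^bsub>loc\<^esub> z \<oplus>\<^bsub>loc\<^esub> y \<otimes>\<^bsub>loc\<^esub> z" .
qed

lemma emb_hom: "ring_hom_cring R loc emb"
proof (rule ring_hom_cringI[OF is_cring loc_cring], rule ring_hom_memI)
  fix x y assume "x \<in> carrier R" "y \<in> carrier R"
  thus "emb (x \<otimes> y) = emb x \<otimes>\<^bsub>loc\<^esub> emb y" "emb (x \<oplus> y) = emb x \<oplus>\<^bsub>loc\<^esub> emb y"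
    using one_denominator by (simp_all add: frac_mult frac_add)
qed (use one_denominator frac_closed loc_one in auto)

lemma emb_closed: "a \<in> carrier R \<Longrightarrow> emb a \<in> carrier loc"
  using one_denominator by (auto intro: frac_closed)

lemma frac_eq_emb_mult:
  assumes "a \<in> carrier R" "s \<in> loc_denominators"
  shows "frac a s = emb a \<otimes>\<^bsub>loc\<^esub> frac \<one> s"
  using assms one_denominator by (simp add: frac_mult)

lemma emb_denominator_mult:
  assumes "a \<in> carrier R" "s \<in> loc_denominators"
  shows "emb s \<otimes>\<^bsub>loc\<^esub> frac a s = emb a"
proof -
  have "emb s \<otimes>\<^bsub>loc\<^esub> frac a s = frac (s \<otimes> a) (\<one> \<otimes> s)"
    using assms one_denominator by (intro frac_mult) auto
  also have "\<dots> = emb a" using assms one_denominator by (intro frac_eqI) (auto simp: m_ac)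
  finally show ?thesis .
qed

lemma emb_eq_zero_iff:
  assumes "a \<in> carrier R"
  shows "emb a = \<zero>\<^bsub>loc\<^esub> \<longleftrightarrow> (\<exists>u\<in>loc_denominators. u \<otimes> a = \<zero>)"
  unfolding loc_zero using assms one_denominator by (subst frac_eq_iff) auto

lemma frac_mem_ideal_iff:
  assumes "ideal J loc" "a \<in> carrier R" "s \<in> loc_denominators"
  shows "frac a s \<in> J \<longleftrightarrow> emb a \<in> J"
proof -
  interpret J: ideal J loc by fact
  have "emb s \<in> carrier loc" "frac \<one> s \<in> carrier loc" using assms emb_closed frac_closed by auto
  thus ?thesis using J.I_l_closed J.I_r_closed emb_denominator_mult[OF assms(2,3)] frac_eq_emb_mult[OF assms(2,3)]
    by metis
qed

definition extended_prime :: "'a set \<Rightarrow> ('a \<times> 'a) set set" where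
  "extended_prime P = {frac a s | a s. a \<in> P \<and> s \<in> loc_denominators}"

text \<open>Denominators avoid P because P \<subseteq> I, so membership can be read off any
  representative of the fraction.\<close>

lemma frac_mem_extended_prime_iff:
  assumes P: "primeideal P R" "P \<subseteq> I" and a: "a \<in> carrier R" "s \<in> loc_denominators"
  shows "frac a s \<in> extended_prime P \<longleftrightarrow> a \<in> P"
proof
  interpret P: primeideal P R by fact
  assume "frac a s \<in> extended_prime P"
  then obtain b t where "frac a s = frac b t" and b: "b \<in> P" "t \<in> loc_denominators"
    unfolding extended_prime_def by blast
  moreover have "b \<in> carrier R" using b P.a_subset by blast
  ultimately obtain u where u: "u \<in> loc_denominators" "u \<otimes> (a \<otimes> t) = u \<otimes> (b \<otimes> s)"
    using frac_eq_iff[of a b s t] a by blast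
  have "u \<otimes> (b \<otimes> s) \<in> P" using u b a by (intro P.I_l_closed P.I_r_closed) auto
  hence "u \<otimes> (a \<otimes> t) \<in> P" using u(2) by simp
  moreover have "u \<notin> P" "t \<notin> P" using u b P(2) by auto
  ultimately show "a \<in> P" using P.I_prime[of u "a \<otimes> t"] P.I_prime[of a t] u b a by auto
qed (use a in \<open>auto simp: extended_prime_def\<close>)

lemma extended_prime:
  assumes P: "primeideal P R" "P \<subseteq> I"
  shows "primeideal (extended_prime P) loc"
proof -
  interpret P: primeideal P R by fact
  interpret L: cring loc by (rule loc_cring)
  note mem = frac_mem_extended_prime_iff[OF P]
  have sub: "extended_prime P \<subseteq> carrier loc"
    unfolding extended_prime_def using P.a_subset by (auto intro!: frac_closed)
  have id: "ideal (extended_prime P) loc"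
  proof (rule idealI)
    show "ring loc" by (rule L.ring_axioms)
    show "subgroup (extended_prime P) (add_monoid loc)"
    proof (rule L.add.subgroupI)
      show "extended_prime P \<subseteq> carrier loc" by (rule sub)
      show "extended_prime P \<noteq> {}" unfolding extended_prime_def using P.zero_closed one_denominator by blast
      fix x assume "x \<in> extended_prime P"
      then obtain a s where x: "x = frac a s" "a \<in> P" "s \<in> loc_denominators" unfolding extended_prime_def by blast
      have ac: "a \<in> carrier R" using x P.a_subset by blast
      have "\<ominus>\<^bsub>loc\<^esub> x = frac (\<ominus> a) s"
      proof (rule L.minus_equality)
        have "frac (\<ominus> a) s \<oplus>\<^bsub>loc\<^esub> x = frac ((\<ominus> a) \<otimes> s \<oplus> a \<otimes> s) (s \<otimes> s)"
          unfolding x(1) using x ac by (intro frac_add) auto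
        also have "\<dots> = \<zero>\<^bsub>loc\<^esub>"
          unfolding loc_zero using x ac one_denominator mult_denominator[of s s]
          by (intro frac_eqI) (auto simp: l_minus l_neg)
        finally show "frac (\<ominus> a) s \<oplus>\<^bsub>loc\<^esub> x = \<zero>\<^bsub>loc\<^esub>" .
      qed (use x ac sub frac_closed in auto)
      thus "\<ominus>\<^bsub>loc\<^esub> x \<in> extended_prime P" using mem[of "\<ominus> a" s] x ac by auto
      fix y assume "y \<in> extended_prime P"
      then obtain b t where y: "y = frac b t" "b \<in> P" "t \<in> loc_denominators" unfolding extended_prime_def by blast
      have bc: "b \<in> carrier R" using y P.a_subset by blast
      have "x \<oplus>\<^bsub>loc\<^esub> y = frac (a \<otimes> t \<oplus> b \<otimes> s) (s \<otimes> t)"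
        unfolding x(1) y(1) using x ac y bc by (intro frac_add) auto
      moreover have "a \<otimes> t \<oplus> b \<otimes> s \<in> P"
        using x y by (intro P.a_closed P.I_r_closed) auto
      ultimately show "x \<oplus>\<^bsub>loc\<^esub> y \<in> extended_prime P"
        unfolding extended_prime_def using mult_denominator[OF x(3) y(3)] by blast
    qed
    fix x y assume "x \<in> extended_prime P" and y: "y \<in> carrier loc"
    then obtain a s b t where x: "x = frac a s" "a \<in> P" "s \<in> loc_denominators"
      and y: "y = frac b t" "b \<in> carrier R" "t \<in> loc_denominators"
      unfolding extended_prime_def by (elim loc_cases) blast
    have ac: "a \<in> carrier R" using x P.a_subset by blast
    have "x \<otimes>\<^bsub>loc\<^esub> y = frac (a \<otimes> b) (s \<otimes> t)" unfolding x(1) y(1) using x y ac by (intro frac_mult) auto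
    moreover have "a \<otimes> b \<in> P" using x y by (intro P.I_r_closed) auto
    ultimately show "x \<otimes>\<^bsub>loc\<^esub> y \<in> extended_prime P"
      unfolding extended_prime_def using mult_denominator[OF x(3) y(3)] by blast
    thus "y \<otimes>\<^bsub>loc\<^esub> x \<in> extended_prime P"
      using L.m_comm[of x y] x y ac frac_closed by simp
  qed
  show ?thesis
  proof (rule primeidealI[OF id loc_cring])
    have "emb \<one> \<notin> extended_prime P"
      using mem[of \<one> \<one>] one_denominator P(2) by auto
    thus "carrier loc \<noteq> extended_prime P" using emb_closed[OF one_closed] by blast
    fix x y assume "x \<in> carrier loc" "y \<in> carrier loc" and xy: "x \<otimes>\<^bsub>loc\<^esub> y \<in> extended_prime P"
    then obtain a s b t where x: "x = frac a s" "a \<in> carrier R" "s \<in> loc_denominators"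
      and y: "y = frac b t" "b \<in> carrier R" "t \<in> loc_denominators" by (elim loc_cases) blast
    have "a \<otimes> b \<in> P"
      using xy mem[of "a \<otimes> b" "s \<otimes> t"] mult_denominator[of s t] x y frac_mult[of a s b t] by auto
    thus "x \<in> extended_prime P \<or> y \<in> extended_prime P"
      using P.I_prime[of a b] mem x y by auto
  qed
qed

lemma contracted_prime:
  assumes "primeideal Q loc"
  shows "primeideal {a \<in> carrier R. emb a \<in> Q} R" "{a \<in> carrier R. emb a \<in> Q} \<subseteq> I"
proof -
  interpret Q: primeideal Q loc by fact
  interpret h: ring_hom_cring R loc emb by (rule emb_hom)
  show "{a \<in> carrier R. emb a \<in> Q} \<subseteq> I"
  proof (rule ccontr)
    assume "\<not> {a \<in> carrier R. emb a \<in> Q} \<subseteq> I"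
    then obtain s where s: "s \<in> loc_denominators" "emb s \<in> Q" by blast
    have "emb s \<otimes>\<^bsub>loc\<^esub> frac \<one> s \<in> Q" using s frac_closed[of \<one> s] by (intro Q.I_r_closed) auto
    moreover have "emb s \<otimes>\<^bsub>loc\<^esub> frac \<one> s = \<one>\<^bsub>loc\<^esub>"
      unfolding loc_one using s by (intro emb_denominator_mult) auto
    ultimately have "\<one>\<^bsub>loc\<^esub> \<in> Q" by (simp only:)
    thus False using Q.one_imp_carrier Q.I_notcarr by simp
  qed
  show "primeideal {a \<in> carrier R. emb a \<in> Q} R"
    by (rule h.ring.primeideal_vimage[OF is_cring Q.primeideal_axioms])
qed

text \<open>Together with \<open>krull_dim_loc_le\<close> this reduces the dimension of the
  localization to chains of primes of R inside I, so that all chains below are built and bounded in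
  R itself.\<close>

lemma krull_dim_loc_ge:
  assumes "\<And>i. i \<le> k \<Longrightarrow> primeideal (c i) R" "\<And>i. i \<le> k \<Longrightarrow> c i \<subseteq> I" "\<And>i. i < k \<Longrightarrow> c i \<subset> c (Suc i)"
  shows "enat k \<le> krull_dim loc"
  unfolding krull_dim_def
proof (intro Sup_upper CollectI exI[of _ k] exI[of _ "\<lambda>i. extended_prime (c i)"] conjI allI impI refl)
  fix i assume "i \<le> k" thus "primeideal (extended_prime (c i)) loc" using assms by (intro extended_prime) auto
next
  fix i assume i: "i < k"
  interpret P: primeideal "c (Suc i)" R using i assms by auto
  have 1: "extended_prime (c i) \<subseteq> extended_prime (c (Suc i))"
    unfolding extended_prime_def using assms(3)[OF i] by blast
  obtain a where a: "a \<in> c (Suc i)" "a \<notin> c i" using assms(3)[OF i] by blast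
  have "a \<in> carrier R" using a P.a_subset by blast
  hence "emb a \<in> extended_prime (c (Suc i))" "emb a \<notin> extended_prime (c i)"
    using frac_mem_extended_prime_iff[of _ a \<one>] assms i a one_denominator by auto
  thus "extended_prime (c i) \<subset> extended_prime (c (Suc i))" using 1 by blast
qed

text \<open>Contraction keeps inclusions strict: a fraction and its numerator lie in the same ideals
  of the localization.\<close>

lemma krull_dim_loc_le:
  assumes "\<And>k c. (\<And>i. i \<le> k \<Longrightarrow> primeideal (c i) R) \<Longrightarrow> (\<And>i. i \<le> k \<Longrightarrow> c i \<subseteq> I) \<Longrightarrow>
     (\<And>i. i < k \<Longrightarrow> c i \<subset> c (Suc i)) \<Longrightarrow> k \<le> d"
  shows "krull_dim loc \<le> enat d"
  unfolding krull_dim_def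
proof (rule Sup_least, clarify)
  fix k and c :: "nat \<Rightarrow> ('a \<times> 'a) set set"
  assume c: "\<forall>i\<le>k. primeideal (c i) loc" "\<forall>i<k. c i \<subset> c (Suc i)"
  let ?c = "\<lambda>i. {a \<in> carrier R. emb a \<in> c i}"
  have "k \<le> d"
  proof (rule assms)
    fix i assume "i \<le> k"
    thus "primeideal (?c i) R" "?c i \<subseteq> I" using contracted_prime c(1) by auto
  next
    fix i assume i: "i < k"
    interpret P: primeideal "c (Suc i)" loc using i c(1) by auto
    interpret P': primeideal "c i" loc using i c(1) by auto
    obtain x where x: "x \<in> c (Suc i)" "x \<notin> c i" using c(2) i by blast
    hence "x \<in> carrier loc" using P.a_subset by blast
    then obtain a s where a: "x = frac a s" "a \<in> carrier R" "s \<in> loc_denominators" by (elim loc_cases) blast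
    have "emb a \<in> c (Suc i)" "emb a \<notin> c i"
      using x a frac_mem_ideal_iff[OF P.is_ideal] frac_mem_ideal_iff[OF P'.is_ideal] by auto
    thus "?c i \<subset> ?c (Suc i)" using c(2) i a by blast
  qed
  thus "enat k \<le> enat d" by simp
qed

text \<open>The multiplier u lies outside I and becomes a unit. In this form the elimination
  identities, which hold only up to a power of the pivots, turn into inclusions of localized
  ideals.\<close>

lemma localized_ideal_mono:
  assumes S: "S \<subseteq> carrier R" and J: "J \<subseteq> carrier R"
    and mem: "\<And>x. x \<in> J \<Longrightarrow> \<exists>u\<in>loc_denominators. u \<otimes> x \<in> Idl S"
  shows "localized_ideal R I J \<subseteq> Idl\<^bsub>loc\<^esub> (emb ` S)"
proof -
  interpret L: cring loc by (rule loc_cring)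
  interpret h: ring_hom_cring R loc emb by (rule emb_hom)
  have S': "emb ` S \<subseteq> carrier loc" using S emb_closed by blast
  interpret K: ideal "Idl\<^bsub>loc\<^esub> (emb ` S)" loc using S' by (rule L.genideal_ideal)
  have id: "ideal {a \<in> carrier R. emb a \<in> Idl\<^bsub>loc\<^esub> (emb ` S)} R"
    by (rule h.ring.ideal_vimage[OF K.is_ideal])
  have sub: "Idl S \<subseteq> {a \<in> carrier R. emb a \<in> Idl\<^bsub>loc\<^esub> (emb ` S)}"
  proof (rule genideal_minimal[OF id])
    show "S \<subseteq> {a \<in> carrier R. emb a \<in> Idl\<^bsub>loc\<^esub> (emb ` S)}" using S L.genideal_self[OF S'] by blast
  qed
  show ?thesis
    unfolding localized_ideal_def
  proof (intro L.genideal_minimal K.is_ideal subsetI, elim imageE)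
    fix y x assume y: "y = emb x" and x: "x \<in> J"
    obtain u where u: "u \<in> loc_denominators" "u \<otimes> x \<in> Idl S" using mem[OF x] by blast
    have xc: "x \<in> carrier R" using x J by blast
    have uc: "frac \<one> u \<in> carrier loc" using u by (intro frac_closed) auto
    have "frac \<one> u \<otimes>\<^bsub>loc\<^esub> emb (u \<otimes> x) \<in> Idl\<^bsub>loc\<^esub> (emb ` S)"
      using u sub uc by (intro K.I_l_closed) auto
    also have "frac \<one> u \<otimes>\<^bsub>loc\<^esub> emb (u \<otimes> x) = frac (\<one> \<otimes> (u \<otimes> x)) (u \<otimes> \<one>)"
      using u xc one_denominator by (intro frac_mult) auto
    also have "\<dots> = emb x" using u xc one_denominator by (intro frac_eqI) (auto simp: m_ac)
    finally show "y \<in> Idl\<^bsub>loc\<^esub> (emb ` S)" using y by simp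
  qed
qed

lemma common_denominator:
  assumes "finite F" "\<And>x. x \<in> F \<Longrightarrow> e x \<in> carrier loc"
  shows "\<exists>s\<in>loc_denominators. \<exists>a\<in>F \<rightarrow> carrier R. \<forall>x\<in>F. emb s \<otimes>\<^bsub>loc\<^esub> e x = emb (a x)"
  using assms
proof (induction F)
  case empty
  then show ?case using one_denominator by blast
next
  case (insert y F)
  interpret L: cring loc by (rule loc_cring)
  interpret h: ring_hom_cring R loc emb by (rule emb_hom)
  obtain s a where s: "s \<in> loc_denominators" "a \<in> F \<rightarrow> carrier R" "\<forall>x\<in>F. emb s \<otimes>\<^bsub>loc\<^esub> e x = emb (a x)"
    using insert by auto
  have "e y \<in> carrier loc" using insert by simp
  then obtain b t where b: "e y = frac b t" "b \<in> carrier R" "t \<in> loc_denominators" by (elim loc_cases)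
  let ?a = "\<lambda>x. if x = y then s \<otimes> b else t \<otimes> a x"
  have "emb (s \<otimes> t) \<otimes>\<^bsub>loc\<^esub> e x = emb (?a x)" if x: "x \<in> insert y F" for x
  proof (cases "x = y")
    case True
    have "emb (s \<otimes> t) \<otimes>\<^bsub>loc\<^esub> e y = emb s \<otimes>\<^bsub>loc\<^esub> (emb t \<otimes>\<^bsub>loc\<^esub> e y)"
      using s b frac_closed[of b t] emb_closed by (simp add: L.m_assoc)
    also have "\<dots> = emb (s \<otimes> b)" using b s emb_denominator_mult[of b t] by simp
    finally show ?thesis using True by simp
  next
    case False
    have ex: "e x \<in> carrier loc" "a x \<in> carrier R" using insert.prems s x False by auto
    have "emb (s \<otimes> t) \<otimes>\<^bsub>loc\<^esub> e x = emb t \<otimes>\<^bsub>loc\<^esub> (emb s \<otimes>\<^bsub>loc\<^esub> e x)"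
      using s b ex emb_closed by (simp add: L.m_ac)
    also have "\<dots> = emb (t \<otimes> a x)" using s b x False ex by simp
    finally show ?thesis using False by simp
  qed
  hence "\<forall>x\<in>insert y F. emb (s \<otimes> t) \<otimes>\<^bsub>loc\<^esub> e x = emb (?a x)" by blast
  moreover have "s \<otimes> t \<in> loc_denominators" using s b mult_denominator by blast
  moreover have "?a \<in> insert y F \<rightarrow> carrier R" using s b by (auto simp: Pi_def)
  ultimately show ?case by (intro bexI[of _ "s \<otimes> t"] bexI[of _ ?a])
qed

end

section \<open>Multiplication of polynomials\<close>

lemma finite_submultisets: "finite {a. a \<subseteq># (m :: 'c multiset)}"
proof (induction m)
  case empty
  have "{a. a \<subseteq># ({#} :: 'c multiset)} = {{#}}" by auto
  then show ?case by simp
next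
  case (add v m)
  have "{a. a \<subseteq># add_mset v m} \<subseteq> {a. a \<subseteq># m} \<union> add_mset v ` {a. a \<subseteq># m}"
  proof
    fix a assume "a \<in> {a. a \<subseteq># add_mset v m}"
    hence a: "a \<subseteq># add_mset v m" by simp
    show "a \<in> {a. a \<subseteq># m} \<union> add_mset v ` {a. a \<subseteq># m}"
    proof (cases "v \<in># a")
      case True
      hence "a = add_mset v (a - {#v#})" by simp
      moreover have "a - {#v#} \<subseteq># m" using a by (simp add: subset_eq_diff_conv)
      ultimately show ?thesis by blast
    next
      case False
      hence "a \<subseteq># m" using a
        by (metis add_mset_remove_trivial diff_single_trivial subset_eq_diff_conv union_mset_add_mset_right add.right_neutral)
      thus ?thesis by simp
    qed
  qed
  thus ?case using add finite_subset by blast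
qed

text \<open>\<open>finsum\<close> over an infinite set is zero by default, so the convolution in
  \<open>indexed_mult\<close> is meaningful only because a monomial has finitely many
  splittings.\<close>

lemma finite_multiset_splits: "finite {x. fst x + snd x = (m :: 'c multiset)}"
proof (rule finite_subset[OF _ finite_cartesian_product])
  show "{x. fst x + snd x = m} \<subseteq> {a. a \<subseteq># m} \<times> {a. a \<subseteq># m}" by auto
qed (rule finite_submultisets)+

context cring begin

lemma carrier_coeff_iff: "carrier_coeff f \<longleftrightarrow> (\<forall>m. f m \<in> carrier R)"
  unfolding carrier_coeff_def ..

lemma indexed_mult_comm:
  assumes "carrier_coeff f" "carrier_coeff g"
  shows "indexed_mult R f g = indexed_mult R g f"
proof
  fix m :: "'c multiset"
  let ?S = "{x. fst x + snd x = m}"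
  have eq: "?S = prod.swap ` ?S" by (auto simp: add.commute image_iff)
  have "indexed_mult R f g m = (\<Oplus>x\<in>prod.swap ` ?S. f (fst x) \<otimes> g (snd x))"
    unfolding indexed_mult_def eq[symmetric] ..
  also have "\<dots> = (\<Oplus>x\<in>?S. f (fst (prod.swap x)) \<otimes> g (snd (prod.swap x)))"
    using assms unfolding carrier_coeff_iff by (intro finsum_reindex) (auto simp: inj_on_def)
  also have "\<dots> = indexed_mult R g f m"
    unfolding indexed_mult_def using assms unfolding carrier_coeff_iff
    by (intro finsum_cong') (auto simp: m_comm)
  finally show "indexed_mult R f g m = indexed_mult R g f m" .
qed

lemma indexed_mult_padd_left:
  assumes "carrier_coeff f" "carrier_coeff g" "carrier_coeff h"
  shows "indexed_mult R (indexed_padd f g) h = indexed_padd (indexed_mult R f h) (indexed_mult R g h)"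
proof
  fix m :: "'c multiset"
  show "indexed_mult R (indexed_padd f g) h m = indexed_padd (indexed_mult R f h) (indexed_mult R g h) m"
    using assms unfolding indexed_mult_def indexed_padd_def carrier_coeff_iff
    by (subst finsum_addf[symmetric]) (auto intro!: finsum_cong' simp: l_distr)
qed

lemma indexed_mult_scale_left:
  assumes "carrier_coeff f" "carrier_coeff g" "c \<in> carrier R"
  shows "indexed_mult R (\<lambda>m. c \<otimes> f m) g = (\<lambda>m. c \<otimes> indexed_mult R f g m)"
proof
  fix m :: "'c multiset"
  show "indexed_mult R (\<lambda>m. c \<otimes> f m) g m = c \<otimes> indexed_mult R f g m"
    using assms unfolding indexed_mult_def carrier_coeff_iff
    by (subst finsum_rdistr) (auto intro!: finsum_cong' simp: m_assoc finite_multiset_splits)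
qed

lemma indexed_mult_const_left:
  assumes "carrier_coeff f" "c \<in> carrier R"
  shows "indexed_mult R (indexed_const c) f = (\<lambda>m. c \<otimes> f m)"
proof
  fix m :: "'c multiset"
  have "indexed_mult R (indexed_const c) f m = (\<Oplus>x\<in>{({#} :: 'c multiset, m)}. indexed_const c (fst x) \<otimes> f (snd x))"
    unfolding indexed_mult_def
    by (rule add.finprod_mono_neutral_cong_right[OF finite_multiset_splits])
      (use assms in \<open>auto simp: indexed_const_def carrier_coeff_iff\<close>)
  also have "\<dots> = c \<otimes> f m" using assms by (simp add: indexed_const_def carrier_coeff_iff)
  finally show "indexed_mult R (indexed_const c) f m = c \<otimes> f m" .
qed

text \<open>Only splittings with v in the first part contribute, and removing this v is a bijection
  onto the splittings of the smaller monomial.\<close>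

lemma indexed_mult_pmult_left:
  assumes "carrier_coeff f" "carrier_coeff g"
  shows "indexed_mult R (indexed_pmult f v) g = indexed_pmult (indexed_mult R f g) v"
proof
  fix m :: "'c multiset"
  let ?S = "{x. fst x + snd x = m}"
  show "indexed_mult R (indexed_pmult f v) g m = indexed_pmult (indexed_mult R f g) v m"
  proof (cases "v \<in># m")
    case False
    have "indexed_mult R (indexed_pmult f v) g m = (\<Oplus>x\<in>?S. \<zero>)"
      unfolding indexed_mult_def using assms False unfolding carrier_coeff_iff
      by (intro finsum_cong') (auto simp: indexed_pmult_def)
    thus ?thesis using False by (simp add: indexed_pmult_def)
  next
    case True
    let ?S' = "{x. fst x + snd x = m - {#v#}}" and ?h = "\<lambda>x. (add_mset v (fst x), snd x)"
    have sub: "?h ` ?S' \<subseteq> ?S" using True by auto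
    have rest: "v \<notin># fst x" if "x \<in> ?S - ?h ` ?S'" for x
    proof
      assume v: "v \<in># fst x"
      have "x = ?h (fst x - {#v#}, snd x)" using v by simp
      moreover have "(fst x - {#v#}, snd x) \<in> ?S'" using that v by auto
      ultimately show False using that by blast
    qed
    have "indexed_mult R (indexed_pmult f v) g m = (\<Oplus>x\<in>?h ` ?S'. indexed_pmult f v (fst x) \<otimes> g (snd x))"
      unfolding indexed_mult_def
      by (rule add.finprod_mono_neutral_cong_right[OF finite_multiset_splits sub])
        (use assms rest in \<open>auto simp: indexed_pmult_def carrier_coeff_iff\<close>)
    also have "\<dots> = (\<Oplus>x\<in>?S'. indexed_pmult f v (fst (?h x)) \<otimes> g (snd (?h x)))"
      using assms unfolding carrier_coeff_iff
      by (intro finsum_reindex) (auto simp: inj_on_def indexed_pmult_def)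
    also have "\<dots> = indexed_mult R f g (m - {#v#})"
      unfolding indexed_mult_def using assms unfolding carrier_coeff_iff
      by (intro finsum_cong') (auto simp: indexed_pmult_def)
    finally show ?thesis using True by (simp add: indexed_pmult_def)
  qed
qed

abbreviation polys :: "'c set \<Rightarrow> ('c multiset \<Rightarrow> 'a) set" where
  "polys V \<equiv> indexed_pset V (carrier R)"

lemma polys_coeff: "f \<in> polys V \<Longrightarrow> carrier_coeff f"
  by (rule indexed_pset_in_carrier[of "carrier R"]) auto

lemma polys_induct [consumes 1, case_names const add pmult]:
  assumes "f \<in> polys V" "\<And>c. c \<in> carrier R \<Longrightarrow> P (indexed_const c)"
    "\<And>f g. f \<in> polys V \<Longrightarrow> g \<in> polys V \<Longrightarrow> P f \<Longrightarrow> P g \<Longrightarrow> P (indexed_padd f g)"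
    "\<And>f v. f \<in> polys V \<Longrightarrow> v \<in> V \<Longrightarrow> P f \<Longrightarrow> P (indexed_pmult f v)"
  shows "P f"
  using assms by (induction rule: indexed_pset.induct) auto

lemma polys_mono:
  assumes "f \<in> polys V" "V \<subseteq> W"
  shows "f \<in> polys W"
  using assms(1)
  by (induction rule: polys_induct) (use assms(2) in \<open>auto intro: indexed_pset.intros\<close>)

lemma polys_scale:
  assumes "f \<in> polys V" "c \<in> carrier R"
  shows "(\<lambda>m. c \<otimes> f m) \<in> polys V"
  using assms(1)
proof (induction rule: polys_induct)
  case (const d)
  have eq: "(\<lambda>m. c \<otimes> indexed_const d m) = indexed_const (c \<otimes> d)"
    using const assms by (auto simp: indexed_const_def)
  show ?case unfolding eq using const assms by (intro indexed_pset.indexed_const) simp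
next
  case (add f g)
  have "(\<lambda>m. c \<otimes> indexed_padd f g m) = indexed_padd (\<lambda>m. c \<otimes> f m) (\<lambda>m. c \<otimes> g m)"
    using polys_coeff[OF add(1)] polys_coeff[OF add(2)] assms
    by (auto simp: indexed_padd_def carrier_coeff_iff r_distr)
  thus ?case using add by (simp add: indexed_pset.indexed_padd)
next
  case (pmult f v)
  have "(\<lambda>m. c \<otimes> indexed_pmult f v m) = indexed_pmult (\<lambda>m. c \<otimes> f m) v"
    using assms by (auto simp: indexed_pmult_def)
  thus ?case using pmult by (simp add: indexed_pset.indexed_pmult)
qed

lemma polys_mult:
  assumes "f \<in> polys V" "g \<in> polys V"
  shows "indexed_mult R f g \<in> polys V"
  using assms(1)
proof (induction rule: polys_induct)
  case (const d)
  then show ?case using polys_coeff[OF assms(2)] polys_scale[OF assms(2)]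
    by (simp add: indexed_mult_const_left)
next
  case (add f h)
  then show ?case using polys_coeff assms(2)
    by (simp add: indexed_mult_padd_left[of f h g] polys_coeff indexed_pset.indexed_padd)
next
  case (pmult f v)
  then show ?case using polys_coeff assms(2)
    by (simp add: indexed_mult_pmult_left[of f g v] polys_coeff indexed_pset.indexed_pmult)
qed

text \<open>Polynomials are generated by constants, sums and multiplication by a variable, so
  induction on the first factor replaces the reindexing of a double convolution.\<close>

lemma indexed_mult_assoc:
  assumes "f \<in> polys V" "g \<in> polys V" "h \<in> polys V"
  shows "indexed_mult R (indexed_mult R f g) h = indexed_mult R f (indexed_mult R g h)"
  using assms(1)
proof (induction rule: polys_induct)
  case (const d)
  then show ?case using polys_coeff[OF assms(2)] polys_coeff[OF assms(3)] polys_coeff[OF polys_mult[OF assms(2,3)]]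
    by (simp add: indexed_mult_const_left indexed_mult_scale_left)
next
  case (add f f')
  have c: "carrier_coeff f" "carrier_coeff f'" "carrier_coeff g" "carrier_coeff h"
    "carrier_coeff (indexed_mult R g h)" "carrier_coeff (indexed_mult R f g)" "carrier_coeff (indexed_mult R f' g)"
    using add assms polys_coeff polys_mult by blast+
  show ?case using add(3,4) c by (simp add: indexed_mult_padd_left)
next
  case (pmult f v)
  have c: "carrier_coeff f" "carrier_coeff g" "carrier_coeff h"
    "carrier_coeff (indexed_mult R g h)" "carrier_coeff (indexed_mult R f g)"
    using pmult assms polys_coeff polys_mult by blast+
  show ?case using pmult(3) c by (simp add: indexed_mult_pmult_left)
qed

abbreviation poly_ring :: "'c set \<Rightarrow> ('c multiset \<Rightarrow> 'a) ring" where
  "poly_ring V \<equiv> indexed_poly_ring R V"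

lemma poly_ring_simps:
  "carrier (poly_ring V) = polys V"
  "f \<otimes>\<^bsub>poly_ring V\<^esub> g = indexed_mult R f g"
  "f \<oplus>\<^bsub>poly_ring V\<^esub> g = indexed_padd f g"
  "\<one>\<^bsub>poly_ring V\<^esub> = indexed_const \<one>"
  "\<zero>\<^bsub>poly_ring V\<^esub> = (\<lambda>_. \<zero>)"
  unfolding indexed_poly_ring_def by (simp_all add: indexed_zero_def)

lemma poly_ring_cring: "cring (poly_ring V)"
proof (rule cringI)
  have zero: "(\<lambda>_. \<zero>) \<in> polys V"
    using indexed_pset.indexed_const[of \<zero> "carrier R" V] by (simp add: indexed_zero_def)
  show "abelian_group (poly_ring V)"
  proof (rule abelian_groupI)
    fix f assume "f \<in> carrier (poly_ring V)"
    hence f: "f \<in> polys V" by (simp add: poly_ring_simps)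
    have c: "f m \<in> carrier R" for m using polys_coeff[OF f] by (simp add: carrier_coeff_iff)
    have "(\<lambda>m. \<ominus> \<one> \<otimes> f m) \<in> polys V" using f by (intro polys_scale) auto
    moreover have "indexed_padd (\<lambda>m. \<ominus> \<one> \<otimes> f m) f = (\<lambda>_. \<zero>)"
      unfolding indexed_padd_def using c by (simp add: l_minus l_neg)
    ultimately show "\<exists>g\<in>carrier (poly_ring V). g \<oplus>\<^bsub>poly_ring V\<^esub> f = \<zero>\<^bsub>poly_ring V\<^esub>"
      unfolding poly_ring_simps by blast
    show "\<zero>\<^bsub>poly_ring V\<^esub> \<oplus>\<^bsub>poly_ring V\<^esub> f = f"
      unfolding poly_ring_simps indexed_padd_def using c by simp
  next
    fix f g h assume "f \<in> carrier (poly_ring V)" "g \<in> carrier (poly_ring V)" "h \<in> carrier (poly_ring V)"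
    hence c: "f m \<in> carrier R" "g m \<in> carrier R" "h m \<in> carrier R" for m
      using polys_coeff carrier_coeff_iff by (metis poly_ring_simps(1))+
    show "f \<oplus>\<^bsub>poly_ring V\<^esub> g \<oplus>\<^bsub>poly_ring V\<^esub> h = f \<oplus>\<^bsub>poly_ring V\<^esub> (g \<oplus>\<^bsub>poly_ring V\<^esub> h)"
      unfolding poly_ring_simps indexed_padd_def using c by (simp add: a_assoc)
  next
    fix f g assume fg: "f \<in> carrier (poly_ring V)" "g \<in> carrier (poly_ring V)"
    hence c: "f m \<in> carrier R" "g m \<in> carrier R" for m
      using polys_coeff carrier_coeff_iff by (metis poly_ring_simps(1))+
    show "f \<oplus>\<^bsub>poly_ring V\<^esub> g = g \<oplus>\<^bsub>poly_ring V\<^esub> f"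
      unfolding poly_ring_simps indexed_padd_def using c by (simp add: a_comm)
    show "f \<oplus>\<^bsub>poly_ring V\<^esub> g \<in> carrier (poly_ring V)"
      using fg unfolding poly_ring_simps by (rule indexed_pset.indexed_padd)
  qed (use zero in \<open>simp add: poly_ring_simps\<close>)
  have one: "indexed_const \<one> \<in> polys V" by (intro indexed_pset.indexed_const) auto
  show "comm_monoid (poly_ring V)"
  proof (rule comm_monoidI)
    fix f assume "f \<in> carrier (poly_ring V)"
    hence f: "carrier_coeff f" using polys_coeff by (simp add: poly_ring_simps)
    thus "\<one>\<^bsub>poly_ring V\<^esub> \<otimes>\<^bsub>poly_ring V\<^esub> f = f"
      by (simp add: poly_ring_simps indexed_mult_const_left carrier_coeff_iff)
  next
    fix f g h assume "f \<in> carrier (poly_ring V)" "g \<in> carrier (poly_ring V)" "h \<in> carrier (poly_ring V)"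
    thus "f \<otimes>\<^bsub>poly_ring V\<^esub> g \<otimes>\<^bsub>poly_ring V\<^esub> h = f \<otimes>\<^bsub>poly_ring V\<^esub> (g \<otimes>\<^bsub>poly_ring V\<^esub> h)"
      unfolding poly_ring_simps by (rule indexed_mult_assoc)
  next
    fix f g assume "f \<in> carrier (poly_ring V)" "g \<in> carrier (poly_ring V)"
    thus "f \<otimes>\<^bsub>poly_ring V\<^esub> g \<in> carrier (poly_ring V)"
      "f \<otimes>\<^bsub>poly_ring V\<^esub> g = g \<otimes>\<^bsub>poly_ring V\<^esub> f"
      unfolding poly_ring_simps using polys_mult indexed_mult_comm[OF polys_coeff polys_coeff] by blast+
  qed (use one in \<open>simp add: poly_ring_simps\<close>)
  fix f g h assume "f \<in> carrier (poly_ring V)" "g \<in> carrier (poly_ring V)" "h \<in> carrier (poly_ring V)"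
  thus "(f \<oplus>\<^bsub>poly_ring V\<^esub> g) \<otimes>\<^bsub>poly_ring V\<^esub> h =
      f \<otimes>\<^bsub>poly_ring V\<^esub> h \<oplus>\<^bsub>poly_ring V\<^esub> g \<otimes>\<^bsub>poly_ring V\<^esub> h"
    unfolding poly_ring_simps by (intro indexed_mult_padd_left polys_coeff)
qed

lemma polys_const: "c \<in> carrier R \<Longrightarrow> indexed_const c \<in> polys V"
  by (rule indexed_pset.indexed_const)

lemma polys_closed: "f \<in> polys V \<Longrightarrow> f m \<in> carrier R"
  using polys_coeff carrier_coeff_iff by blast

lemma polys_zero: "(\<lambda>_. \<zero>) \<in> polys V"
  using polys_const[of \<zero> V] by (simp add: indexed_zero_def)

lemma polys_var: "v \<in> V \<Longrightarrow> indexed_var v \<in> polys V"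
  unfolding indexed_var_def by (intro indexed_pset.indexed_pmult polys_const) auto

lemma polys_support:
  assumes "f \<in> polys V" "f m \<noteq> \<zero>"
  shows "set_mset m \<subseteq> V"
  using assms
proof (induction arbitrary: m rule: polys_induct)
  case (add f g)
  thus ?case by (auto simp: indexed_padd_def) (metis l_zero r_zero polys_closed zero_closed subsetD)
next
  case (pmult f v)
  have "v \<in># m" "f (m - {#v#}) \<noteq> \<zero>" using pmult by (auto simp: indexed_pmult_def split: if_splits)
  moreover from this have "set_mset m \<subseteq> insert v (set_mset (m - {#v#}))" by (metis calculation(1) insert_DiffM set_mset_add_mset_insert subset_refl)
  ultimately show ?case using pmult by blast
qed (auto simp: indexed_const_def split: if_splits)

lemma polys_finite_support:
  assumes "f \<in> polys V"
  shows "finite {m. f m \<noteq> \<zero>}"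
  using assms
proof (induction rule: polys_induct)
  case (const c)
  have "{m. indexed_const c m \<noteq> \<zero>} \<subseteq> {{#}}" by (auto simp: indexed_const_def)
  thus ?case using finite_subset by blast
next
  case (add f g)
  have "{m. indexed_padd f g m \<noteq> \<zero>} \<subseteq> {m. f m \<noteq> \<zero>} \<union> {m. g m \<noteq> \<zero>}"
    by (auto simp: indexed_padd_def)
  thus ?case using add finite_subset by blast
next
  case (pmult f v)
  have "{m. indexed_pmult f v m \<noteq> \<zero>} \<subseteq> add_mset v ` {m. f m \<noteq> \<zero>}"
  proof
    fix m assume "m \<in> {m. indexed_pmult f v m \<noteq> \<zero>}"
    hence "m = add_mset v (m - {#v#})" "m - {#v#} \<in> {m. f m \<noteq> \<zero>}"
      by (auto simp: indexed_pmult_def split: if_splits)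
    thus "m \<in> add_mset v ` {m. f m \<noteq> \<zero>}" by (rule image_eqI)
  qed
  thus ?case using pmult finite_subset by blast
qed

lemma pmult_eq_mult_var:
  assumes "f \<in> polys V"
  shows "indexed_mult R f (indexed_var v) = indexed_pmult f v"
    and "indexed_mult R (indexed_var v) f = indexed_pmult f v"
proof -
  have c: "carrier_coeff f" "carrier_coeff (indexed_var v)" "carrier_coeff (indexed_const \<one>)"
    using polys_coeff[OF assms] polys_coeff[OF polys_var[of v UNIV]] polys_coeff[OF polys_const[of \<one> UNIV]]
    by simp_all
  have "indexed_mult R (indexed_const \<one>) f = f"
    using c by (simp add: indexed_mult_const_left carrier_coeff_iff)
  thus 1: "indexed_mult R (indexed_var v) f = indexed_pmult f v"
    using indexed_mult_pmult_left[OF c(3,1), of v] by (simp add: indexed_var_def)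
  thus "indexed_mult R f (indexed_var v) = indexed_pmult f v"
    using indexed_mult_comm c by metis
qed

section \<open>Coefficients and derivatives with respect to one variable\<close>

text \<open>The coefficient of the k-th power of v when f is viewed as a polynomial in v; monomials
  containing v are sent to zero so that the result is free of v.\<close>

definition var_coeff :: "'c \<Rightarrow> nat \<Rightarrow> ('c multiset \<Rightarrow> 'a) \<Rightarrow> 'c multiset \<Rightarrow> 'a" where
  "var_coeff v k f = (\<lambda>m. if v \<in># m then \<zero> else f (m + replicate_mset k v))"

text \<open>The quotient of f minus its constant term in v by v, the recursive part of Horner's
  scheme.\<close>

definition var_shift :: "'c \<Rightarrow> ('c multiset \<Rightarrow> 'a) \<Rightarrow> 'c multiset \<Rightarrow> 'a" where
  "var_shift v f = (\<lambda>m. f (add_mset v m))"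

text \<open>\<open>Suc (count m v)\<close> is the exponent of v in the monomial
  \<open>add_mset v m\<close> from which the coefficient is taken.\<close>

definition partial_deriv :: "'c \<Rightarrow> ('c multiset \<Rightarrow> 'a) \<Rightarrow> 'c multiset \<Rightarrow> 'a" where
  "partial_deriv v f = (\<lambda>m. [Suc (count m v)] \<cdot> f (add_mset v m))"

lemma var_coeff_const: "var_coeff v k (indexed_const c) = (if k = 0 then indexed_const c else (\<lambda>_. \<zero>))"
  by (auto simp: var_coeff_def indexed_const_def fun_eq_iff)

lemma var_coeff_padd: "var_coeff v k (indexed_padd f g) = indexed_padd (var_coeff v k f) (var_coeff v k g)"
  by (auto simp: var_coeff_def indexed_padd_def fun_eq_iff)

lemma var_coeff_scale: "c \<in> carrier R \<Longrightarrow> var_coeff v k (\<lambda>m. c \<otimes> f m) = (\<lambda>m. c \<otimes> var_coeff v k f m)"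
  by (auto simp: var_coeff_def fun_eq_iff)

lemma var_coeff_pmult_other:
  "u \<noteq> v \<Longrightarrow> var_coeff v k (indexed_pmult f u) = indexed_pmult (var_coeff v k f) u"
  by (auto simp: var_coeff_def indexed_pmult_def fun_eq_iff in_diff_count)

lemma var_coeff_0_pmult: "var_coeff v 0 (indexed_pmult f v) = (\<lambda>_. \<zero>)"
  by (auto simp: var_coeff_def indexed_pmult_def fun_eq_iff)

lemma var_coeff_Suc_pmult: "var_coeff v (Suc k) (indexed_pmult f v) = var_coeff v k f"
  by (auto simp: var_coeff_def indexed_pmult_def fun_eq_iff)

lemma var_coeff_shift: "var_coeff v k (var_shift v f) = var_coeff v (Suc k) f"
  by (auto simp: var_coeff_def var_shift_def fun_eq_iff)

lemma var_coeff_closed: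
  assumes "f \<in> polys V"
  shows "var_coeff v k f \<in> polys (V - {v})"
  using assms
proof (induction arbitrary: k rule: polys_induct)
  case (const c)
  then show ?case by (cases "k = 0") (auto simp: var_coeff_const intro: polys_const polys_zero)
next
  case (add f g)
  then show ?case by (simp add: var_coeff_padd indexed_pset.indexed_padd)
next
  case (pmult f u)
  show ?case
  proof (cases "u = v")
    case True
    show ?thesis
      using pmult polys_zero by (cases k) (simp_all add: True var_coeff_0_pmult var_coeff_Suc_pmult)
  next
    case False
    then show ?thesis using pmult by (simp add: var_coeff_pmult_other indexed_pset.indexed_pmult)
  qed
qed

lemma var_shift_closed:
  assumes "f \<in> polys V"
  shows "var_shift v f \<in> polys V"
  using assms
proof (induction rule: polys_induct)
  case (const c)
  have "var_shift v (indexed_const c) = (\<lambda>_. \<zero>)" by (auto simp: var_shift_def indexed_const_def)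
  then show ?case using polys_zero by simp
next
  case (add f g)
  have "var_shift v (indexed_padd f g) = indexed_padd (var_shift v f) (var_shift v g)"
    by (auto simp: var_shift_def indexed_padd_def)
  then show ?case using add by (simp add: indexed_pset.indexed_padd)
next
  case (pmult f u)
  have "var_shift v (indexed_pmult f u) = (if u = v then f else indexed_pmult (var_shift v f) u)"
    by (auto simp: var_shift_def indexed_pmult_def fun_eq_iff)
  then show ?case using pmult by (simp add: indexed_pset.indexed_pmult)
qed

lemma var_decomposition:
  assumes "f \<in> polys V"
  shows "f = indexed_padd (var_coeff v 0 f) (indexed_pmult (var_shift v f) v)"
proof
  fix m
  show "f m = indexed_padd (var_coeff v 0 f) (indexed_pmult (var_shift v f) v) m"
    using polys_closed[OF assms, of m]
    by (cases "v \<in># m") (auto simp: var_coeff_def var_shift_def indexed_padd_def indexed_pmult_def)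
qed

lemma var_coeff_free:
  assumes "f \<in> polys V" "v \<notin> V"
  shows "var_coeff v k f = (if k = 0 then f else (\<lambda>_. \<zero>))"
proof
  fix m
  have z: "f m' = \<zero>" if "v \<in># m'" for m' using polys_support[OF assms(1), of m'] that assms(2) by blast
  thus "var_coeff v k f m = (if k = 0 then f else (\<lambda>_. \<zero>)) m"
    by (auto simp: var_coeff_def)
qed

text \<open>The coefficient of index 0 is the substitution v = 0, hence multiplicative. This is the
  reason why primality of extended ideals is tested on constant terms.\<close>

lemma var_coeff_0_mult:
  assumes "f \<in> polys V" "g \<in> polys V"
  shows "var_coeff v 0 (indexed_mult R f g) = indexed_mult R (var_coeff v 0 f) (var_coeff v 0 g)"
  using assms(1)
proof (induction rule: polys_induct)
  case (const c)
  then show ?case using assms(2) polys_coeff[OF assms(2)] polys_coeff[OF var_coeff_closed[OF assms(2)]]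
    by (simp add: indexed_mult_const_left var_coeff_scale var_coeff_const)
next
  case (add f h)
  have c: "carrier_coeff f" "carrier_coeff h" "carrier_coeff g"
    "carrier_coeff (var_coeff v 0 f)" "carrier_coeff (var_coeff v 0 h)" "carrier_coeff (var_coeff v 0 g)"
    using polys_coeff[OF add(1)] polys_coeff[OF add(2)] polys_coeff[OF assms(2)]
      polys_coeff[OF var_coeff_closed[OF add(1)]] polys_coeff[OF var_coeff_closed[OF add(2)]]
      polys_coeff[OF var_coeff_closed[OF assms(2)]] by simp_all
  show ?case using add c by (simp add: indexed_mult_padd_left var_coeff_padd)
next
  case (pmult f u)
  have c: "carrier_coeff f" "carrier_coeff g" "carrier_coeff (var_coeff v 0 f)" "carrier_coeff (var_coeff v 0 g)"
    using polys_coeff[OF pmult(1)] polys_coeff[OF assms(2)]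
      polys_coeff[OF var_coeff_closed[OF pmult(1)]] polys_coeff[OF var_coeff_closed[OF assms(2)]] by simp_all
  show ?case
  proof (cases "u = v")
    case True
    have "indexed_mult R (\<lambda>_. \<zero>) (var_coeff v 0 g) = (\<lambda>_. \<zero>)"
      using indexed_mult_const_left[OF c(4), of \<zero>] c(4) by (simp add: indexed_zero_def carrier_coeff_iff)
    thus ?thesis using True c by (simp add: indexed_mult_pmult_left var_coeff_0_pmult)
  next
    case False
    thus ?thesis using pmult c by (simp add: indexed_mult_pmult_left var_coeff_pmult_other)
  qed
qed

lemma partial_deriv_padd:
  assumes "f \<in> polys V" "g \<in> polys V"
  shows "partial_deriv v (indexed_padd f g) = indexed_padd (partial_deriv v f) (partial_deriv v g)"
  using polys_closed[OF assms(1)] polys_closed[OF assms(2)]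
  by (auto simp: partial_deriv_def indexed_padd_def add.nat_pow_distrib a_ac)

lemma partial_deriv_pmult:
  assumes "f \<in> polys V"
  shows "partial_deriv v (indexed_pmult f v) = indexed_padd (indexed_pmult (partial_deriv v f) v) f"
proof
  fix m
  show "partial_deriv v (indexed_pmult f v) m = indexed_padd (indexed_pmult (partial_deriv v f) v) f m"
  proof (cases "count m v")
    case 0
    hence "v \<notin># m" by (simp add: not_in_iff)
    thus ?thesis using polys_closed[OF assms] 0 by (simp add: partial_deriv_def indexed_padd_def indexed_pmult_def)
  next
    case (Suc k)
    hence "v \<in># m" by (metis count_inI nat.distinct(1))
    thus ?thesis using polys_closed[OF assms] Suc by (simp add: partial_deriv_def indexed_padd_def indexed_pmult_def)
  qed
qed

lemma partial_deriv_closed: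
  assumes "f \<in> polys V"
  shows "partial_deriv v f \<in> polys V"
  using assms
proof (induction rule: polys_induct)
  case (const c)
  have "partial_deriv v (indexed_const c) = (\<lambda>_. \<zero>)" by (auto simp: partial_deriv_def indexed_const_def)
  then show ?case using polys_zero by simp
next
  case (add f g)
  then show ?case using partial_deriv_padd[OF add(1,2)] by (simp add: indexed_pset.indexed_padd)
next
  case (pmult f u)
  show ?case
  proof (cases "u = v")
    case True
    then show ?thesis using pmult partial_deriv_pmult[OF pmult(1)]
      by (simp add: indexed_pset.indexed_pmult indexed_pset.indexed_padd)
  next
    case False
    have "partial_deriv v (indexed_pmult f u) = indexed_pmult (partial_deriv v f) u"
      using False by (auto simp: partial_deriv_def indexed_pmult_def fun_eq_iff)
    then show ?thesis using pmult by (simp add: indexed_pset.indexed_pmult)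
  qed
qed

text \<open>A factor free of v acts as a scalar. With \<open>partial_deriv_pmult\<close> this yields
  the Leibniz rule for factors that are linear in v.\<close>

lemma partial_deriv_mult_free:
  assumes f: "f \<in> polys V" and h: "h \<in> polys W" and v: "v \<notin> W"
  shows "partial_deriv v (indexed_mult R h f) = indexed_mult R h (partial_deriv v f)"
  using h
proof (induction rule: polys_induct)
  case (const c)
  have "partial_deriv v (\<lambda>m. c \<otimes> f m) = (\<lambda>m. c \<otimes> partial_deriv v f m)"
    using polys_closed[OF f] const by (intro ext) (simp add: partial_deriv_def add_pow_rdistr r_distr)
  then show ?case using const polys_coeff[OF f] polys_coeff[OF partial_deriv_closed[OF f]]
    by (simp add: indexed_mult_const_left)
next
  case (add h h')
  have c: "carrier_coeff h" "carrier_coeff h'" "carrier_coeff f" "carrier_coeff (partial_deriv v f)"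
    using polys_coeff[OF add(1)] polys_coeff[OF add(2)] polys_coeff[OF f]
      polys_coeff[OF partial_deriv_closed[OF f]] by simp_all
  have p: "indexed_mult R h f \<in> polys UNIV" "indexed_mult R h' f \<in> polys UNIV"
    using polys_mono[OF add(1), of UNIV] polys_mono[OF add(2), of UNIV] polys_mono[OF f, of UNIV]
    by (auto intro: polys_mult)
  show ?case using add c p by (simp add: indexed_mult_padd_left partial_deriv_padd)
next
  case (pmult h u)
  have c: "carrier_coeff h" "carrier_coeff f" "carrier_coeff (partial_deriv v f)"
    using polys_coeff[OF pmult(1)] polys_coeff[OF f] polys_coeff[OF partial_deriv_closed[OF f]] by simp_all
  have "u \<noteq> v" using pmult v by blast
  hence "partial_deriv v (indexed_pmult (indexed_mult R h f) u) = indexed_pmult (partial_deriv v (indexed_mult R h f)) u"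
    by (auto simp: partial_deriv_def indexed_pmult_def fun_eq_iff)
  thus ?case using pmult c by (simp add: indexed_mult_pmult_left)
qed

end

section \<open>Prime ideals of polynomial rings\<close>

lemma (in ideal) zero_mem: "\<zero> \<in> I"
  by (rule additive_subgroup.zero_closed[OF additive_subgroup_axioms])

lemma (in ideal) add_mem: "a \<in> I \<Longrightarrow> b \<in> I \<Longrightarrow> a \<oplus> b \<in> I"
  by (rule additive_subgroup.a_closed[OF additive_subgroup_axioms])

lemma (in ideal) add_cancel_mem:
  assumes "a \<in> I" "b \<in> carrier R" "a \<oplus> b \<in> I"
  shows "b \<in> I"
proof -
  have a: "a \<in> carrier R" using assms(1) a_subset by blast
  have "\<ominus> a \<in> I" by (rule additive_subgroup.a_inv_closed[OF additive_subgroup_axioms assms(1)])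
  hence "\<ominus> a \<oplus> (a \<oplus> b) \<in> I" using assms(3) by (rule add_mem)
  thus ?thesis using a assms(2) by (simp add: r_neg1)
qed

context cring begin

lemma poly_idealD:
  assumes "ideal Q (poly_ring V)"
  shows "Q \<subseteq> polys V" "(\<lambda>_. \<zero>) \<in> Q"
    "\<And>f g. f \<in> Q \<Longrightarrow> g \<in> Q \<Longrightarrow> indexed_padd f g \<in> Q"
    "\<And>f g. f \<in> polys V \<Longrightarrow> g \<in> Q \<Longrightarrow> indexed_mult R f g \<in> Q"
    "\<And>f c. f \<in> Q \<Longrightarrow> c \<in> carrier R \<Longrightarrow> (\<lambda>m. c \<otimes> f m) \<in> Q"
    "\<And>f v. f \<in> Q \<Longrightarrow> v \<in> V \<Longrightarrow> indexed_pmult f v \<in> Q"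
proof -
  interpret Q: ideal Q "poly_ring V" by fact
  show sub: "Q \<subseteq> polys V" using Q.a_subset by (simp add: poly_ring_simps)
  show "(\<lambda>_. \<zero>) \<in> Q" using Q.zero_mem by (simp add: poly_ring_simps)
  show "indexed_padd f g \<in> Q" if "f \<in> Q" "g \<in> Q" for f g
    using Q.add_mem[OF that] by (simp add: poly_ring_simps)
  show m: "indexed_mult R f g \<in> Q" if "f \<in> polys V" "g \<in> Q" for f g
    using Q.I_l_closed[of g f] that by (simp add: poly_ring_simps)
  show "(\<lambda>m. c \<otimes> f m) \<in> Q" if "f \<in> Q" "c \<in> carrier R" for f c
    using m[OF polys_const[OF that(2)] that(1)] indexed_mult_const_left[OF polys_coeff[OF subsetD[OF sub that(1)]] that(2)]
    by simp
  show "indexed_pmult f v \<in> Q" if "f \<in> Q" "v \<in> V" for f v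
    using m[OF polys_var[OF that(2)] that(1)] pmult_eq_mult_var(2)[OF subsetD[OF sub that(1)], of v] by simp
qed

text \<open>Constants and variables generate the polynomials, so closure under multiplication by
  these gives closure under multiplication by every polynomial.\<close>

lemma poly_idealI:
  assumes "Q \<subseteq> polys V" "(\<lambda>_. \<zero>) \<in> Q"
    and add: "\<And>f g. f \<in> Q \<Longrightarrow> g \<in> Q \<Longrightarrow> indexed_padd f g \<in> Q"
    and scale: "\<And>f c. f \<in> Q \<Longrightarrow> c \<in> carrier R \<Longrightarrow> (\<lambda>m. c \<otimes> f m) \<in> Q"
    and pm: "\<And>f v. f \<in> Q \<Longrightarrow> v \<in> V \<Longrightarrow> indexed_pmult f v \<in> Q"
  shows "ideal Q (poly_ring V)"
proof -
  interpret P: cring "poly_ring V" by (rule poly_ring_cring)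
  have mult: "indexed_mult R f g \<in> Q" if f: "f \<in> polys V" and g: "g \<in> Q" for f g
    using f
  proof (induction rule: polys_induct)
    case (const c)
    then show ?case using scale[OF g] polys_coeff[of g V] g assms(1) by (auto simp: indexed_mult_const_left)
  next
    case (add h h')
    have "carrier_coeff g" using polys_coeff[of g V] g assms(1) by blast
    thus ?case using add assms(3) polys_coeff[OF add(1)] polys_coeff[OF add(2)] by (simp add: indexed_mult_padd_left)
  next
    case (pmult h v)
    have "carrier_coeff g" using polys_coeff[of g V] g assms(1) by blast
    thus ?case using pmult pm polys_coeff[OF pmult(1)] by (simp add: indexed_mult_pmult_left)
  qed
  show ?thesis
  proof (rule idealI)
    show "ring (poly_ring V)" by (rule P.ring_axioms)
    show "subgroup Q (add_monoid (poly_ring V))"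
    proof (rule P.add.subgroupI)
      show "Q \<subseteq> carrier (poly_ring V)" using assms(1) by (simp add: poly_ring_simps)
      fix f assume f: "f \<in> Q"
      have fc: "f \<in> polys V" using f assms(1) by blast
      have "\<ominus>\<^bsub>poly_ring V\<^esub> f = (\<lambda>m. \<ominus> \<one> \<otimes> f m)"
      proof (rule P.minus_equality)
        show "(\<lambda>m. \<ominus> \<one> \<otimes> f m) \<oplus>\<^bsub>poly_ring V\<^esub> f = \<zero>\<^bsub>poly_ring V\<^esub>"
          using polys_closed[OF fc] by (auto simp: poly_ring_simps indexed_padd_def l_minus l_neg)
      qed (use fc polys_scale[OF fc, of "\<ominus> \<one>"] in \<open>simp_all add: poly_ring_simps\<close>)
      thus "\<ominus>\<^bsub>poly_ring V\<^esub> f \<in> Q" using scale[OF f, of "\<ominus> \<one>"] by simp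
    qed (use assms(2) add in \<open>auto simp: poly_ring_simps\<close>)
    fix g f assume "g \<in> Q" "f \<in> carrier (poly_ring V)"
    thus "f \<otimes>\<^bsub>poly_ring V\<^esub> g \<in> Q" using mult by (simp add: poly_ring_simps)
    moreover have "f \<otimes>\<^bsub>poly_ring V\<^esub> g = g \<otimes>\<^bsub>poly_ring V\<^esub> f"
      using \<open>g \<in> Q\<close> \<open>f \<in> carrier (poly_ring V)\<close> assms(1) by (intro P.m_comm) (auto simp: poly_ring_simps)
    ultimately show "g \<otimes>\<^bsub>poly_ring V\<^esub> f \<in> Q" by simp
  qed
qed

lemma poly_primeidealI:
  assumes "ideal Q (poly_ring V)" "indexed_const \<one> \<notin> Q"
    "\<And>f g. f \<in> polys V \<Longrightarrow> g \<in> polys V \<Longrightarrow> indexed_mult R f g \<in> Q \<Longrightarrow> f \<in> Q \<or> g \<in> Q"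
  shows "primeideal Q (poly_ring V)"
proof (rule primeidealI[OF assms(1) poly_ring_cring])
  show "carrier (poly_ring V) \<noteq> Q" using assms(2) polys_const[of \<one> V] by (auto simp: poly_ring_simps)
qed (use assms(3) in \<open>simp add: poly_ring_simps\<close>)

lemma poly_primeidealD:
  assumes "primeideal Q (poly_ring V)"
  shows "indexed_const \<one> \<notin> Q"
    "\<And>f g. f \<in> polys V \<Longrightarrow> g \<in> polys V \<Longrightarrow> indexed_mult R f g \<in> Q \<Longrightarrow> f \<in> Q \<or> g \<in> Q"
proof -
  interpret Q: primeideal Q "poly_ring V" by fact
  show "indexed_const \<one> \<notin> Q"
    using Q.one_imp_carrier Q.I_notcarr unfolding poly_ring_simps(4) by blast
  show "f \<in> polys V \<Longrightarrow> g \<in> polys V \<Longrightarrow> indexed_mult R f g \<in> Q \<Longrightarrow> f \<in> Q \<or> g \<in> Q" for f g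
    using Q.I_prime[of f g] by (simp add: poly_ring_simps)
qed

text \<open>The extension to \<open>R[V]\<close> of the contraction of \<open>Q\<close> to \<open>R[V - {v}]\<close>.\<close>

definition var_extension :: "'c set \<Rightarrow> 'c \<Rightarrow> ('c multiset \<Rightarrow> 'a) set \<Rightarrow> ('c multiset \<Rightarrow> 'a) set" where
  "var_extension V v Q = {f \<in> polys V. \<forall>k. var_coeff v k f \<in> Q}"

lemma var_extension_ideal:
  assumes Q: "ideal Q (poly_ring V)"
  shows "ideal (var_extension V v Q) (poly_ring V)"
proof (rule poly_idealI)
  note QD = poly_idealD[OF Q]
  have "var_coeff v k (\<lambda>_. \<zero>) = (\<lambda>_. \<zero>)" for k by (auto simp: var_coeff_def)
  thus "(\<lambda>_. \<zero>) \<in> var_extension V v Q" using QD(2) polys_zero by (simp add: var_extension_def)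
  fix f assume f: "f \<in> var_extension V v Q"
  { fix g assume "g \<in> var_extension V v Q"
    thus "indexed_padd f g \<in> var_extension V v Q"
      using f QD(3) by (simp add: var_extension_def var_coeff_padd indexed_pset.indexed_padd) }
  { fix c assume "c \<in> carrier R"
    thus "(\<lambda>m. c \<otimes> f m) \<in> var_extension V v Q"
      using f QD(5) by (simp add: var_extension_def var_coeff_scale polys_scale) }
  fix u assume u: "u \<in> V"
  have "var_coeff v k (indexed_pmult f u) \<in> Q" for k
  proof (cases "u = v")
    case True
    thus ?thesis using f QD(2) by (cases k) (simp_all add: var_extension_def var_coeff_0_pmult var_coeff_Suc_pmult)
  next
    case False
    thus ?thesis using f QD(6) u by (simp add: var_extension_def var_coeff_pmult_other)
  qed
  thus "indexed_pmult f u \<in> var_extension V v Q"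
    using f u by (simp add: var_extension_def indexed_pset.indexed_pmult)
next
  show "var_extension V v Q \<subseteq> polys V" unfolding var_extension_def by blast
qed

lemma free_mem_var_extension_iff:
  assumes Q: "ideal Q (poly_ring V)" and f: "f \<in> polys (V - {v})"
  shows "f \<in> var_extension V v Q \<longleftrightarrow> f \<in> Q"
proof -
  have "v \<notin> V - {v}" by simp
  note var_coeff_free[OF f this]
  thus ?thesis
    unfolding var_extension_def using poly_idealD(2)[OF Q] polys_mono[OF f, of V]
    by (auto split: if_splits)
qed

lemma pmult_mem_var_extension:
  assumes "f \<in> polys V" "indexed_pmult f v \<in> var_extension V v Q"
  shows "f \<in> var_extension V v Q"
proof -
  have "var_coeff v (Suc k) (indexed_pmult f v) \<in> Q" for k using assms(2) by (simp add: var_extension_def)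
  thus ?thesis using assms(1) by (simp add: var_extension_def var_coeff_Suc_pmult)
qed

lemma var_extension_shift:
  assumes Q: "ideal Q (poly_ring V)" and v: "v \<in> V" and f: "f \<in> polys V" and g: "g \<in> polys V"
    and fg: "indexed_mult R f g \<in> var_extension V v Q" and k: "var_coeff v k f \<notin> Q"
  shows "\<exists>f'\<in>polys V. indexed_mult R f' g \<in> var_extension V v Q \<and> var_coeff v 0 f' \<notin> Q"
  using f fg k
proof (induction k arbitrary: f)
  case (Suc k)
  interpret E: ideal "var_extension V v Q" "poly_ring V" using Q by (rule var_extension_ideal)
  interpret P: cring "poly_ring V" by (rule poly_ring_cring)
  show ?case
  proof (cases "var_coeff v 0 f \<in> Q")
    case True
    let ?c = "var_coeff v 0 f" and ?s = "var_shift v f"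
    have c: "?c \<in> polys V" "?c \<in> polys (V - {v})" using var_coeff_closed[OF Suc.prems(1), of v 0] polys_mono[of ?c "V - {v}" V] by auto
    have s: "?s \<in> polys V" using Suc.prems(1) by (rule var_shift_closed)
    have "?c \<in> var_extension V v Q" using True free_mem_var_extension_iff[OF Q c(2)] by simp
    hence cg: "indexed_mult R ?c g \<in> var_extension V v Q"
      using E.I_r_closed[of ?c g] g by (simp add: poly_ring_simps)
    have "indexed_mult R f g = indexed_padd (indexed_mult R ?c g) (indexed_pmult (indexed_mult R ?s g) v)"
      using polys_coeff[OF c(1)] polys_coeff[OF s] polys_coeff[OF g] polys_coeff[OF indexed_pset.indexed_pmult[OF s v]]
      by (subst var_decomposition[OF Suc.prems(1), of v])
        (simp add: indexed_mult_padd_left indexed_mult_pmult_left)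
    moreover have p: "indexed_pmult (indexed_mult R ?s g) v \<in> polys V" "indexed_mult R ?c g \<in> polys V"
      using polys_mult[OF s g] polys_mult[OF c(1) g] v by (auto intro: indexed_pset.indexed_pmult)
    ultimately have "indexed_mult R ?c g \<oplus>\<^bsub>poly_ring V\<^esub> indexed_pmult (indexed_mult R ?s g) v \<in> var_extension V v Q"
      using Suc.prems(2) by (simp add: poly_ring_simps)
    hence "indexed_pmult (indexed_mult R ?s g) v \<in> var_extension V v Q"
      by (rule E.add_cancel_mem[OF cg _, unfolded poly_ring_simps(1), OF p(1)])
    hence "indexed_mult R ?s g \<in> var_extension V v Q"
      using polys_mult[OF s g] by (rule pmult_mem_var_extension[rotated])
    moreover have "var_coeff v k ?s \<notin> Q" using Suc.prems(3) by (simp add: var_coeff_shift)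
    ultimately show ?thesis using Suc.IH[OF s] by blast
  qed (use Suc.prems in blast)
qed blast

text \<open>Horner's scheme rebuilds f from its coefficients by multiplying with v and adding the
  next coefficient, which never leaves Q.\<close>

lemma var_extension_subset:
  assumes Q: "ideal Q (poly_ring V)" and v: "v \<in> V"
  shows "var_extension V v Q \<subseteq> Q"
proof
  fix f assume f: "f \<in> var_extension V v Q"
  have fp: "f \<in> polys V" using f by (simp add: var_extension_def)
  \<comment> \<open>Exceeds the degree of f in v, so that the base case d = 0 leaves only f =
    0.\<close>
  define d where "d = Suc (Max ((\<lambda>m. count m v) ` {m. f m \<noteq> \<zero>}))"
  have "count m v < d" if "f m \<noteq> \<zero>" for m
    unfolding d_def using that polys_finite_support[OF fp] by (auto simp: less_Suc_eq_le intro!: Max_ge)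
  moreover have "\<forall>k. var_coeff v k f \<in> Q" using f by (simp add: var_extension_def)
  ultimately show "f \<in> Q" using fp
  proof (induction d arbitrary: f)
    case 0
    have "f = (\<lambda>_. \<zero>)" using 0(1) by auto
    then show ?case using poly_idealD(2)[OF Q] by simp
  next
    case (Suc d)
    have "count m v < d" if "var_shift v f m \<noteq> \<zero>" for m
      using Suc.prems(1)[of "add_mset v m"] that by (simp add: var_shift_def)
    hence "var_shift v f \<in> Q"
      using Suc.prems var_shift_closed[of f V v] by (intro Suc.IH) (auto simp: var_coeff_shift)
    thus ?case
      using Suc.prems poly_idealD(3,6)[OF Q] v by (subst var_decomposition[OF Suc.prems(3), of v]) auto
  qed
qed

text \<open>The argument of Gauss's lemma: if neither factor belongs to the extension, both can be
  replaced by polynomials with constant term outside Q whose product still belongs to it. The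
  constant term of that product is a product of two elements outside Q, yet lies in Q.\<close>

lemma var_extension_prime:
  assumes Q: "primeideal Q (poly_ring V)" and v: "v \<in> V"
  shows "primeideal (var_extension V v Q) (poly_ring V)"
proof (rule poly_primeidealI)
  note Qi = primeideal.axioms(1)[OF Q]
  show "ideal (var_extension V v Q) (poly_ring V)" by (rule var_extension_ideal[OF Qi])
  show "indexed_const \<one> \<notin> var_extension V v Q"
    using poly_primeidealD(1)[OF Q] var_extension_subset[OF Qi v] by blast
  fix f g assume fg: "f \<in> polys V" "g \<in> polys V" "indexed_mult R f g \<in> var_extension V v Q"
  show "f \<in> var_extension V v Q \<or> g \<in> var_extension V v Q"
  proof (rule ccontr)
    assume "\<not> ?thesis"
    then obtain i j where ij: "var_coeff v i f \<notin> Q" "var_coeff v j g \<notin> Q"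
      using fg unfolding var_extension_def by blast
    obtain f' where f': "f' \<in> polys V" "indexed_mult R f' g \<in> var_extension V v Q" "var_coeff v 0 f' \<notin> Q"
      using var_extension_shift[OF Qi v fg ij(1)] by blast
    have "indexed_mult R g f' \<in> var_extension V v Q"
      using f' indexed_mult_comm[OF polys_coeff[OF f'(1)] polys_coeff[OF fg(2)]] by simp
    then obtain g' where g': "g' \<in> polys V" "indexed_mult R g' f' \<in> var_extension V v Q" "var_coeff v 0 g' \<notin> Q"
      using var_extension_shift[OF Qi v fg(2) f'(1) _ ij(2)] by blast
    have "var_coeff v 0 (indexed_mult R g' f') \<in> Q" using g' by (simp add: var_extension_def)
    hence "indexed_mult R (var_coeff v 0 g') (var_coeff v 0 f') \<in> Q"
      by (simp add: var_coeff_0_mult[OF g'(1) f'(1)])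
    moreover have "var_coeff v 0 g' \<in> polys V" "var_coeff v 0 f' \<in> polys V"
      using polys_mono[OF var_coeff_closed[OF g'(1)], of v V] polys_mono[OF var_coeff_closed[OF f'(1)], of v V] by auto
    ultimately show False using poly_primeidealD(2)[OF Q] f'(3) g'(3) by blast
  qed
qed

section \<open>Primes described by coefficients\<close>

lemma constant_coeff_mult:
  assumes "f \<in> polys V" "g \<in> polys V"
  shows "indexed_mult R f g {#} = f {#} \<otimes> g {#}"
proof -
  have "{x. fst x + snd x = ({#} :: 'c multiset)} = {({#}, {#})}" by auto
  thus ?thesis unfolding indexed_mult_def using polys_closed[OF assms(1)] polys_closed[OF assms(2)] by simp
qed

lemma constant_coeff_prime:
  assumes q: "primeideal q R"
  shows "primeideal {f \<in> polys V. f {#} \<in> q} (poly_ring V)"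
proof (rule poly_primeidealI)
  interpret q: primeideal q R by fact
  show "ideal {f \<in> polys V. f {#} \<in> q} (poly_ring V)"
    by (rule poly_idealI) (auto simp: polys_zero indexed_padd_def indexed_pmult_def q.I_l_closed
        intro: polys_scale indexed_pset.indexed_pmult indexed_pset.indexed_padd[unfolded indexed_padd_def]
          indexed_pset.indexed_pmult[unfolded indexed_pmult_def])
  show "indexed_const \<one> \<notin> {f \<in> polys V. f {#} \<in> q}"
    using q.one_imp_carrier q.I_notcarr by (auto simp: indexed_const_def)
  fix f g assume fg: "f \<in> polys V" "g \<in> polys V" "indexed_mult R f g \<in> {f \<in> polys V. f {#} \<in> q}"
  thus "f \<in> {f \<in> polys V. f {#} \<in> q} \<or> g \<in> {f \<in> polys V. f {#} \<in> q}"
    using q.I_prime[of "f {#}" "g {#}"] polys_closed constant_coeff_mult[OF fg(1,2)] by auto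
qed

text \<open>The extension of q to the polynomial ring, the kernel of reducing coefficients modulo
  q.\<close>

definition coeff_ideal :: "'c set \<Rightarrow> 'a set \<Rightarrow> ('c multiset \<Rightarrow> 'a) set" where
  "coeff_ideal V q = {f \<in> polys V. \<forall>m. f m \<in> q}"

text \<open>The ideals \<open>?Q U\<close> interpolate between the condition on the constant
  coefficient alone, for U empty, and the condition on all coefficients, for U = V. Adding one
  variable to U is one application of \<open>var_extension\<close>, which preserves
  primality.\<close>

lemma coeff_ideal_prime:
  assumes q: "primeideal q R" and V: "finite V"
  shows "primeideal (coeff_ideal V q) (poly_ring V)"
proof -
  interpret q: primeideal q R by fact
  let ?Q = "\<lambda>U. {f \<in> polys V. \<forall>m. set_mset m \<subseteq> U \<longrightarrow> f m \<in> q}"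
  have "U \<subseteq> V \<Longrightarrow> primeideal (?Q U) (poly_ring V)" if "finite U" for U
    using that
  proof (induction U)
    case empty
    have "?Q {} = {f \<in> polys V. f {#} \<in> q}" by auto
    then show ?case using constant_coeff_prime[OF q] by simp
  next
    case (insert v U)
    have "var_extension V v (?Q U) = ?Q (insert v U)"
    proof (intro equalityI subsetI)
      fix f assume f: "f \<in> var_extension V v (?Q U)"
      have "f m \<in> q" if m: "set_mset m \<subseteq> insert v U" for m
      proof -
        let ?m = "filter_mset (\<lambda>u. u \<noteq> v) m"
        have eq: "?m + replicate_mset (count m v) v = m"
          by (auto simp: multiset_eq_iff)
        have "set_mset ?m \<subseteq> U" using m by auto
        moreover have "var_coeff v (count m v) f \<in> ?Q U" using f by (simp add: var_extension_def)
        ultimately have "var_coeff v (count m v) f ?m \<in> q" by blast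
        thus ?thesis unfolding var_coeff_def eq by simp
      qed
      thus "f \<in> ?Q (insert v U)" using f by (auto simp: var_extension_def)
    next
      fix f assume f: "f \<in> ?Q (insert v U)"
      have "var_coeff v k f \<in> ?Q U" for k
      proof -
        have "var_coeff v k f m \<in> q" if "set_mset m \<subseteq> U" for m
        proof -
          have "set_mset (m + replicate_mset k v) \<subseteq> insert v U" using that by auto
          thus ?thesis using f q.zero_mem by (auto simp: var_coeff_def)
        qed
        thus ?thesis using f var_coeff_closed[of f V v k] polys_mono[of "var_coeff v k f" "V - {v}" V] by auto
      qed
      thus "f \<in> var_extension V v (?Q U)" using f by (simp add: var_extension_def)
    qed
    thus ?case using var_extension_prime[of "?Q U" V v] insert by simp
  qed
  from this[OF V order_refl] have "primeideal (?Q V) (poly_ring V)" .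
  moreover have "?Q V = coeff_ideal V q"
  proof (intro equalityI subsetI)
    fix f assume f: "f \<in> ?Q V"
    have "f m \<in> q" for m
      using f polys_support[of f V m] q.zero_mem by (cases "f m = \<zero>") auto
    thus "f \<in> coeff_ideal V q" using f by (simp add: coeff_ideal_def)
  qed (simp add: coeff_ideal_def)
  ultimately show ?thesis by simp
qed

end

section \<open>Evaluation of polynomials\<close>

definition eval_monom :: "('d, 'e) ring_scheme \<Rightarrow> ('c \<Rightarrow> 'd) \<Rightarrow> 'c multiset \<Rightarrow> 'd" where
  "eval_monom T a m = (\<Otimes>\<^bsub>T\<^esub>v\<in>set_mset m. a v [^]\<^bsub>T\<^esub> count m v)"

definition poly_eval ::
    "('a, 'b) ring_scheme \<Rightarrow> ('d, 'e) ring_scheme \<Rightarrow> ('a \<Rightarrow> 'd) \<Rightarrow> ('c \<Rightarrow> 'd) \<Rightarrow> ('c multiset \<Rightarrow> 'a) \<Rightarrow> 'd" where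
  "poly_eval R T \<sigma> a f = (\<Oplus>\<^bsub>T\<^esub>m\<in>{m. f m \<noteq> \<zero>\<^bsub>R\<^esub>}. \<sigma> (f m) \<otimes>\<^bsub>T\<^esub> eval_monom T a m)"

lemma (in cring) eval_monom_closed:
  assumes "\<And>v. v \<in> set_mset m \<Longrightarrow> a v \<in> carrier R"
  shows "eval_monom R a m \<in> carrier R"
  unfolding eval_monom_def using assms by (intro finprod_closed) auto

lemma (in cring) eval_monom_add_mset:
  assumes "\<And>u. u \<in> set_mset m \<Longrightarrow> a u \<in> carrier R" "a v \<in> carrier R"
  shows "eval_monom R a (add_mset v m) = a v \<otimes> eval_monom R a m"
proof -
  let ?F = "set_mset m - {v}"
  have cl: "\<And>k u. u \<in> ?F \<Longrightarrow> a u [^] (k::nat) \<in> carrier R" using assms by auto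
  have ins: "set_mset (add_mset v m) = insert v ?F" by auto
  have "eval_monom R a (add_mset v m) = a v [^] Suc (count m v) \<otimes> (\<Otimes>u\<in>?F. a u [^] count (add_mset v m) u)"
    unfolding eval_monom_def ins using assms cl by (subst finprod_insert) auto
  also have "(\<Otimes>u\<in>?F. a u [^] count (add_mset v m) u) = (\<Otimes>u\<in>?F. a u [^] count m u)"
    using cl by (intro finprod_cong') auto
  finally have 1: "eval_monom R a (add_mset v m) = a v [^] Suc (count m v) \<otimes> (\<Otimes>u\<in>?F. a u [^] count m u)" .
  have "eval_monom R a m = a v [^] count m v \<otimes> (\<Otimes>u\<in>?F. a u [^] count m u)"
  proof (cases "v \<in># m")
    case True
    hence ins: "set_mset m = insert v ?F" by auto
    have "eval_monom R a m = (\<Otimes>u\<in>insert v ?F. a u [^] count m u)"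
      unfolding eval_monom_def using ins by simp
    also have "\<dots> = a v [^] count m v \<otimes> (\<Otimes>u\<in>?F. a u [^] count m u)"
      using assms cl by (intro finprod_insert) auto
    finally show ?thesis .
  next
    case False
    hence "?F = set_mset m" "count m v = 0" by (auto simp: not_in_iff)
    thus ?thesis using assms finprod_closed[of "\<lambda>u. a u [^] count m u" "set_mset m"]
      unfolding eval_monom_def by auto
  qed
  moreover have "(\<Otimes>u\<in>?F. a u [^] count m u) \<in> carrier R" using cl by (intro finprod_closed) auto
  ultimately show ?thesis unfolding 1 using assms by (simp add: m_ac)
qed

lemma (in cring) eval_monom_empty: "eval_monom R a {#} = \<one>"
  unfolding eval_monom_def by simp

text \<open>Evaluation along a homomorphism \<sigma> of the coefficients. Two instances matter:
  substituting polynomials into polynomials, with \<sigma> the inclusion of constants, and a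
  substitution with values in a localization, where variables may go to fractions.\<close>

locale poly_evaluation = h: ring_hom_cring R T \<sigma> 
  for R :: "('a, 'b) ring_scheme" (structure) and T :: "('d, 'e) ring_scheme" (structure) and \<sigma> +
  fixes V :: "'c set" and a :: "'c \<Rightarrow> 'd"
  assumes a_closed: "v \<in> V \<Longrightarrow> a v \<in> carrier T"
begin

lemma monom_closed: "set_mset m \<subseteq> V \<Longrightarrow> eval_monom T a m \<in> carrier T"
  using a_closed by (intro h.S.eval_monom_closed) auto

text \<open>The defining sum runs over the support, which changes with f; a common finite index set
  allows several sums to be compared.\<close>

lemma eval_superset:
  assumes "finite F" "{m. f m \<noteq> \<zero>\<^bsub>R\<^esub>} \<subseteq> F" "\<And>m. f m \<in> carrier R" "\<And>m. m \<in> F \<Longrightarrow> set_mset m \<subseteq> V"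
  shows "poly_eval R T \<sigma> a f = (\<Oplus>\<^bsub>T\<^esub>m\<in>F. \<sigma> (f m) \<otimes>\<^bsub>T\<^esub> eval_monom T a m)"
  unfolding poly_eval_def
proof (rule h.S.add.finprod_mono_neutral_cong_left[OF assms(1,2)])
  show "(\<lambda>m. \<sigma> (f m) \<otimes>\<^bsub>T\<^esub> eval_monom T a m) \<in> F \<rightarrow> carrier T"
    using assms monom_closed by auto
  fix m assume m: "m \<in> F - {m. f m \<noteq> \<zero>\<^bsub>R\<^esub>}"
  show "\<sigma> (f m) \<otimes>\<^bsub>T\<^esub> eval_monom T a m = \<zero>\<^bsub>T\<^esub>"
    using m assms monom_closed by auto
qed simp

lemma eval_const: "c \<in> carrier R \<Longrightarrow> poly_eval R T \<sigma> a (h.R.indexed_const c) = \<sigma> c"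
  by (subst eval_superset[of "{{#}}"])
    (auto simp: h.R.indexed_const_def h.S.eval_monom_empty)

lemma eval_closed:
  assumes "f \<in> h.R.polys V"
  shows "poly_eval R T \<sigma> a f \<in> carrier T"
  unfolding poly_eval_def
  using h.R.polys_support[OF assms] h.R.polys_closed[OF assms] monom_closed by (intro h.S.finsum_closed) auto

lemma eval_padd:
  assumes f: "f \<in> h.R.polys V" and g: "g \<in> h.R.polys V"
  shows "poly_eval R T \<sigma> a (h.R.indexed_padd f g) = poly_eval R T \<sigma> a f \<oplus>\<^bsub>T\<^esub> poly_eval R T \<sigma> a g"
proof -
  let ?F = "{m. f m \<noteq> \<zero>\<^bsub>R\<^esub>} \<union> {m. g m \<noteq> \<zero>\<^bsub>R\<^esub>}"
  have F: "finite ?F" using h.R.polys_finite_support f g by blast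
  have V: "set_mset m \<subseteq> V" if "m \<in> ?F" for m using that h.R.polys_support[OF f] h.R.polys_support[OF g] by blast
  note cl = h.R.polys_closed[OF f] h.R.polys_closed[OF g]
  have "poly_eval R T \<sigma> a (h.R.indexed_padd f g) = (\<Oplus>\<^bsub>T\<^esub>m\<in>?F. \<sigma> (f m \<oplus> g m) \<otimes>\<^bsub>T\<^esub> eval_monom T a m)"
    using F V cl by (subst eval_superset[of ?F]) (auto simp: h.R.indexed_padd_def)
  also have "\<dots> = (\<Oplus>\<^bsub>T\<^esub>m\<in>?F. \<sigma> (f m) \<otimes>\<^bsub>T\<^esub> eval_monom T a m \<oplus>\<^bsub>T\<^esub> \<sigma> (g m) \<otimes>\<^bsub>T\<^esub> eval_monom T a m)"
    using V cl monom_closed by (intro h.S.finsum_cong') (auto simp: h.S.l_distr)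
  also have "\<dots> = (\<Oplus>\<^bsub>T\<^esub>m\<in>?F. \<sigma> (f m) \<otimes>\<^bsub>T\<^esub> eval_monom T a m) \<oplus>\<^bsub>T\<^esub> (\<Oplus>\<^bsub>T\<^esub>m\<in>?F. \<sigma> (g m) \<otimes>\<^bsub>T\<^esub> eval_monom T a m)"
    using V cl monom_closed by (intro h.S.finsum_addf) auto
  also have "\<dots> = poly_eval R T \<sigma> a f \<oplus>\<^bsub>T\<^esub> poly_eval R T \<sigma> a g"
    using eval_superset[of ?F f] eval_superset[of ?F g] F V cl by simp
  finally show ?thesis .
qed

lemma eval_pmult:
  assumes f: "f \<in> h.R.polys V" and v: "v \<in> V"
  shows "poly_eval R T \<sigma> a (h.R.indexed_pmult f v) = a v \<otimes>\<^bsub>T\<^esub> poly_eval R T \<sigma> a f"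
proof -
  let ?F = "{m. f m \<noteq> \<zero>\<^bsub>R\<^esub>}"
  have F: "finite ?F" using h.R.polys_finite_support f by blast
  have V: "set_mset m \<subseteq> V" if "m \<in> ?F" for m using that h.R.polys_support[OF f] by blast
  note cl = h.R.polys_closed[OF f]
  have cl': "h.R.indexed_pmult f v m \<in> carrier R" for m using cl by (simp add: h.R.indexed_pmult_def)
  have sup: "{m. h.R.indexed_pmult f v m \<noteq> \<zero>\<^bsub>R\<^esub>} \<subseteq> add_mset v ` ?F"
  proof
    fix m assume "m \<in> {m. h.R.indexed_pmult f v m \<noteq> \<zero>\<^bsub>R\<^esub>}"
    hence "m = add_mset v (m - {#v#})" "m - {#v#} \<in> ?F"
      by (auto simp: h.R.indexed_pmult_def split: if_splits)
    thus "m \<in> add_mset v ` ?F" by (rule image_eqI)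
  qed
  have V': "set_mset m \<subseteq> V" if "m \<in> add_mset v ` ?F" for m using V v that by (force simp: subset_iff)
  have "poly_eval R T \<sigma> a (h.R.indexed_pmult f v) =
      (\<Oplus>\<^bsub>T\<^esub>m\<in>add_mset v ` ?F. \<sigma> (h.R.indexed_pmult f v m) \<otimes>\<^bsub>T\<^esub> eval_monom T a m)"
    using F by (intro eval_superset sup cl' V') auto
  also have "\<dots> = (\<Oplus>\<^bsub>T\<^esub>m\<in>?F. \<sigma> (h.R.indexed_pmult f v (add_mset v m)) \<otimes>\<^bsub>T\<^esub> eval_monom T a (add_mset v m))"
    using cl' V' monom_closed by (intro h.S.finsum_reindex) (auto simp: inj_on_def)
  also have "\<dots> = (\<Oplus>\<^bsub>T\<^esub>m\<in>?F. a v \<otimes>\<^bsub>T\<^esub> (\<sigma> (f m) \<otimes>\<^bsub>T\<^esub> eval_monom T a m))"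
  proof (intro h.S.finsum_cong' refl)
    show "(\<lambda>m. a v \<otimes>\<^bsub>T\<^esub> (\<sigma> (f m) \<otimes>\<^bsub>T\<^esub> eval_monom T a m)) \<in> ?F \<rightarrow> carrier T"
      using cl V monom_closed a_closed[OF v] by auto
    fix m assume m: "m \<in> ?F"
    have "eval_monom T a (add_mset v m) = a v \<otimes>\<^bsub>T\<^esub> eval_monom T a m"
      using V[OF m] a_closed v by (intro h.S.eval_monom_add_mset) auto
    thus "\<sigma> (h.R.indexed_pmult f v (add_mset v m)) \<otimes>\<^bsub>T\<^esub> eval_monom T a (add_mset v m) =
        a v \<otimes>\<^bsub>T\<^esub> (\<sigma> (f m) \<otimes>\<^bsub>T\<^esub> eval_monom T a m)"
      using cl[of m] monom_closed[OF V[OF m]] a_closed[OF v] by (simp add: h.R.indexed_pmult_def h.S.m_ac)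
  qed
  also have "\<dots> = a v \<otimes>\<^bsub>T\<^esub> (\<Oplus>\<^bsub>T\<^esub>m\<in>?F. \<sigma> (f m) \<otimes>\<^bsub>T\<^esub> eval_monom T a m)"
    using F cl V monom_closed a_closed[OF v] by (intro h.S.finsum_rdistr[symmetric]) auto
  finally show ?thesis unfolding poly_eval_def .
qed

lemma eval_mult:
  assumes f: "f \<in> h.R.polys V" and g: "g \<in> h.R.polys V"
  shows "poly_eval R T \<sigma> a (indexed_mult R f g) = poly_eval R T \<sigma> a f \<otimes>\<^bsub>T\<^esub> poly_eval R T \<sigma> a g"
  using f
proof (induction rule: h.R.polys_induct)
  case (const c)
  have e: "indexed_mult R (h.R.indexed_const c) g = (\<lambda>m. c \<otimes> g m)"
    using h.R.indexed_mult_const_left[OF h.R.polys_coeff[OF g] const] .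
  note cl = h.R.polys_closed[OF g]
  have "poly_eval R T \<sigma> a (\<lambda>m. c \<otimes> g m) = (\<Oplus>\<^bsub>T\<^esub>m\<in>{m. g m \<noteq> \<zero>\<^bsub>R\<^esub>}. \<sigma> (c \<otimes> g m) \<otimes>\<^bsub>T\<^esub> eval_monom T a m)"
    using h.R.polys_finite_support[OF g] h.R.polys_support[OF g] cl const
    by (intro eval_superset) auto
  also have "\<dots> = (\<Oplus>\<^bsub>T\<^esub>m\<in>{m. g m \<noteq> \<zero>\<^bsub>R\<^esub>}. \<sigma> c \<otimes>\<^bsub>T\<^esub> (\<sigma> (g m) \<otimes>\<^bsub>T\<^esub> eval_monom T a m))"
    using h.R.polys_support[OF g] cl const monom_closed
    by (intro h.S.finsum_cong') (auto simp: h.S.m_assoc)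
  also have "\<dots> = \<sigma> c \<otimes>\<^bsub>T\<^esub> poly_eval R T \<sigma> a g"
    unfolding poly_eval_def
    using h.R.polys_finite_support[OF g] h.R.polys_support[OF g] cl const monom_closed
    by (intro h.S.finsum_rdistr[symmetric]) auto
  finally show ?case unfolding e eval_const[OF const] .
next
  case (add f f')
  show ?case
    using add h.R.polys_coeff[OF add(1)] h.R.polys_coeff[OF add(2)] h.R.polys_coeff[OF g]
      h.R.polys_mult[OF add(1) g] h.R.polys_mult[OF add(2) g] eval_closed[OF add(1)] eval_closed[OF add(2)] eval_closed[OF g]
    by (simp add: h.R.indexed_mult_padd_left eval_padd h.S.l_distr)
next
  case (pmult f v)
  show ?case
    using pmult h.R.polys_coeff[OF pmult(1)] h.R.polys_coeff[OF g]
      h.R.polys_mult[OF pmult(1) g] eval_closed[OF pmult(1)] eval_closed[OF g] a_closed[OF pmult(2)]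
    by (simp add: h.R.indexed_mult_pmult_left eval_pmult h.S.m_assoc)
qed

lemma eval_hom: "ring_hom_cring (h.R.poly_ring V) T (poly_eval R T \<sigma> a)"
proof (rule ring_hom_cringI[OF h.R.poly_ring_cring h.S.is_cring], rule ring_hom_memI)
  show "poly_eval R T \<sigma> a \<one>\<^bsub>h.R.poly_ring V\<^esub> = \<one>\<^bsub>T\<^esub>"
    by (simp add: h.R.poly_ring_simps eval_const)
qed (simp_all add: h.R.poly_ring_simps eval_closed eval_mult eval_padd)

end

context cring begin

section \<open>Substitution of polynomials into polynomials\<close>

lemma indexed_const_hom: "ring_hom_cring R (poly_ring V) indexed_const"
proof (rule ring_hom_cringI[OF is_cring poly_ring_cring], rule ring_hom_memI)
  fix x y assume xy: "x \<in> carrier R" "y \<in> carrier R"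
  show "indexed_const (x \<otimes> y) = indexed_const x \<otimes>\<^bsub>poly_ring V\<^esub> indexed_const y"
    unfolding poly_ring_simps(2) indexed_mult_const_left[OF polys_coeff[OF polys_const[OF xy(2)]] xy(1)]
    using xy by (auto simp: indexed_const_def)
qed (auto simp: poly_ring_simps polys_const indexed_padd_const)

lemma poly_evaluation_into_polys:
  assumes "\<And>v. v \<in> J \<Longrightarrow> g v \<in> polys V"
  shows "poly_evaluation R (poly_ring V) indexed_const J g"
  using assms indexed_const_hom unfolding poly_evaluation_def poly_evaluation_axioms_def
  by (simp add: poly_ring_simps)

abbreviation peval :: "'c set \<Rightarrow> ('d \<Rightarrow> 'c multiset \<Rightarrow> 'a) \<Rightarrow> ('d multiset \<Rightarrow> 'a) \<Rightarrow> 'c multiset \<Rightarrow> 'a" where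
  "peval V g \<equiv> poly_eval R (poly_ring V) indexed_const g"

lemma peval_var:
  assumes "f \<in> polys W" "W \<subseteq> V"
  shows "peval V indexed_var f = f"
proof -
  interpret E: poly_evaluation R "poly_ring V" indexed_const W indexed_var
    using assms(2) polys_var[of _ V] by (intro poly_evaluation_into_polys) auto
  show ?thesis using assms(1)
  proof (induction rule: polys_induct)
    case (const c)
    then show ?case by (rule E.eval_const)
  next
    case (add f g)
    then show ?case using E.eval_padd[OF add(1,2)] by (simp add: poly_ring_simps)
  next
    case (pmult f v)
    have "f \<in> polys V" using polys_mono[OF pmult(1) assms(2)] .
    then show ?case using E.eval_pmult[OF pmult(1,2)] pmult(3) pmult_eq_mult_var(2)[of f V v]
      by (simp add: poly_ring_simps)
  qed
qed

lemma peval_mem_ideal: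
  assumes Q: "ideal Q (poly_ring V)" and q: "\<And>c. c \<in> q \<Longrightarrow> indexed_const c \<in> Q"
    and g: "\<And>v. v \<in> J \<Longrightarrow> g v \<in> polys V" and f: "f \<in> polys J" "\<And>m. f m \<in> q"
  shows "peval V g f \<in> Q"
proof -
  interpret E: poly_evaluation R "poly_ring V" indexed_const J g
    using g by (rule poly_evaluation_into_polys)
  interpret Q: ideal Q "poly_ring V" by fact
  show ?thesis
    unfolding poly_eval_def
  proof (rule E.h.S.finsum_ideal_closed[OF Q])
    show "finite {m. f m \<noteq> \<zero>}" using f(1) by (rule polys_finite_support)
    fix m assume "m \<in> {m. f m \<noteq> \<zero>}"
    hence "eval_monom (poly_ring V) g m \<in> carrier (poly_ring V)"
      using polys_support[OF f(1)] by (intro E.monom_closed) auto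
    thus "indexed_const (f m) \<otimes>\<^bsub>poly_ring V\<^esub> eval_monom (poly_ring V) g m \<in> Q"
      using q[OF f(2)] by (rule Q.I_r_closed[rotated])
  qed
qed

text \<open>A polynomial is its own value at the variables, so the statement on values
  applies.\<close>

lemma coeffs_mem_ideal:
  assumes Q: "ideal Q (poly_ring V)" and q: "\<And>c. c \<in> q \<Longrightarrow> indexed_const c \<in> Q"
    and f: "f \<in> polys V" "\<And>m. f m \<in> q"
  shows "f \<in> Q"
proof -
  have "peval V indexed_var f \<in> Q" by (rule peval_mem_ideal[OF Q q polys_var f])
  thus ?thesis using peval_var[OF f(1), of V] by simp
qed

section \<open>Algebraic independence and lengths of chains of primes\<close>

text \<open>Algebraic independence, modulo \<open>Q\<close>, of the images of \<open>g j\<close> (\<open>j \<in> J\<close>) over \<open>R/q\<close>.\<close>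

definition alg_indep_mod ::
    "'a set \<Rightarrow> 'c set \<Rightarrow> ('c multiset \<Rightarrow> 'a) set \<Rightarrow> 'd set \<Rightarrow> ('d \<Rightarrow> 'c multiset \<Rightarrow> 'a) \<Rightarrow> bool" where
  "alg_indep_mod q V Q J g \<longleftrightarrow> (\<forall>F\<in>polys J. peval V g F \<in> Q \<longrightarrow> (\<forall>m. F m \<in> q))"

lemma peval_cong:
  assumes "\<And>v. v \<in> J \<Longrightarrow> g v = g' v" "f \<in> polys J"
    and cl: "\<And>v. v \<in> J \<Longrightarrow> g v \<in> polys V"
  shows "peval V g f = peval V g' f"
proof -
  interpret E: poly_evaluation R "poly_ring V" indexed_const J g
    using cl by (rule poly_evaluation_into_polys)
  interpret E': poly_evaluation R "poly_ring V" indexed_const J g'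
    using cl assms(1) by (intro poly_evaluation_into_polys) auto
  show ?thesis using assms(2)
  proof (induction rule: polys_induct)
    case (const c)
    then show ?case by (simp add: E.eval_const E'.eval_const)
  next
    case (add f g)
    then show ?case by (simp add: E.eval_padd E'.eval_padd)
  next
    case (pmult f v)
    then show ?case using assms(1) by (simp add: E.eval_pmult E'.eval_pmult)
  qed
qed

text \<open>A relation among the \<open>g j\<close> and \<open>f\<close> modulo \<open>Q\<close> has its constant term (in \<open>f\<close>) in \<open>Q'\<close>,
  hence trivial; dividing by \<open>f \<notin> Q\<close> lowers the degree in \<open>f\<close>.\<close>

lemma alg_indep_mod_insert:
  assumes Q: "primeideal Q (poly_ring V)" and Q': "ideal Q' (poly_ring V)" and sub: "Q \<subseteq> Q'"
    and f: "f \<in> Q'" "f \<notin> Q" and q: "\<And>c. c \<in> q \<Longrightarrow> indexed_const c \<in> Q" "\<zero> \<in> q"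
    and g: "\<And>v. v \<in> J \<Longrightarrow> g v \<in> polys V" and j: "j \<notin> J"
    and ind: "alg_indep_mod q V Q' J g"
  shows "alg_indep_mod q V Q (insert j J) (g(j := f))"
  unfolding alg_indep_mod_def
proof (intro ballI impI)
  fix F assume F: "F \<in> polys (insert j J)" and mem: "peval V (g(j := f)) F \<in> Q"
  note Qi = primeideal.axioms(1)[OF Q]
  interpret Q: ideal Q "poly_ring V" by (rule Qi)
  interpret Q': ideal Q' "poly_ring V" by (rule Q')
  have fp: "f \<in> polys V" using f(1) poly_idealD(1)[OF Q'] by blast
  have g': "\<And>v. v \<in> insert j J \<Longrightarrow> (g(j := f)) v \<in> polys V" using g fp by auto
  interpret E: poly_evaluation R "poly_ring V" indexed_const "insert j J" "g(j := f)"
    using g' by (rule poly_evaluation_into_polys)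
  \<comment> \<open>Exceeds the degree of F in the new variable j; division by f lowers it, and d =
    0 means F = 0.\<close>
  define d where "d = Suc (Max ((\<lambda>m. count m j) ` {m. F m \<noteq> \<zero>}))"
  have "count m j < d" if "F m \<noteq> \<zero>" for m
    unfolding d_def using that polys_finite_support[OF F] by (auto simp: less_Suc_eq_le intro!: Max_ge)
  thus "\<forall>m. F m \<in> q" using F mem
  proof (induction d arbitrary: F)
    case 0
    hence "F m = \<zero>" for m by blast
    then show ?case using q(2) by simp
  next
    case (Suc d)
    let ?c = "var_coeff j 0 F" and ?s = "var_shift j F"
    have cJ: "?c \<in> polys J" using polys_mono[OF var_coeff_closed[OF Suc.prems(2)], of j J] by blast
    have c: "?c \<in> polys (insert j J)" using polys_mono[OF cJ] by blast
    have s: "?s \<in> polys (insert j J)" using Suc.prems(2) by (rule var_shift_closed)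
    have pm: "indexed_pmult ?s j \<in> polys (insert j J)" using s by (intro indexed_pset.indexed_pmult) auto
    have ec: "peval V (g(j := f)) ?c = peval V g ?c"
      using j g' cJ by (intro peval_cong[of J]) auto
    have es: "peval V (g(j := f)) ?s \<in> polys V" using E.eval_closed[OF s] by (simp add: poly_ring_simps)
    have ecc: "peval V g ?c \<in> polys V" using E.eval_closed[OF c] unfolding ec by (simp add: poly_ring_simps)
    have fs: "indexed_mult R f (peval V (g(j := f)) ?s) \<in> polys V" using polys_mult[OF fp es] .
    have "peval V (g(j := f)) F = peval V (g(j := f)) (indexed_padd ?c (indexed_pmult ?s j))"
      by (rule arg_cong[OF var_decomposition[OF Suc.prems(2)]])
    also have "\<dots> = peval V g ?c \<oplus>\<^bsub>poly_ring V\<^esub> peval V (g(j := f)) (indexed_pmult ?s j)"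
      using E.eval_padd[OF c pm] ec by simp
    also have "peval V (g(j := f)) (indexed_pmult ?s j) = indexed_mult R f (peval V (g(j := f)) ?s)"
      using E.eval_pmult[OF s, of j] by (simp add: poly_ring_simps)
    finally have eq: "peval V (g(j := f)) F = peval V g ?c \<oplus>\<^bsub>poly_ring V\<^esub> indexed_mult R f (peval V (g(j := f)) ?s)" .
    have fsQ': "indexed_mult R f (peval V (g(j := f)) ?s) \<in> Q'"
      using Q'.I_r_closed[OF f(1), of "peval V (g(j := f)) ?s"] es by (simp add: poly_ring_simps)
    have "indexed_mult R f (peval V (g(j := f)) ?s) \<oplus>\<^bsub>poly_ring V\<^esub> peval V g ?c \<in> Q'"
      using Suc.prems(3) sub unfolding eq using ecc fs Q.a_comm[of "peval V g ?c" "indexed_mult R f (peval V (g(j := f)) ?s)"]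
      by (auto simp: poly_ring_simps(1))
    hence "peval V g ?c \<in> Q'"
      by (rule Q'.add_cancel_mem[OF fsQ' _, unfolded poly_ring_simps(1), OF ecc])
    hence cq: "\<forall>m. ?c m \<in> q" using ind cJ unfolding alg_indep_mod_def by blast
    have cQ: "peval V g ?c \<in> Q"
      by (rule peval_mem_ideal[OF Qi q(1) g cJ]) (use cq in blast)+
    have "indexed_mult R f (peval V (g(j := f)) ?s) \<in> Q"
      by (rule Q.add_cancel_mem[OF cQ _, unfolded poly_ring_simps(1), OF fs])
        (use Suc.prems(3) eq in \<open>simp only:\<close>)
    hence "peval V (g(j := f)) ?s \<in> Q" using poly_primeidealD(2)[OF Q fp es] f(2) by blast
    moreover have "count m j < d" if "?s m \<noteq> \<zero>" for m
      using Suc.prems(1)[of "add_mset j m"] that by (simp add: var_shift_def)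
    ultimately have sq: "\<forall>m. ?s m \<in> q" using Suc.IH[of ?s] s by blast
    show ?case
    proof
      fix m
      show "F m \<in> q"
      proof (cases "j \<in># m")
        case True
        have "?s (m - {#j#}) \<in> q" using sq by blast
        thus ?thesis using True by (simp add: var_shift_def)
      next
        case False
        have "?c m \<in> q" using cq by blast
        thus ?thesis using False by (simp add: var_coeff_def)
      qed
    qed
  qed
qed

section \<open>Counting monomials of bounded degree\<close>

text \<open>A bound for the total degree; the zero polynomial satisfies every bound.\<close>

definition size_bounded :: "('c multiset \<Rightarrow> 'a) \<Rightarrow> nat \<Rightarrow> bool" where
  "size_bounded f d \<longleftrightarrow> (\<forall>m. f m \<noteq> \<zero> \<longrightarrow> size m \<le> d)"

lemma size_bounded_mult:
  assumes "f \<in> polys V" "g \<in> polys V" "size_bounded f d" "size_bounded g e"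
  shows "size_bounded (indexed_mult R f g) (d + e)"
  unfolding size_bounded_def
proof (intro allI impI)
  fix m assume "indexed_mult R f g m \<noteq> \<zero>"
  hence "\<exists>x\<in>{x. fst x + snd x = m}. f (fst x) \<otimes> g (snd x) \<noteq> \<zero>"
    unfolding indexed_mult_def by (metis (mono_tags, lifting) add.finprod_one_eqI)
  then obtain x where x: "fst x + snd x = m" "f (fst x) \<otimes> g (snd x) \<noteq> \<zero>" by blast
  have "f (fst x) \<noteq> \<zero>" "g (snd x) \<noteq> \<zero>"
    using x(2) polys_closed[OF assms(1)] polys_closed[OF assms(2)] by auto
  hence "size (fst x) \<le> d" "size (snd x) \<le> e" using assms(3,4) unfolding size_bounded_def by blast+
  thus "size m \<le> d + e" unfolding x(1)[symmetric] by simp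
qed

lemma size_bounded_eval_monom:
  assumes g: "\<And>v. v \<in> J \<Longrightarrow> g v \<in> polys V" "\<And>v. v \<in> J \<Longrightarrow> size_bounded (g v) d" and m: "set_mset m \<subseteq> J"
  shows "size_bounded (eval_monom (poly_ring V) g m) (size m * d)"
  using m
proof (induction m)
  case empty
  interpret P: cring "poly_ring V" by (rule poly_ring_cring)
  show ?case by (auto simp: P.eval_monom_empty poly_ring_simps size_bounded_def indexed_const_def)
next
  case (add v m)
  interpret P: cring "poly_ring V" by (rule poly_ring_cring)
  have v: "v \<in> J" and m: "set_mset m \<subseteq> J" using add by auto
  have "eval_monom (poly_ring V) g m \<in> carrier (poly_ring V)"
    using g(1) m by (intro P.eval_monom_closed) (auto simp: poly_ring_simps)
  hence "size_bounded (indexed_mult R (g v) (eval_monom (poly_ring V) g m)) (d + size m * d)"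
    using add m v g by (intro size_bounded_mult[of _ V]) (auto simp: poly_ring_simps)
  moreover have "eval_monom (poly_ring V) g (add_mset v m) = g v \<otimes>\<^bsub>poly_ring V\<^esub> eval_monom (poly_ring V) g m"
    using g(1) m v by (intro P.eval_monom_add_mset) (auto simp: poly_ring_simps)
  ultimately show ?case by (simp add: poly_ring_simps)
qed

lemma finsum_poly_ring_apply:
  assumes "finite F" "\<And>x. x \<in> F \<Longrightarrow> f x \<in> polys V"
  shows "(\<Oplus>\<^bsub>poly_ring V\<^esub>x\<in>F. f x) m = (\<Oplus>x\<in>F. f x m)"
  using assms
proof (induction F)
  case empty
  interpret P: cring "poly_ring V" by (rule poly_ring_cring)
  show ?case using P.finsum_empty by (simp add: poly_ring_simps)
next
  case (insert x F)
  interpret P: cring "poly_ring V" by (rule poly_ring_cring)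
  have "(\<Oplus>\<^bsub>poly_ring V\<^esub>x\<in>insert x F. f x) = f x \<oplus>\<^bsub>poly_ring V\<^esub> (\<Oplus>\<^bsub>poly_ring V\<^esub>x\<in>F. f x)"
    using insert by (intro P.finsum_insert) (auto simp: poly_ring_simps)
  moreover have "(\<Oplus>x\<in>insert x F. f x m) = f x m \<oplus> (\<Oplus>x\<in>F. f x m)"
    using insert polys_closed by (intro finsum_insert) auto
  ultimately show ?case using insert by (simp add: poly_ring_simps indexed_padd_def)
qed

lemma monomial_polys:
  assumes "c \<in> carrier R" "set_mset m0 \<subseteq> J"
  shows "(\<lambda>m. if m = m0 then c else \<zero>) \<in> polys J"
  using assms(2)
proof (induction m0)
  case empty
  then show ?case using polys_const[OF assms(1), of J] by (simp add: indexed_const_def)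
next
  case (add v m0)
  have "indexed_pmult (\<lambda>m. if m = m0 then c else \<zero>) v = (\<lambda>m. if m = add_mset v m0 then c else \<zero>)"
    by (auto simp: indexed_pmult_def fun_eq_iff)
  moreover have "indexed_pmult (\<lambda>m. if m = m0 then c else \<zero>) v \<in> polys J"
    using add by (intro indexed_pset.indexed_pmult) auto
  ultimately show ?case by simp
qed

lemma finite_support_polys:
  assumes "finite F" "\<And>m. m \<in> F \<Longrightarrow> set_mset m \<subseteq> J" "\<And>m. m \<in> F \<Longrightarrow> s m \<in> carrier R"
  shows "(\<lambda>m. if m \<in> F then s m else \<zero>) \<in> polys J"
  using assms
proof (induction F)
  case empty
  then show ?case using polys_zero by simp
next
  case (insert m0 F)
  have "(\<lambda>m. if m \<in> insert m0 F then s m else \<zero>) =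
      indexed_padd (\<lambda>m. if m = m0 then s m0 else \<zero>) (\<lambda>m. if m \<in> F then s m else \<zero>)"
    using insert by (auto simp: indexed_padd_def fun_eq_iff)
  moreover have "\<dots> \<in> polys J"
    using insert by (intro indexed_pset.indexed_padd monomial_polys) auto
  ultimately show ?case by simp
qed

lemma bounded_exponents:
  assumes "finite J"
  obtains E where "finite E" "card E = (N + 1) ^ card J" "\<And>m. m \<in> E \<Longrightarrow> set_mset m \<subseteq> J \<and> size m \<le> N * card J"
proof -
  let ?h = "\<lambda>e. \<Sum>j\<in>J. replicate_mset (e j) j" and ?P = "J \<rightarrow>\<^sub>E {..N}"
  have cnt: "count (?h e) j = (if j \<in> J then e j else 0)" for e j
  proof -
    have "count (?h e) j = (\<Sum>i\<in>J. if j = i then e i else 0)"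
      unfolding count_sum by (intro sum.cong) auto
    also have "\<dots> = (if j \<in> J then e j else 0)" using assms by (rule sum.delta')
    finally show ?thesis .
  qed
  have inj: "inj_on ?h ?P"
  proof (rule inj_onI)
    fix e e' assume e: "e \<in> ?P" "e' \<in> ?P" "?h e = ?h e'"
    have "e j = e' j" for j
    proof (cases "j \<in> J")
      case True
      thus ?thesis using cnt[of e j] cnt[of e' j] e(3) by simp
    next
      case False
      thus ?thesis using PiE_arb[OF e(1)] PiE_arb[OF e(2)] by metis
    qed
    thus "e = e'" by blast
  qed
  show thesis
  proof (rule that[of "?h ` ?P"])
    show "finite (?h ` ?P)" using assms by (intro finite_imageI finite_PiE) auto
    show "card (?h ` ?P) = (N + 1) ^ card J" using assms inj by (simp add: card_image card_PiE)
    fix m assume "m \<in> ?h ` ?P"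
    then obtain e where m: "m = ?h e" "e \<in> ?P" by blast
    have "j \<in> J" if "j \<in># m" for j
      using that cnt[of e j] unfolding m(1)[symmetric] by (metis not_in_iff)
    moreover have "size m = (\<Sum>j\<in>J. e j)" unfolding m(1) by (simp add: size_multiset_sum)
    moreover have "(\<Sum>j\<in>J. e j) \<le> card J * N" using m(2) by (intro sum_bounded_above[of J e N, simplified]) auto
    ultimately show "set_mset m \<subseteq> J \<and> size m \<le> N * card J" by (auto simp: mult.commute)
  qed
qed

lemma card_bounded_monomials:
  assumes "finite V"
  shows "finite {m. set_mset m \<subseteq> V \<and> size m \<le> B}" "card {m. set_mset m \<subseteq> V \<and> size m \<le> B} \<le> (B + 1) ^ card V"
proof -
  let ?h = "\<lambda>m. restrict (count m) V" and ?M = "{m. set_mset m \<subseteq> V \<and> size m \<le> B}"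
  have inj: "inj_on ?h ?M"
  proof (rule inj_onI)
    fix m m' assume m: "m \<in> ?M" "m' \<in> ?M" "?h m = ?h m'"
    have "count m v = count m' v" for v
    proof (cases "v \<in> V")
      case True
      thus ?thesis using fun_cong[OF m(3), of v] by simp
    next
      case False
      hence "v \<notin># m" "v \<notin># m'" using m by auto
      thus ?thesis by (simp add: not_in_iff)
    qed
    thus "m = m'" by (rule multiset_eqI)
  qed
  have im: "?h ` ?M \<subseteq> (V \<rightarrow>\<^sub>E {..B})"
  proof (intro subsetI, elim imageE)
    fix e m assume e: "e = ?h m" and m: "m \<in> ?M"
    have "count m v \<le> B" for v using m count_le_size[of m v] by auto
    thus "e \<in> (V \<rightarrow>\<^sub>E {..B})" unfolding e by auto
  qed
  have fin: "finite (V \<rightarrow>\<^sub>E {..B})" using assms by (intro finite_PiE) auto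
  show "finite ?M" using inj im fin by (rule inj_on_finite)
  have "card ?M \<le> card (V \<rightarrow>\<^sub>E {..B})" using inj im fin by (rule card_inj_on_le)
  thus "card ?M \<le> (B + 1) ^ card V" using assms by (simp add: card_PiE)
qed

text \<open>There are \<open>(N + 1)\<^bsup>card J\<^esup>\<close> monomials in the \<open>g j\<close> with exponents at most \<open>N\<close>, but they lie in
  the span of \<open>O(N\<^bsup>card V\<^esup>)\<close> monomials in the variables.\<close>

lemma alg_indep_mod_card_le:
  assumes Q: "ideal Q (poly_ring V)" and V: "finite V" and J: "finite J"
    and q: "primeideal q R" "\<And>c. c \<in> q \<Longrightarrow> indexed_const c \<in> Q"
    and g: "\<And>v. v \<in> J \<Longrightarrow> g v \<in> polys V" and ind: "alg_indep_mod q V Q J g"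
  shows "card J \<le> card V"
proof (rule ccontr)
  assume "\<not> card J \<le> card V"
  hence less: "Suc (card V) \<le> card J" by simp
  interpret q: primeideal q R by (rule q(1))
  interpret E: poly_evaluation R "poly_ring V" indexed_const J g
    using g by (rule poly_evaluation_into_polys)
  have "\<exists>d. \<forall>v\<in>J. size_bounded (g v) d"
  proof -
    have "finite (\<Union>v\<in>J. {m. g v m \<noteq> \<zero>})" using J g polys_finite_support by blast
    hence "finite (size ` (\<Union>v\<in>J. {m. g v m \<noteq> \<zero>}))" by simp
    then obtain d where "\<forall>k\<in>size ` (\<Union>v\<in>J. {m. g v m \<noteq> \<zero>}). k \<le> d"
      using finite_nat_set_iff_bounded_le by auto
    thus ?thesis unfolding size_bounded_def by blast
  qed
  then obtain d where d: "\<And>v. v \<in> J \<Longrightarrow> size_bounded (g v) d" by blast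
  \<comment> \<open>A monomial in the g j with exponents at most N has total degree at most N C.
    With v = card V the choice of N gives (N C + 1)^v \<le> ((C + 1)(N + 1))^v = N (N + 1)^v < (N +
    1)^(v + 1), so there are more monomials in the g j than monomials that can occur in their
    expansions.\<close>
  define C where "C = card J * d"
  define N where "N = (C + 1) ^ card V"
  obtain Ex where Ex: "finite Ex" "card Ex = (N + 1) ^ card J"
    "\<And>m. m \<in> Ex \<Longrightarrow> set_mset m \<subseteq> J \<and> size m \<le> N * card J"
    using bounded_exponents[OF J] by blast
  let ?K = "{m. set_mset m \<subseteq> V \<and> size m \<le> N * C}"
  have K: "finite ?K" "card ?K \<le> (N * C + 1) ^ card V" using card_bounded_monomials[OF V] by blast+
  have "(N * C + 1) ^ card V \<le> ((C + 1) * (N + 1)) ^ card V" by (intro power_mono) auto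
  also have "\<dots> = N * (N + 1) ^ card V" by (simp only: power_mult_distrib N_def[symmetric])
  also have "\<dots> < (N + 1) ^ Suc (card V)" by simp
  also have "\<dots> \<le> (N + 1) ^ card J" using less by (intro power_increasing) auto
  finally have card: "card ?K < card Ex" using K(2) Ex(2) by linarith
  let ?mon = "\<lambda>m. eval_monom (poly_ring V) g m"
  have mon: "?mon m \<in> polys V" if "m \<in> Ex" for m
    using E.monom_closed[of m] Ex(3)[OF that] by (simp add: poly_ring_simps)
  \<comment> \<open>The unknowns are the coefficients of a relation F, one for each monomial in the
    g j; each k in \<open>?K\<close> contributes the equation that the coefficient of k in the value
    of F lies in q.\<close>
  have "\<exists>s\<in>Ex \<rightarrow> carrier R. (\<exists>m\<in>Ex. s m \<notin> q) \<and> (\<forall>k\<in>?K. (\<Oplus>m\<in>Ex. ?mon m k \<otimes> s m) \<in> q)"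
    using polys_closed[OF mon] by (intro exists_nontrivial_solution_mod_prime[OF q(1) K(1) Ex(1) card]) auto
  then obtain s where s: "s \<in> Ex \<rightarrow> carrier R" "\<exists>m\<in>Ex. s m \<notin> q" "\<forall>k\<in>?K. (\<Oplus>m\<in>Ex. ?mon m k \<otimes> s m) \<in> q"
    by blast
  have sc: "s m \<in> carrier R" if "m \<in> Ex" for m using s(1) that by blast
  define F where "F = (\<lambda>m. if m \<in> Ex then s m else \<zero>)"
  have F: "F \<in> polys J" unfolding F_def using Ex sc by (intro finite_support_polys) auto
  have smon: "(\<lambda>k. s m \<otimes> ?mon m k) \<in> polys V" if "m \<in> Ex" for m
    using polys_scale[OF mon[OF that] sc[OF that]] .
  have "peval V g F = (\<Oplus>\<^bsub>poly_ring V\<^esub>m\<in>Ex. indexed_const (F m) \<otimes>\<^bsub>poly_ring V\<^esub> ?mon m)"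
    using Ex polys_closed[OF F] by (intro E.eval_superset) (auto simp: F_def)
  also have "\<dots> = (\<Oplus>\<^bsub>poly_ring V\<^esub>m\<in>Ex. (\<lambda>k. s m \<otimes> ?mon m k))"
    using smon sc mon by (intro E.h.S.finsum_cong') (auto simp: F_def poly_ring_simps indexed_mult_const_left polys_coeff[OF mon])
  finally have ev: "peval V g F k = (\<Oplus>m\<in>Ex. s m \<otimes> ?mon m k)" for k
    using finsum_poly_ring_apply[OF Ex(1), of "\<lambda>m k. s m \<otimes> ?mon m k" V] smon by simp
  \<comment> \<open>Outside the counted monomials the coefficient vanishes for degree reasons. Thus
    all coefficients lie in q and the value of F lies in Q, against independence.\<close>
  have "peval V g F k \<in> q" for k
  proof (cases "k \<in> ?K")
    case True
    have "peval V g F k = (\<Oplus>m\<in>Ex. ?mon m k \<otimes> s m)"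
      unfolding ev using sc polys_closed[OF mon] by (intro finsum_cong') (auto simp: m_comm)
    thus ?thesis using s(3) True by simp
  next
    case False
    have "?mon m k = \<zero>" if m: "m \<in> Ex" for m
    proof (rule ccontr)
      assume nz: "?mon m k \<noteq> \<zero>"
      have "size_bounded (?mon m) (size m * d)"
        using g d Ex(3)[OF m] by (intro size_bounded_eval_monom[of J]) auto
      hence "size k \<le> size m * d" using nz unfolding size_bounded_def by blast
      also have "\<dots> \<le> N * card J * d" using Ex(3)[OF m] by (intro mult_right_mono) auto
      finally have "size k \<le> N * C" by (simp add: C_def mult.assoc)
      moreover have "set_mset k \<subseteq> V" using polys_support[OF mon[OF m] nz] .
      ultimately show False using False by simp
    qed
    hence "peval V g F k = (\<Oplus>m\<in>Ex. \<zero>)" unfolding ev using sc by (intro finsum_cong') auto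
    thus ?thesis using q.zero_mem by simp
  qed
  moreover have "peval V g F \<in> polys V" using E.eval_closed[OF F] by (simp add: poly_ring_simps)
  ultimately have "peval V g F \<in> Q" by (intro coeffs_mem_ideal[OF Q q(2)])
  hence "\<forall>m. F m \<in> q" using ind F unfolding alg_indep_mod_def by blast
  moreover obtain m where "m \<in> Ex" "s m \<notin> q" using s(2) by blast
  ultimately show False unfolding F_def by (metis (full_types))
qed

section \<open>Chains of primes over a minimal prime\<close>

lemma const_contraction_prime:
  assumes "primeideal Q (poly_ring V)"
  shows "primeideal {c \<in> carrier R. indexed_const c \<in> Q} R"
proof -
  interpret h: ring_hom_cring R "poly_ring V" indexed_const by (rule indexed_const_hom)
  show ?thesis by (rule h.ring.primeideal_vimage[OF is_cring assms])
qed

text \<open>The variables in W are independent modulo p over R/q. Going down the chain, each proper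
  inclusion contributes one more independent element, so card W + k elements are independent modulo
  the smallest prime, and the monomial count bounds their number by card V.\<close>

lemma prime_chain_length_le:
  fixes V W :: "'c set"
  assumes inf: "infinite (UNIV :: 'c set)" and V: "finite V" and W: "W \<subseteq> V"
    and q: "primeideal q R" "\<And>q'. primeideal q' R \<Longrightarrow> q' \<subseteq> q \<Longrightarrow> q' = q"
    and p: "\<And>f m. f \<in> polys W \<Longrightarrow> f \<in> p \<Longrightarrow> f m \<in> q"
    and c: "\<And>i. i \<le> k \<Longrightarrow> primeideal (c i) (poly_ring V)" "\<And>i. i \<le> k \<Longrightarrow> c i \<subseteq> p" "\<And>i. i < k \<Longrightarrow> c i \<subset> c (Suc i)"
  shows "k + card W \<le> card V"
proof -
  interpret q: primeideal q R by (rule q(1))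
  have const: "indexed_const b \<in> c i" if "i \<le> k" "b \<in> q" for i b
  proof -
    \<comment> \<open>The contraction of c i is a prime inside the contraction of p, hence inside q;
      minimality of q forces equality.\<close>
    have "{b \<in> carrier R. indexed_const b \<in> c i} \<subseteq> q"
    proof
      fix b assume "b \<in> {b \<in> carrier R. indexed_const b \<in> c i}"
      hence "indexed_const b ({#} :: 'c multiset) \<in> q" using c(2)[OF that(1)] p[OF polys_const[of b W], of "{#}"] by auto
      thus "b \<in> q" by (simp add: indexed_const_def)
    qed
    hence "{b \<in> carrier R. indexed_const b \<in> c i} = q" by (intro q(2) const_contraction_prime[OF c(1)[OF that(1)]])
    thus ?thesis using that(2) by blast
  qed
  have fW: "finite W" using W V finite_subset by blast
  have "\<exists>J g. finite J \<and> card J = card W + l \<and> (\<forall>v\<in>J. g v \<in> polys V) \<and> alg_indep_mod q V (c (k - l)) (J :: 'c set) g"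
    if "l \<le> k" for l
    using that
  proof (induction l)
    case 0
    have "alg_indep_mod q V (c k) W indexed_var"
      unfolding alg_indep_mod_def
    proof (intro ballI impI allI)
      fix F m assume F: "F \<in> polys W" "peval V indexed_var F \<in> c k"
      hence "F \<in> p" using c(2)[of k] peval_var[OF F(1) W] by auto
      thus "F m \<in> q" by (rule p[OF F(1)])
    qed
    then show ?case using fW polys_var[OF subsetD[OF W]] by (intro exI[of _ W] exI[of _ indexed_var]) auto
  next
    case (Suc l)
    then obtain J :: "'c set" and g where J: "finite J" "card J = card W + l" "\<forall>v\<in>J. g v \<in> polys V"
      "alg_indep_mod q V (c (k - l)) J g" by auto
    define i where "i = k - Suc l"
    have i: "i < k" "k - l = Suc i" using Suc.prems by (auto simp: i_def)
    obtain f where f: "f \<in> c (Suc i)" "f \<notin> c i" using c(3)[OF i(1)] by blast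
    \<comment> \<open>The independent family takes its indices from the type of the variables; since
      that type is infinite, a fresh index exists.\<close>
    obtain j where j: "j \<notin> J" using ex_new_if_finite[OF inf J(1)] by blast
    have "alg_indep_mod q V (c i) (insert j J) (g(j := f))"
    proof (rule alg_indep_mod_insert[where Q' = "c (Suc i)"])
      show "alg_indep_mod q V (c (Suc i)) J g" using J(4) i(2) by simp
      show "ideal (c (Suc i)) (poly_ring V)" using i(1) by (intro primeideal.axioms(1) c(1)) simp
      show "c i \<subseteq> c (Suc i)" using c(3)[OF i(1)] by blast
    qed (use c i f J j const q.zero_mem primeideal.axioms(1) in auto)
    moreover have "f \<in> polys V" using f poly_idealD(1)[OF primeideal.axioms(1)[OF c(1)[of "Suc i"]]] i by auto
    ultimately show ?case
      using J j unfolding i_def by (intro exI[of _ "insert j J"] exI[of _ "g(j := f)"] conjI) (assumption | simp)+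
  qed
  from this[of k] obtain J :: "'c set" and g where J: "finite J" "card J = card W + k" "\<And>v. v \<in> J \<Longrightarrow> g v \<in> polys V"
      "alg_indep_mod q V (c 0) J g" by auto
  have "card J \<le> card V"
    using alg_indep_mod_card_le[OF _ V J(1) q(1) _ J(3,4)] const[of 0] primeideal.axioms(1)[OF c(1)[of 0]] by blast
  thus ?thesis using J(2) by simp
qed

section \<open>Numbers of generators in a localization\<close>

text \<open>The combinations of the y l form an ideal that contains each y l. Indexing by
  \<open>L\<close> rather than by the image tolerates repeated generators.\<close>

lemma genideal_indexed_combination:
  assumes L: "finite L" and y: "\<And>l. l \<in> L \<Longrightarrow> y l \<in> carrier R" and x: "x \<in> Idl (y ` L)"
  shows "\<exists>d\<in>L \<rightarrow> carrier R. x = (\<Oplus>l\<in>L. d l \<otimes> y l)"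
proof -
  let ?C = "{x. \<exists>d\<in>L \<rightarrow> carrier R. x = (\<Oplus>l\<in>L. d l \<otimes> y l)}"
  have "ideal ?C R"
  proof (rule idealI[OF ring_axioms])
    show "subgroup ?C (add_monoid R)"
    proof (rule add.subgroupI)
      show "?C \<subseteq> carrier R" using y by (auto intro!: finsum_closed)
      show "?C \<noteq> {}" by (auto intro!: exI[of _ "\<Oplus>l\<in>L. \<zero> \<otimes> y l"] bexI[of _ "\<lambda>_. \<zero>"])
    next
      fix x assume "x \<in> ?C"
      then obtain d where d: "d \<in> L \<rightarrow> carrier R" "x = (\<Oplus>l\<in>L. d l \<otimes> y l)" by blast
      have "\<ominus> x = (\<Oplus>l\<in>L. \<ominus> (d l \<otimes> y l))"
        unfolding d(2) using L d(1) y by (intro finsum_a_inv[symmetric]) auto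
      also have "\<dots> = (\<Oplus>l\<in>L. (\<ominus> d l) \<otimes> y l)"
        using d(1) y by (intro finsum_cong') (auto simp: l_minus Pi_def)
      finally show "\<ominus> x \<in> ?C" using d(1) by (intro CollectI bexI[of _ "\<lambda>l. \<ominus> d l"]) auto
      fix x' assume "x' \<in> ?C"
      then obtain d' where d': "d' \<in> L \<rightarrow> carrier R" "x' = (\<Oplus>l\<in>L. d' l \<otimes> y l)" by blast
      have "x \<oplus> x' = (\<Oplus>l\<in>L. d l \<otimes> y l \<oplus> d' l \<otimes> y l)"
        unfolding d(2) d'(2) using d(1) d'(1) y by (intro finsum_addf[symmetric]) auto
      also have "\<dots> = (\<Oplus>l\<in>L. (d l \<oplus> d' l) \<otimes> y l)"
        using d(1) d'(1) y by (intro finsum_cong') (auto simp: l_distr Pi_def)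
      finally show "x \<oplus> x' \<in> ?C" using d(1) d'(1) by (intro CollectI bexI[of _ "\<lambda>l. d l \<oplus> d' l"]) auto
    qed
    fix x r assume "x \<in> ?C" and r: "r \<in> carrier R"
    then obtain d where d: "d \<in> L \<rightarrow> carrier R" "x = (\<Oplus>l\<in>L. d l \<otimes> y l)" by blast
    have "r \<otimes> x = (\<Oplus>l\<in>L. r \<otimes> (d l \<otimes> y l))"
      unfolding d(2) using L d(1) y r by (intro finsum_rdistr) auto
    also have "\<dots> = (\<Oplus>l\<in>L. (r \<otimes> d l) \<otimes> y l)"
      using d(1) y r by (intro finsum_cong') (auto simp: m_assoc Pi_def)
    finally show rx: "r \<otimes> x \<in> ?C" using d(1) r by (intro CollectI bexI[of _ "\<lambda>l. r \<otimes> d l"]) auto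
    have "x \<in> carrier R" unfolding d(2) using d(1) y by (auto intro!: finsum_closed)
    thus "x \<otimes> r \<in> ?C" using rx r by (simp only: m_comm)
  qed
  moreover have "y ` L \<subseteq> ?C"
  proof
    fix z assume "z \<in> y ` L"
    then obtain l0 where l0: "l0 \<in> L" "z = y l0" by blast
    have "(\<Oplus>l\<in>L. (if l = l0 then \<one> else \<zero>) \<otimes> y l) = (\<Oplus>l\<in>{l0}. y l)"
      by (rule add.finprod_mono_neutral_cong_right[OF L]) (use l0 y in auto)
    also have "\<dots> = z" using l0 y by simp
    finally show "z \<in> ?C" by (intro CollectI bexI[of _ "\<lambda>l. if l = l0 then \<one> else \<zero>"]) auto
  qed
  ultimately have "Idl (y ` L) \<subseteq> ?C" by (rule genideal_minimal)
  thus ?thesis using x by blast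
qed

text \<open>Inclusion of S in the ideal of T after inverting c. One exponent serves all of S, so
  that the multiplication passes to the whole ideal generated by S.\<close>

definition power_multiplies_into :: "'a \<Rightarrow> 'a set \<Rightarrow> 'a set \<Rightarrow> bool" where
  "power_multiplies_into c S T \<longleftrightarrow> (\<exists>K::nat. \<forall>x\<in>S. c [^] K \<otimes> x \<in> Idl T)"

text \<open>The elements that c multiplies into an ideal form an ideal themselves, the colon
  ideal.\<close>

lemma multiplies_into_ideal:
  assumes T: "T \<subseteq> carrier R" and S: "S \<subseteq> carrier R" and c: "c \<in> carrier R"
    and mem: "\<And>x. x \<in> S \<Longrightarrow> c \<otimes> x \<in> Idl T" and x: "x \<in> Idl S"
  shows "c \<otimes> x \<in> Idl T"
proof -
  interpret I: ideal "Idl T" R using T by (rule genideal_ideal)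
  have "ideal {x \<in> carrier R. c \<otimes> x \<in> Idl T} R"
  proof (rule idealI[OF ring_axioms])
    show "subgroup {x \<in> carrier R. c \<otimes> x \<in> Idl T} (add_monoid R)"
    proof (rule add.subgroupI)
      show "{x \<in> carrier R. c \<otimes> x \<in> Idl T} \<noteq> {}" using I.zero_mem c by (auto intro!: exI[of _ \<zero>])
    next
      fix x assume x: "x \<in> {x \<in> carrier R. c \<otimes> x \<in> Idl T}"
      thus "\<ominus> x \<in> {x \<in> carrier R. c \<otimes> x \<in> Idl T}"
        using additive_subgroup.a_inv_closed[OF I.additive_subgroup_axioms, of "c \<otimes> x"] c by (simp add: r_minus)
      fix y assume "y \<in> {x \<in> carrier R. c \<otimes> x \<in> Idl T}"
      thus "x \<oplus> y \<in> {x \<in> carrier R. c \<otimes> x \<in> Idl T}"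
        using x I.add_mem[of "c \<otimes> x" "c \<otimes> y"] c by (simp add: r_distr)
    qed auto
    fix x r assume x: "x \<in> {x \<in> carrier R. c \<otimes> x \<in> Idl T}" and r: "r \<in> carrier R"
    have "c \<otimes> (r \<otimes> x) = r \<otimes> (c \<otimes> x)" using c r x by (simp add: m_lcomm)
    thus rx: "r \<otimes> x \<in> {x \<in> carrier R. c \<otimes> x \<in> Idl T}" using I.I_l_closed[of "c \<otimes> x" r] x r c by simp
    have "x \<otimes> r = r \<otimes> x" using x r by (simp add: m_comm)
    thus "x \<otimes> r \<in> {x \<in> carrier R. c \<otimes> x \<in> Idl T}" using rx by simp
  qed
  hence "Idl S \<subseteq> {x \<in> carrier R. c \<otimes> x \<in> Idl T}"
    using S mem by (intro genideal_minimal) auto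
  thus ?thesis using x by blast
qed

text \<open>K powers of c lead from S into the ideal of T, and L powers of d from there into that of
  U; the surplus powers in the exponent K + L are absorbed by the ideal.\<close>

lemma power_multiplies_into_trans:
  assumes S: "S \<subseteq> carrier R" "T \<subseteq> carrier R" "U \<subseteq> carrier R" and c: "c \<in> carrier R" "d \<in> carrier R"
    and 1: "power_multiplies_into c S T" and 2: "power_multiplies_into d T U"
  shows "power_multiplies_into (c \<otimes> d) S U"
proof -
  obtain K where K: "\<And>x. x \<in> S \<Longrightarrow> c [^] (K::nat) \<otimes> x \<in> Idl T" using 1 unfolding power_multiplies_into_def by blast
  obtain L where L: "\<And>x. x \<in> T \<Longrightarrow> d [^] (L::nat) \<otimes> x \<in> Idl U" using 2 unfolding power_multiplies_into_def by blast
  interpret U: ideal "Idl U" R using S(3) by (rule genideal_ideal)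
  show ?thesis
    unfolding power_multiplies_into_def
  proof (intro exI[of _ "K + L"] ballI)
    fix x assume x: "x \<in> S"
    have xc: "x \<in> carrier R" using x S by blast
    have "d [^] L \<otimes> (c [^] K \<otimes> x) \<in> Idl U"
      by (rule multiplies_into_ideal[OF S(3,2) _ L K[OF x]]) (use c in simp)
    hence "c [^] L \<otimes> d [^] K \<otimes> (d [^] L \<otimes> (c [^] K \<otimes> x)) \<in> Idl U"
      by (rule U.I_l_closed) (use c in simp)
    moreover have "c [^] L \<otimes> d [^] K \<otimes> (d [^] L \<otimes> (c [^] K \<otimes> x)) = (c \<otimes> d) [^] (K + L) \<otimes> x"
      using c xc by (simp add: nat_pow_distrib nat_pow_mult[symmetric] m_ac)
    ultimately show "(c \<otimes> d) [^] (K + L) \<otimes> x \<in> Idl U" by simp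
  qed
qed

end

context primeideal begin

lemma pow_notin_prime: "c \<in> carrier R \<Longrightarrow> c \<notin> I \<Longrightarrow> c [^] (k::nat) \<in> loc_denominators"
  by (induction k) (use one_denominator mult_denominator in auto)

lemma extended_prime_self: "primeideal (extended_prime I) loc"
  using primeideal_axioms by (intro extended_prime) auto

text \<open>If fewer elements than \<open>L\<close> generated the ideal, linear algebra modulo the maximal ideal would
  produce a relation between the \<open>y l\<close> with a coefficient outside the maximal ideal.\<close>

lemma min_gens_loc_ge:
  fixes L :: "'l set"
  assumes L: "finite L" and y: "\<And>l. l \<in> L \<Longrightarrow> y l \<in> carrier R"
    and indep: "\<And>b l. b \<in> L \<rightarrow> carrier R \<Longrightarrow> (\<Oplus>l\<in>L. b l \<otimes> y l) = \<zero> \<Longrightarrow> l \<in> L \<Longrightarrow> b l \<in> I"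
  shows "enat (card L) \<le> min_gens loc (Idl\<^bsub>loc\<^esub> (emb ` y ` L))"
  unfolding min_gens_def
proof (rule Inf_greatest, clarify)
  fix G assume G: "G \<subseteq> carrier loc" "finite G" and gen: "Idl\<^bsub>loc\<^esub> G = Idl\<^bsub>loc\<^esub> (emb ` y ` L)"
  interpret A: cring loc by (rule loc_cring)
  interpret h: ring_hom_cring R loc emb by (rule emb_hom)
  interpret M: primeideal "extended_prime I" loc by (rule extended_prime_self)
  note memM = frac_mem_extended_prime_iff[OF primeideal_axioms order_refl]
  let ?y = "\<lambda>l. emb (y l)"
  have yc: "?y l \<in> carrier loc" if "l \<in> L" for l using y[OF that] by (rule emb_closed)
  have "card L \<le> card G"
  proof (rule ccontr)
    assume "\<not> card L \<le> card G"
    hence less: "card G < card L" by simp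
    have "\<exists>d\<in>G \<rightarrow> carrier loc. ?y l = (\<Oplus>\<^bsub>loc\<^esub>g\<in>G. d g \<otimes>\<^bsub>loc\<^esub> g)" if l: "l \<in> L" for l
    proof -
      have "emb ` y ` L \<subseteq> carrier loc" using yc by auto
      hence "emb ` y ` L \<subseteq> Idl\<^bsub>loc\<^esub> (emb ` y ` L)" by (rule A.genideal_self)
      hence "?y l \<in> Idl\<^bsub>loc\<^esub> ((\<lambda>g. g) ` G)" using l gen by auto
      thus ?thesis using G by (intro A.genideal_indexed_combination) auto
    qed
    hence "\<forall>l\<in>L. \<exists>d. d \<in> G \<rightarrow> carrier loc \<and> ?y l = (\<Oplus>\<^bsub>loc\<^esub>g\<in>G. d g \<otimes>\<^bsub>loc\<^esub> g)"
      unfolding Bex_def by simp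
    from bchoice[OF this] obtain C where
      C': "\<forall>l\<in>L. C l \<in> G \<rightarrow> carrier loc \<and> ?y l = (\<Oplus>\<^bsub>loc\<^esub>g\<in>G. C l g \<otimes>\<^bsub>loc\<^esub> g)" ..
    have C: "C l \<in> G \<rightarrow> carrier loc" "?y l = (\<Oplus>\<^bsub>loc\<^esub>g\<in>G. C l g \<otimes>\<^bsub>loc\<^esub> g)" if "l \<in> L" for l
      using bspec[OF C' that] by simp_all
    have Cc: "C l g \<in> carrier loc" if "l \<in> L" "g \<in> G" for l g using C(1)[OF that(1)] that(2) by auto
    have Gc: "g \<in> carrier loc" if "g \<in> G" for g using G(1) that by blast
    have "\<exists>d\<in>L \<rightarrow> carrier loc. g = (\<Oplus>\<^bsub>loc\<^esub>l\<in>L. d l \<otimes>\<^bsub>loc\<^esub> ?y l)" if g: "g \<in> G" for g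
    proof -
      have "g \<in> Idl\<^bsub>loc\<^esub> (emb ` y ` L)" using A.genideal_self[OF G(1)] g gen by auto
      hence "g \<in> Idl\<^bsub>loc\<^esub> (?y ` L)" by (simp add: image_image)
      thus ?thesis using L yc by (intro A.genideal_indexed_combination) auto
    qed
    hence "\<forall>g\<in>G. \<exists>d. d \<in> L \<rightarrow> carrier loc \<and> g = (\<Oplus>\<^bsub>loc\<^esub>l\<in>L. d l \<otimes>\<^bsub>loc\<^esub> ?y l)"
      unfolding Bex_def by simp
    from bchoice[OF this] obtain D where
      D': "\<forall>g\<in>G. D g \<in> L \<rightarrow> carrier loc \<and> g = (\<Oplus>\<^bsub>loc\<^esub>l\<in>L. D g l \<otimes>\<^bsub>loc\<^esub> ?y l)" ..
    have D: "D g \<in> L \<rightarrow> carrier loc" "g = (\<Oplus>\<^bsub>loc\<^esub>l\<in>L. D g l \<otimes>\<^bsub>loc\<^esub> ?y l)" if "g \<in> G" for g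
      using bspec[OF D' that] by (rule conjunct1, rule conjunct2)
    have Dc: "D g l \<in> carrier loc" if "l \<in> L" "g \<in> G" for l g using D(1)[OF that(2)] that(1) by auto
    \<comment> \<open>In matrix form y = C g and g = D y. As G is smaller than L, some row vector v
      with an entry outside the maximal ideal satisfies v C = 0 modulo that ideal.\<close>
    have "\<exists>v\<in>L \<rightarrow> carrier loc. (\<exists>l\<in>L. v l \<notin> extended_prime I) \<and>
        (\<forall>g\<in>G. (\<Oplus>\<^bsub>loc\<^esub>l\<in>L. C l g \<otimes>\<^bsub>loc\<^esub> v l) \<in> extended_prime I)"
      using Cc by (intro A.exists_nontrivial_solution_mod_prime extended_prime_self G(2) L less) auto
    then obtain v l0 where v: "v \<in> L \<rightarrow> carrier loc" and l0: "l0 \<in> L" "v l0 \<notin> extended_prime I"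
      and vM: "\<And>g. g \<in> G \<Longrightarrow> (\<Oplus>\<^bsub>loc\<^esub>l\<in>L. C l g \<otimes>\<^bsub>loc\<^esub> v l) \<in> extended_prime I" by blast
    have vc: "v l \<in> carrier loc" if "l \<in> L" for l using v that by auto
    define w where "w g = (\<Oplus>\<^bsub>loc\<^esub>l\<in>L. C l g \<otimes>\<^bsub>loc\<^esub> v l)" for g
    have wc: "w g \<in> carrier loc" if "g \<in> G" for g
      unfolding w_def using Cc vc that by (intro A.finsum_closed) auto
    \<comment> \<open>z = (v C) D has all entries in the maximal ideal, and v y = (v C) g = z
      y.\<close>
    define z where "z l = (\<Oplus>\<^bsub>loc\<^esub>g\<in>G. w g \<otimes>\<^bsub>loc\<^esub> D g l)" for l
    have zM: "z l \<in> extended_prime I" if "l \<in> L" for l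
      unfolding z_def
    proof (rule A.finsum_ideal_closed[OF M.is_ideal G(2)])
      fix g assume g: "g \<in> G"
      show "w g \<otimes>\<^bsub>loc\<^esub> D g l \<in> extended_prime I"
        using vM[OF g] Dc[OF that g] unfolding w_def by (rule M.I_r_closed)
    qed
    have zc: "z l \<in> carrier loc" if "l \<in> L" for l using zM[OF that] M.a_subset by blast
    have "(\<Oplus>\<^bsub>loc\<^esub>l\<in>L. v l \<otimes>\<^bsub>loc\<^esub> ?y l) = (\<Oplus>\<^bsub>loc\<^esub>l\<in>L. \<Oplus>\<^bsub>loc\<^esub>g\<in>G. v l \<otimes>\<^bsub>loc\<^esub> (C l g \<otimes>\<^bsub>loc\<^esub> g))"
    proof (rule A.finsum_cong'[OF refl])
      fix l assume l: "l \<in> L"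
      show "v l \<otimes>\<^bsub>loc\<^esub> ?y l = (\<Oplus>\<^bsub>loc\<^esub>g\<in>G. v l \<otimes>\<^bsub>loc\<^esub> (C l g \<otimes>\<^bsub>loc\<^esub> g))"
        unfolding C(2)[OF l] using G(2) Cc[OF l] Gc vc[OF l] by (intro A.finsum_rdistr) auto
    qed (use Cc Gc vc in \<open>auto intro!: A.finsum_closed\<close>)
    also have "\<dots> = (\<Oplus>\<^bsub>loc\<^esub>g\<in>G. \<Oplus>\<^bsub>loc\<^esub>l\<in>L. v l \<otimes>\<^bsub>loc\<^esub> (C l g \<otimes>\<^bsub>loc\<^esub> g))"
      using Cc Gc vc by (intro A.finsum_swap[OF L G(2)]) auto
    also have "\<dots> = (\<Oplus>\<^bsub>loc\<^esub>g\<in>G. w g \<otimes>\<^bsub>loc\<^esub> g)"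
    proof (rule A.finsum_cong'[OF refl])
      fix g assume g: "g \<in> G"
      have "(\<Oplus>\<^bsub>loc\<^esub>l\<in>L. v l \<otimes>\<^bsub>loc\<^esub> (C l g \<otimes>\<^bsub>loc\<^esub> g)) = (\<Oplus>\<^bsub>loc\<^esub>l\<in>L. (C l g \<otimes>\<^bsub>loc\<^esub> v l) \<otimes>\<^bsub>loc\<^esub> g)"
        using Cc Gc vc g by (intro A.finsum_cong') (auto simp: A.m_ac)
      also have "\<dots> = w g \<otimes>\<^bsub>loc\<^esub> g"
        unfolding w_def using L Cc Gc vc g by (intro A.finsum_ldistr[symmetric]) auto
      finally show "(\<Oplus>\<^bsub>loc\<^esub>l\<in>L. v l \<otimes>\<^bsub>loc\<^esub> (C l g \<otimes>\<^bsub>loc\<^esub> g)) = w g \<otimes>\<^bsub>loc\<^esub> g" .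
    qed (use wc Gc in auto)
    also have "\<dots> = (\<Oplus>\<^bsub>loc\<^esub>g\<in>G. \<Oplus>\<^bsub>loc\<^esub>l\<in>L. w g \<otimes>\<^bsub>loc\<^esub> (D g l \<otimes>\<^bsub>loc\<^esub> ?y l))"
    proof (rule A.finsum_cong'[OF refl])
      fix g assume g: "g \<in> G"
      have "w g \<otimes>\<^bsub>loc\<^esub> (\<Oplus>\<^bsub>loc\<^esub>l\<in>L. D g l \<otimes>\<^bsub>loc\<^esub> ?y l) = (\<Oplus>\<^bsub>loc\<^esub>l\<in>L. w g \<otimes>\<^bsub>loc\<^esub> (D g l \<otimes>\<^bsub>loc\<^esub> ?y l))"
        using L Dc[OF _ g] yc wc[OF g] by (intro A.finsum_rdistr) auto
      thus "w g \<otimes>\<^bsub>loc\<^esub> g = (\<Oplus>\<^bsub>loc\<^esub>l\<in>L. w g \<otimes>\<^bsub>loc\<^esub> (D g l \<otimes>\<^bsub>loc\<^esub> ?y l))"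
        using D(2)[OF g] by simp
    qed (use Dc yc wc in \<open>auto intro!: A.finsum_closed\<close>)
    also have "\<dots> = (\<Oplus>\<^bsub>loc\<^esub>l\<in>L. \<Oplus>\<^bsub>loc\<^esub>g\<in>G. w g \<otimes>\<^bsub>loc\<^esub> (D g l \<otimes>\<^bsub>loc\<^esub> ?y l))"
      using Dc yc wc by (intro A.finsum_swap[OF G(2) L]) auto
    also have "\<dots> = (\<Oplus>\<^bsub>loc\<^esub>l\<in>L. z l \<otimes>\<^bsub>loc\<^esub> ?y l)"
    proof (rule A.finsum_cong'[OF refl])
      fix l assume l: "l \<in> L"
      have "(\<Oplus>\<^bsub>loc\<^esub>g\<in>G. w g \<otimes>\<^bsub>loc\<^esub> (D g l \<otimes>\<^bsub>loc\<^esub> ?y l)) = (\<Oplus>\<^bsub>loc\<^esub>g\<in>G. (w g \<otimes>\<^bsub>loc\<^esub> D g l) \<otimes>\<^bsub>loc\<^esub> ?y l)"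
        using Dc[OF l] yc[OF l] wc by (intro A.finsum_cong') (auto simp: A.m_assoc)
      also have "\<dots> = z l \<otimes>\<^bsub>loc\<^esub> ?y l"
        unfolding z_def using G(2) Dc[OF l] yc[OF l] wc by (intro A.finsum_ldistr[symmetric]) auto
      finally show "(\<Oplus>\<^bsub>loc\<^esub>g\<in>G. w g \<otimes>\<^bsub>loc\<^esub> (D g l \<otimes>\<^bsub>loc\<^esub> ?y l)) = z l \<otimes>\<^bsub>loc\<^esub> ?y l" .
    qed (use zc yc in auto)
    finally have vz: "(\<Oplus>\<^bsub>loc\<^esub>l\<in>L. v l \<otimes>\<^bsub>loc\<^esub> ?y l) = (\<Oplus>\<^bsub>loc\<^esub>l\<in>L. z l \<otimes>\<^bsub>loc\<^esub> ?y l)" .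
    \<comment> \<open>e = v - z annihilates y, and its entry at \<open>l0\<close> stays outside the
      maximal ideal.\<close>
    define e where "e l = v l \<oplus>\<^bsub>loc\<^esub> \<ominus>\<^bsub>loc\<^esub> z l" for l
    have ec: "e l \<in> carrier loc" if "l \<in> L" for l unfolding e_def using vc zc that by simp
    have "(\<Oplus>\<^bsub>loc\<^esub>l\<in>L. e l \<otimes>\<^bsub>loc\<^esub> ?y l) = (\<Oplus>\<^bsub>loc\<^esub>l\<in>L. v l \<otimes>\<^bsub>loc\<^esub> ?y l \<oplus>\<^bsub>loc\<^esub> \<ominus>\<^bsub>loc\<^esub> (z l \<otimes>\<^bsub>loc\<^esub> ?y l))"
      unfolding e_def using vc zc yc by (intro A.finsum_cong') (auto simp: A.l_distr A.l_minus)
    also have "\<dots> = (\<Oplus>\<^bsub>loc\<^esub>l\<in>L. v l \<otimes>\<^bsub>loc\<^esub> ?y l) \<oplus>\<^bsub>loc\<^esub> (\<Oplus>\<^bsub>loc\<^esub>l\<in>L. \<ominus>\<^bsub>loc\<^esub> (z l \<otimes>\<^bsub>loc\<^esub> ?y l))"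
      using vc zc yc by (intro A.finsum_addf) auto
    also have "(\<Oplus>\<^bsub>loc\<^esub>l\<in>L. \<ominus>\<^bsub>loc\<^esub> (z l \<otimes>\<^bsub>loc\<^esub> ?y l)) = \<ominus>\<^bsub>loc\<^esub> (\<Oplus>\<^bsub>loc\<^esub>l\<in>L. z l \<otimes>\<^bsub>loc\<^esub> ?y l)"
      using zc yc by (intro A.finsum_a_inv[OF L]) auto
    finally have e0: "(\<Oplus>\<^bsub>loc\<^esub>l\<in>L. e l \<otimes>\<^bsub>loc\<^esub> ?y l) = \<zero>\<^bsub>loc\<^esub>"
      unfolding vz using zc yc by (simp add: A.r_neg A.finsum_closed Pi_def)
    have el0: "e l0 \<notin> extended_prime I"
    proof
      assume "e l0 \<in> extended_prime I"
      hence "e l0 \<oplus>\<^bsub>loc\<^esub> z l0 \<in> extended_prime I" using zM[OF l0(1)] by (rule M.add_mem)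
      moreover have "e l0 \<oplus>\<^bsub>loc\<^esub> z l0 = v l0"
        unfolding e_def using vc[OF l0(1)] zc[OF l0(1)] by (simp add: A.a_assoc A.l_neg)
      ultimately show False using l0(2) by simp
    qed
    \<comment> \<open>Clearing the denominators by s, and multiplying by u to undo the passage to
      the localization, turns e into a relation over R to which \<open>indep\<close>
      applies.\<close>
    obtain s a where s: "s \<in> loc_denominators" and a: "a \<in> L \<rightarrow> carrier R"
      and sa: "\<And>l. l \<in> L \<Longrightarrow> emb s \<otimes>\<^bsub>loc\<^esub> e l = emb (a l)"
      using common_denominator[OF L, of e] ec by blast
    have ac: "a l \<in> carrier R" if "l \<in> L" for l using a that by auto
    have sc: "emb s \<in> carrier loc" using s emb_closed by auto
    have "emb (\<Oplus>l\<in>L. a l \<otimes> y l) = (\<Oplus>\<^bsub>loc\<^esub>l\<in>L. emb (a l \<otimes> y l))"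
      using h.hom_finsum[of "\<lambda>l. a l \<otimes> y l" L] ac y by (simp add: comp_def Pi_def)
    also have "\<dots> = (\<Oplus>\<^bsub>loc\<^esub>l\<in>L. emb s \<otimes>\<^bsub>loc\<^esub> (e l \<otimes>\<^bsub>loc\<^esub> ?y l))"
      using ac y sc ec yc sa by (intro A.finsum_cong') (auto simp: A.m_assoc[symmetric])
    also have "\<dots> = emb s \<otimes>\<^bsub>loc\<^esub> (\<Oplus>\<^bsub>loc\<^esub>l\<in>L. e l \<otimes>\<^bsub>loc\<^esub> ?y l)"
      using L sc ec yc by (intro A.finsum_rdistr[symmetric]) auto
    finally have "emb (\<Oplus>l\<in>L. a l \<otimes> y l) = \<zero>\<^bsub>loc\<^esub>" unfolding e0 using sc by simp
    moreover have "(\<Oplus>l\<in>L. a l \<otimes> y l) \<in> carrier R" using ac y by (intro finsum_closed) auto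
    ultimately obtain u where u: "u \<in> loc_denominators" "u \<otimes> (\<Oplus>l\<in>L. a l \<otimes> y l) = \<zero>"
      using emb_eq_zero_iff by blast
    have "(\<Oplus>l\<in>L. (u \<otimes> a l) \<otimes> y l) = (\<Oplus>l\<in>L. u \<otimes> (a l \<otimes> y l))"
      using u ac y by (intro finsum_cong') (auto simp: m_assoc)
    also have "\<dots> = u \<otimes> (\<Oplus>l\<in>L. a l \<otimes> y l)" using L u ac y by (intro finsum_rdistr[symmetric]) auto
    finally have "u \<otimes> a l0 \<in> I" using indep[of "\<lambda>l. u \<otimes> a l" l0] u ac l0 by (auto simp: Pi_def)
    hence "a l0 \<in> I" using I_prime[of u "a l0"] u ac l0 by auto
    hence "emb s \<otimes>\<^bsub>loc\<^esub> e l0 \<in> extended_prime I"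
      unfolding sa[OF l0(1)] using memM[of "a l0" \<one>] ac[OF l0(1)] one_denominator by simp
    moreover have "emb s \<notin> extended_prime I" using memM[of s \<one>] s one_denominator by auto
    ultimately show False using M.I_prime[OF sc ec[OF l0(1)]] el0 by blast
  qed
  thus "enat (card L) \<le> enat (card G)" by simp
qed

lemma min_gens_loc_le:
  assumes "finite L"
  shows "(\<And>l. l \<in> L \<Longrightarrow> y l \<in> carrier R) \<Longrightarrow> min_gens loc (Idl\<^bsub>loc\<^esub> (emb ` y ` L)) \<le> enat (card L)"
proof -
  assume y: "\<And>l. l \<in> L \<Longrightarrow> y l \<in> carrier R"
  have "min_gens loc (Idl\<^bsub>loc\<^esub> (emb ` y ` L)) \<le> enat (card (emb ` y ` L))"
    unfolding min_gens_def using y assms emb_closed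
    by (intro Inf_lower CollectI exI[of _ "emb ` y ` L"]) auto
  also have "card (emb ` y ` L) \<le> card L"
    using assms card_image_le[of L y] card_image_le[of "y ` L" emb] by simp
  finally show ?thesis by simp
qed

end

context cring begin

section \<open>Independence of the minors of a matrix of linear entries\<close>

text \<open>Both \<delta> and g avoid every variable of the block \<open>A \<times> B\<close>, not
  only the own one. Hence a block variable occurs in at most one entry, and derivatives, extensions
  and substitutions can treat the entries separately.\<close>

definition linear_entries ::
    "(nat \<times> nat) set \<Rightarrow> nat set \<Rightarrow> nat set \<Rightarrow> (nat \<Rightarrow> nat \<Rightarrow> (nat \<times> nat) multiset \<Rightarrow> 'a) \<Rightarrow>
      ((nat \<times> nat) multiset \<Rightarrow> 'a) \<Rightarrow> bool" where
  "linear_entries V A B Z \<delta> \<longleftrightarrow> \<delta> \<in> polys (V - A \<times> B) \<and>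
     (\<forall>i\<in>A. \<forall>j\<in>B. \<exists>g\<in>polys (V - A \<times> B). Z i j = indexed_padd (indexed_pmult \<delta> (i, j)) g)"

lemma linear_entries_closed:
  assumes "linear_entries V A B Z \<delta>" "A \<times> B \<subseteq> V" "i \<in> A" "j \<in> B" "W \<subseteq> V" "(i, j) \<in> W" "V - A \<times> B \<subseteq> W"
  shows "Z i j \<in> polys W"
proof -
  obtain g where g: "g \<in> polys (V - A \<times> B)" "Z i j = indexed_padd (indexed_pmult \<delta> (i, j)) g"
    using assms unfolding linear_entries_def by blast
  have "\<delta> \<in> polys W" "g \<in> polys W" using assms g polys_mono[OF _ assms(7)] unfolding linear_entries_def by auto
  thus ?thesis unfolding g(2) using assms(6) by (intro indexed_pset.indexed_padd indexed_pset.indexed_pmult)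
qed

text \<open>The Leibniz rule for a factor whose derivative by its own variable is \<delta>.\<close>

lemma partial_deriv_entry_mult:
  assumes Z: "linear_entries V A B Z \<delta>" and AB: "A \<times> B \<subseteq> V" and ij: "i \<in> A" "j \<in> B" and b: "b \<in> polys V"
  shows "partial_deriv (i, j) (indexed_mult R (Z i j) b) =
    indexed_padd (indexed_mult R (Z i j) (partial_deriv (i, j) b)) (indexed_mult R \<delta> b)"
proof -
  let ?v = "(i, j)" and ?W = "V - A \<times> B"
  obtain g where g: "g \<in> polys ?W" "Z i j = indexed_padd (indexed_pmult \<delta> ?v) g"
    using Z ij unfolding linear_entries_def by blast
  have d: "\<delta> \<in> polys ?W" using Z unfolding linear_entries_def by blast
  have v: "?v \<notin> ?W" "?v \<in> V" using ij AB by auto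
  have dV: "\<delta> \<in> polys V" and gV: "g \<in> polys V" using polys_mono[OF d, of V] polys_mono[OF g(1), of V] by auto
  have Db: "partial_deriv ?v b \<in> polys V" using b by (rule partial_deriv_closed)
  have db: "indexed_mult R \<delta> b \<in> polys V" "indexed_mult R g b \<in> polys V" using dV gV b by (auto intro: polys_mult)
  have c: "carrier_coeff \<delta>" "carrier_coeff g" "carrier_coeff b" "carrier_coeff (partial_deriv ?v b)"
    "carrier_coeff (indexed_pmult \<delta> ?v)"
    using polys_coeff[OF dV] polys_coeff[OF gV] polys_coeff[OF b] polys_coeff[OF Db]
      polys_coeff[OF indexed_pset.indexed_pmult[OF dV v(2)]] by simp_all
  have 1: "indexed_mult R (Z i j) b = indexed_padd (indexed_pmult (indexed_mult R \<delta> b) ?v) (indexed_mult R g b)"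
    unfolding g(2) using c by (simp add: indexed_mult_padd_left indexed_mult_pmult_left)
  have 2: "indexed_mult R (Z i j) (partial_deriv ?v b) =
      indexed_padd (indexed_pmult (indexed_mult R \<delta> (partial_deriv ?v b)) ?v) (indexed_mult R g (partial_deriv ?v b))"
    unfolding g(2) using c by (simp add: indexed_mult_padd_left indexed_mult_pmult_left)
  have "partial_deriv ?v (indexed_mult R (Z i j) b) =
      indexed_padd (indexed_padd (indexed_pmult (indexed_mult R \<delta> (partial_deriv ?v b)) ?v) (indexed_mult R \<delta> b))
        (indexed_mult R g (partial_deriv ?v b))"
    unfolding 1
    using partial_deriv_padd[OF indexed_pset.indexed_pmult[OF db(1) v(2)] db(2), of ?v] partial_deriv_pmult[OF db(1), of ?v]
      partial_deriv_mult_free[OF b d v(1)] partial_deriv_mult_free[OF b g(1) v(1)] by simp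
  also have "\<dots> = indexed_padd (indexed_mult R (Z i j) (partial_deriv ?v b)) (indexed_mult R \<delta> b)"
  proof
    fix m
    have p: "indexed_pmult (indexed_mult R \<delta> (partial_deriv ?v b)) ?v \<in> polys V" "indexed_mult R g (partial_deriv ?v b) \<in> polys V"
      using dV gV Db v(2) by (auto intro!: indexed_pset.indexed_pmult polys_mult)
    show "indexed_padd (indexed_padd (indexed_pmult (indexed_mult R \<delta> (partial_deriv ?v b)) ?v) (indexed_mult R \<delta> b))
        (indexed_mult R g (partial_deriv ?v b)) m = indexed_padd (indexed_mult R (Z i j) (partial_deriv ?v b)) (indexed_mult R \<delta> b) m"
      unfolding 2 using polys_closed[OF p(1), of m] polys_closed[OF p(2), of m] polys_closed[OF db(1), of m]
      by (simp add: indexed_padd_def a_ac)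
  qed
  finally show ?thesis .
qed

text \<open>The products occurring in a determinant, indexed by the set of positions used. No entry
  is repeated, so each block variable meets at most one linear factor, whatever the
  characteristic.\<close>

definition entry_product :: "'c set \<Rightarrow> ('d \<Rightarrow> 'd \<Rightarrow> 'c multiset \<Rightarrow> 'a) \<Rightarrow> ('d \<times> 'd) set \<Rightarrow> 'c multiset \<Rightarrow> 'a" where
  "entry_product V Z U = (\<Otimes>\<^bsub>poly_ring V\<^esub>v\<in>U. Z (fst v) (snd v))"

lemma entry_product_insert:
  assumes "finite U" "\<And>v. v \<in> insert u U \<Longrightarrow> Z (fst v) (snd v) \<in> polys V" "u \<notin> U"
  shows "entry_product V Z (insert u U) = indexed_mult R (Z (fst u) (snd u)) (entry_product V Z U)"
proof -
  interpret P: cring "poly_ring V" by (rule poly_ring_cring)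
  have "entry_product V Z (insert u U) = Z (fst u) (snd u) \<otimes>\<^bsub>poly_ring V\<^esub> entry_product V Z U"
    unfolding entry_product_def using assms by (intro P.finprod_insert) (auto simp: poly_ring_simps)
  thus ?thesis by (simp add: poly_ring_simps)
qed

lemma entry_product_closed:
  assumes "finite U" "\<And>v. v \<in> U \<Longrightarrow> Z (fst v) (snd v) \<in> polys W" "W \<subseteq> V"
  shows "entry_product V Z U \<in> polys W"
  using assms(1,2)
proof (induction U)
  case empty
  interpret P: cring "poly_ring V" by (rule poly_ring_cring)
  show ?case unfolding entry_product_def by (simp add: poly_ring_simps polys_const)
next
  case (insert u U)
  have "Z (fst v) (snd v) \<in> polys V" if "v \<in> insert u U" for v
    using polys_mono[OF insert.prems[OF that] assms(3)] .
  hence "entry_product V Z (insert u U) = indexed_mult R (Z (fst u) (snd u)) (entry_product V Z U)"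
    using insert.hyps by (intro entry_product_insert) auto
  thus ?case using insert by (simp add: polys_mult)
qed

fun partial_derivs :: "'c list \<Rightarrow> ('c multiset \<Rightarrow> 'a) \<Rightarrow> 'c multiset \<Rightarrow> 'a" where
  "partial_derivs [] f = f"
| "partial_derivs (v # vs) f = partial_derivs vs (partial_deriv v f)"

lemma partial_derivs_closed: "f \<in> polys V \<Longrightarrow> partial_derivs vs f \<in> polys V"
  by (induction vs arbitrary: f) (auto simp: partial_deriv_closed)

lemma partial_derivs_padd:
  assumes "f \<in> polys V" "g \<in> polys V"
  shows "partial_derivs vs (indexed_padd f g) = indexed_padd (partial_derivs vs f) (partial_derivs vs g)"
  using assms
  by (induction vs arbitrary: f g) (auto simp: partial_deriv_padd partial_deriv_closed)

lemma partial_derivs_zero: "partial_derivs vs (\<lambda>_. \<zero>) = (\<lambda>_. \<zero>)"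
  by (induction vs) (auto simp: partial_deriv_def)

lemma partial_derivs_finsum:
  assumes "finite F" "\<And>x. x \<in> F \<Longrightarrow> f x \<in> polys V"
  shows "partial_derivs vs (\<Oplus>\<^bsub>poly_ring V\<^esub>x\<in>F. f x) = (\<Oplus>\<^bsub>poly_ring V\<^esub>x\<in>F. partial_derivs vs (f x))"
  using assms
proof (induction F)
  case empty
  interpret P: cring "poly_ring V" by (rule poly_ring_cring)
  show ?case using partial_derivs_zero by (simp add: poly_ring_simps(5))
next
  case (insert x F)
  interpret P: cring "poly_ring V" by (rule poly_ring_cring)
  have s: "(\<Oplus>\<^bsub>poly_ring V\<^esub>x\<in>F. f x) \<in> polys V"
    using insert P.finsum_closed[of f F] by (auto simp: poly_ring_simps(1))
  have "partial_derivs vs (\<Oplus>\<^bsub>poly_ring V\<^esub>x\<in>insert x F. f x) =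
      partial_derivs vs (indexed_padd (f x) (\<Oplus>\<^bsub>poly_ring V\<^esub>x\<in>F. f x))"
    using insert by (subst P.finsum_insert) (auto simp: poly_ring_simps(1,3))
  also have "\<dots> = indexed_padd (partial_derivs vs (f x)) (partial_derivs vs (\<Oplus>\<^bsub>poly_ring V\<^esub>x\<in>F. f x))"
    using insert s by (intro partial_derivs_padd) auto
  also have "\<dots> = partial_derivs vs (f x) \<oplus>\<^bsub>poly_ring V\<^esub> (\<Oplus>\<^bsub>poly_ring V\<^esub>x\<in>F. partial_derivs vs (f x))"
    using insert by (simp add: poly_ring_simps(3))
  also have "\<dots> = (\<Oplus>\<^bsub>poly_ring V\<^esub>x\<in>insert x F. partial_derivs vs (f x))"
    using insert by (intro P.finsum_insert[symmetric]) (auto simp: poly_ring_simps(1) partial_derivs_closed)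
  finally show ?case .
qed

text \<open>Only the entry at v involves the variable v among the factors, so the derivative either
  hits b or removes the factor at v and leaves \<delta>.\<close>

lemma partial_deriv_entry_product:
  assumes Z: "linear_entries V A B Z \<delta>" and AB: "A \<times> B \<subseteq> V" and U: "finite U" "U \<subseteq> A \<times> B"
    and v: "v \<in> A \<times> B" and b: "b \<in> polys V"
  shows "partial_deriv v (indexed_mult R (entry_product V Z U) b) =
    (if v \<in> U then indexed_padd (indexed_mult R (entry_product V Z U) (partial_deriv v b))
         (indexed_mult R (entry_product V Z (U - {v})) (indexed_mult R \<delta> b))
     else indexed_mult R (entry_product V Z U) (partial_deriv v b))"
proof -
  interpret P: cring "poly_ring V" by (rule poly_ring_cring)
  have ZV: "Z (fst u) (snd u) \<in> polys V" if "u \<in> A \<times> B" for u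
    using that AB by (intro linear_entries_closed[OF Z AB]) auto
  have Zv: "Z (fst u) (snd u) \<in> polys (V - {v})" if "u \<in> A \<times> B" "u \<noteq> v" for u
    using that AB v by (intro linear_entries_closed[OF Z AB]) auto
  have free: "partial_deriv v (indexed_mult R (entry_product V Z U') b') = indexed_mult R (entry_product V Z U') (partial_deriv v b')"
    if "finite U'" "U' \<subseteq> A \<times> B" "v \<notin> U'" "b' \<in> polys V" for U' b'
    using that Zv by (intro partial_deriv_mult_free[of _ V _ "V - {v}"] entry_product_closed) auto
  show ?thesis
  proof (cases "v \<in> U")
    case False
    thus ?thesis using free[OF U False b] by simp
  next
    case True
    let ?U = "U - {v}" and ?z = "Z (fst v) (snd v)"
    have U': "finite ?U" "?U \<subseteq> A \<times> B" "v \<notin> ?U" using U by auto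
    have e: "entry_product V Z ?U \<in> polys V" using U' ZV by (intro entry_product_closed) auto
    have z: "?z \<in> polys V" using ZV v by blast
    have Db: "partial_deriv v b \<in> polys V" using b by (rule partial_deriv_closed)
    have d: "\<delta> \<in> polys V" using Z polys_mono[of \<delta> "V - A \<times> B" V] unfolding linear_entries_def by blast
    have eb: "indexed_mult R (entry_product V Z ?U) b \<in> polys V" using polys_mult[OF e b] .
    have ZU: "Z (fst w) (snd w) \<in> polys V" if "w \<in> insert v ?U" for w using ZV[of w] U'(2) v that by blast
    have "insert v ?U = U" using True by auto
    hence eq: "entry_product V Z U = indexed_mult R ?z (entry_product V Z ?U)"
      using entry_product_insert[of ?U v Z V, OF U'(1) ZU U'(3)] by simp
    have "partial_deriv v (indexed_mult R (entry_product V Z U) b) =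
        partial_deriv v (indexed_mult R ?z (indexed_mult R (entry_product V Z ?U) b))"
      unfolding eq using indexed_mult_assoc[OF z e b] by simp
    also have "\<dots> = indexed_padd (indexed_mult R ?z (partial_deriv v (indexed_mult R (entry_product V Z ?U) b)))
        (indexed_mult R \<delta> (indexed_mult R (entry_product V Z ?U) b))"
      using partial_deriv_entry_mult[OF Z AB _ _ eb, of "fst v" "snd v"] v by auto
    also have "partial_deriv v (indexed_mult R (entry_product V Z ?U) b) = indexed_mult R (entry_product V Z ?U) (partial_deriv v b)"
      using free[OF U' b] .
    also have "indexed_mult R ?z (indexed_mult R (entry_product V Z ?U) (partial_deriv v b)) =
        indexed_mult R (entry_product V Z U) (partial_deriv v b)"
      unfolding eq using indexed_mult_assoc[OF z e Db] by simp
    also have "indexed_mult R \<delta> (indexed_mult R (entry_product V Z ?U) b) =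
        indexed_mult R (entry_product V Z ?U) (indexed_mult R \<delta> b)"
      using P.m_lcomm[of \<delta> "entry_product V Z ?U" b] d e b by (simp add: poly_ring_simps)
    finally show ?thesis using True by simp
  qed
qed

text \<open>A derivative removes at most one factor, the one at its own position, and any factor
  that remains keeps the term in p. If the positions match exactly, what survives modulo p is b
  times a power of \<delta>, which is outside p. The later claims rely on the first, and b varies in
  the induction because it collects derivatives and factors \<delta>.\<close>

lemma partial_derivs_entry_product:
  assumes Z: "linear_entries V A B Z \<delta>" and AB: "A \<times> B \<subseteq> V"
    and p: "primeideal p (poly_ring V)" and Zp: "\<forall>v\<in>A \<times> B. Z (fst v) (snd v) \<in> p" and d: "\<delta> \<notin> p"
    and vs: "set vs \<subseteq> A \<times> B" "distinct vs"
  shows "finite U \<Longrightarrow> U \<subseteq> A \<times> B \<Longrightarrow> b \<in> polys V \<Longrightarrow>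
     (length vs < card U \<longrightarrow> partial_derivs vs (indexed_mult R (entry_product V Z U) b) \<in> p) \<and>
     (length vs = card U \<and> U \<noteq> set vs \<longrightarrow> partial_derivs vs (indexed_mult R (entry_product V Z U) b) \<in> p) \<and>
     (U = set vs \<and> partial_derivs vs (indexed_mult R (entry_product V Z U) b) \<in> p \<longrightarrow> b \<in> p)"
  using vs
proof (induction vs arbitrary: U b)
  case Nil
  interpret P: cring "poly_ring V" by (rule poly_ring_cring)
  interpret p: primeideal p "poly_ring V" by (rule p)
  have ZV: "Z (fst u) (snd u) \<in> polys V" if "u \<in> A \<times> B" for u
    using that AB by (intro linear_entries_closed[OF Z AB]) auto
  have "indexed_mult R (entry_product V Z U) b \<in> p" if "0 < card U"
  proof -
    have "U \<noteq> {}" using that by auto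
    then obtain u where u: "u \<in> U" by blast
    have e: "entry_product V Z (U - {u}) \<in> polys V" using Nil ZV by (intro entry_product_closed) auto
    have "entry_product V Z (insert u (U - {u})) = indexed_mult R (Z (fst u) (snd u)) (entry_product V Z (U - {u}))"
      using Nil ZV u by (intro entry_product_insert) auto
    moreover have "insert u (U - {u}) = U" using u by auto
    ultimately have "entry_product V Z U = Z (fst u) (snd u) \<otimes>\<^bsub>poly_ring V\<^esub> entry_product V Z (U - {u})"
      by (simp add: poly_ring_simps)
    hence "entry_product V Z U \<in> p" using p.I_r_closed[of "Z (fst u) (snd u)"] Zp u Nil.prems(2) e by (auto simp: poly_ring_simps)
    thus ?thesis using p.I_r_closed[of "entry_product V Z U" b] Nil.prems(3) by (simp add: poly_ring_simps)
  qed
  moreover have "b \<in> p" if "U = {}" "indexed_mult R (entry_product V Z U) b \<in> p"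
  proof -
    have "entry_product V Z {} = \<one>\<^bsub>poly_ring V\<^esub>" unfolding entry_product_def by simp
    thus ?thesis using that P.l_one[of b] Nil.prems(3) by (simp add: poly_ring_simps)
  qed
  ultimately show ?case using Nil.prems(1) by auto
next
  case (Cons v vs)
  interpret P: cring "poly_ring V" by (rule poly_ring_cring)
  interpret p: primeideal p "poly_ring V" by (rule p)
  have ZV: "Z (fst u) (snd u) \<in> polys V" if "u \<in> A \<times> B" for u
    using that AB by (intro linear_entries_closed[OF Z AB]) auto
  have v: "v \<in> A \<times> B" "v \<notin> set vs" and vs: "set vs \<subseteq> A \<times> B" "distinct vs" using Cons.prems by auto
  note b = Cons.prems(3)
  have Db: "partial_deriv v b \<in> polys V" using b by (rule partial_deriv_closed)
  have dV: "\<delta> \<in> polys V" using Z polys_mono[of \<delta> "V - A \<times> B" V] unfolding linear_entries_def by blast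
  have db: "indexed_mult R \<delta> b \<in> polys V" using polys_mult[OF dV b] .
  note IH1 = Cons.IH[OF Cons.prems(1,2) Db vs]
  note deriv = partial_deriv_entry_product[OF Z AB Cons.prems(1,2) v(1) b]
  have eU: "entry_product V Z U \<in> polys V" using Cons.prems ZV by (intro entry_product_closed) auto
  have c1: "indexed_mult R (entry_product V Z U) (partial_deriv v b) \<in> polys V" using polys_mult[OF eU Db] .
  show ?case
  proof (cases "v \<in> U")
    case False
    thus ?thesis using IH1 deriv by auto
  next
    case True
    let ?U = "U - {v}"
    have U': "finite ?U" "?U \<subseteq> A \<times> B" using Cons.prems by auto
    have cU: "card U = Suc (card ?U)" using True Cons.prems(1) by (metis card_Suc_Diff1)
    note IH2 = Cons.IH[OF U' db vs]
    have e': "entry_product V Z ?U \<in> polys V" using U' ZV by (intro entry_product_closed) auto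
    have c2: "indexed_mult R (entry_product V Z ?U) (indexed_mult R \<delta> b) \<in> polys V" using polys_mult[OF e' db] .
    have eq: "partial_derivs (v # vs) (indexed_mult R (entry_product V Z U) b) =
        partial_derivs vs (indexed_mult R (entry_product V Z U) (partial_deriv v b)) \<oplus>\<^bsub>poly_ring V\<^esub>
        partial_derivs vs (indexed_mult R (entry_product V Z ?U) (indexed_mult R \<delta> b))" (is "_ = ?x \<oplus>\<^bsub>_\<^esub> ?y")
      using deriv True partial_derivs_padd[OF c1 c2] by (simp add: poly_ring_simps(3))
    have yc: "?y \<in> carrier (poly_ring V)" using partial_derivs_closed[OF c2] by (simp add: poly_ring_simps(1))
    have set_eq: "U = set (v # vs) \<longleftrightarrow> ?U = set vs" using True v by auto
    \<comment> \<open>\<open>?x\<close> still has all of its \<open>card U\<close> factors, but only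
      \<open>length vs\<close> derivatives are left.\<close>
    have x: "?x \<in> p" if "length (v # vs) \<le> card U" using IH1 that by auto
    show ?thesis
    proof (intro conjI impI)
      assume "length (v # vs) < card U"
      hence "?x \<in> p" "?y \<in> p" using IH1 IH2 cU by auto
      thus "partial_derivs (v # vs) (indexed_mult R (entry_product V Z U) b) \<in> p" unfolding eq by (rule p.add_mem)
    next
      assume "length (v # vs) = card U \<and> U \<noteq> set (v # vs)"
      hence "?x \<in> p" "?y \<in> p" using IH1 IH2 cU set_eq by auto
      thus "partial_derivs (v # vs) (indexed_mult R (entry_product V Z U) b) \<in> p" unfolding eq by (rule p.add_mem)
    next
      assume a: "U = set (v # vs) \<and> partial_derivs (v # vs) (indexed_mult R (entry_product V Z U) b) \<in> p"
      have "card U = length (v # vs)" using a Cons.prems(5) distinct_card by metis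
      hence "?x \<in> p" using x by simp
      hence "?y \<in> p" using a unfolding eq by (intro p.add_cancel_mem[OF _ yc, of ?x]) auto
      hence "indexed_mult R \<delta> b \<in> p" using IH2 a set_eq by blast
      thus "b \<in> p" using p.I_prime[of \<delta> b] dV b d by (simp add: poly_ring_simps)
    qed
  qed
qed

text \<open>A relation between the minors of \<open>Z\<close> is differentiated once with respect to each of the
  diagonal variables of one minor: modulo \<open>p\<close> only the diagonal term of that minor survives.\<close>

lemma subset_minors_independent:
  assumes Z: "linear_entries V A B Z \<delta>" and AB: "A \<times> B \<subseteq> V" and fin: "finite A" "finite B"
    and p: "primeideal p (poly_ring V)" and Zp: "\<And>i j. i \<in> A \<Longrightarrow> j \<in> B \<Longrightarrow> Z i j \<in> p" and d: "\<delta> \<notin> p"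
    and b: "b \<in> subset_pairs A B e \<rightarrow> polys V"
    and rel: "(\<Oplus>\<^bsub>poly_ring V\<^esub>l\<in>subset_pairs A B e. b l \<otimes>\<^bsub>poly_ring V\<^esub> cring.subset_minor (poly_ring V) Z e l) = \<zero>\<^bsub>poly_ring V\<^esub>"
    and l0: "l0 \<in> subset_pairs A B e"
  shows "b l0 \<in> p"
proof -
  interpret P: cring "poly_ring V" by (rule poly_ring_cring)
  interpret p: primeideal p "poly_ring V" by (rule p)
  let ?L = "subset_pairs A B e" and ?S = "{\<pi>. \<pi> permutes {..<e}}"
  let ?u = "\<lambda>(l :: nat set \<times> nat set) i. sorted_list_of_set (fst l) ! i"
    and ?v = "\<lambda>(l :: nat set \<times> nat set) i. sorted_list_of_set (snd l) ! i"
  have uA: "?u l i \<in> A" "?v l i \<in> B" if "l \<in> ?L" "i < e" for l i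
    using that fin nth_sorted_list_of_subset[of A "fst l" e i] nth_sorted_list_of_subset[of B "snd l" e i]
    by (auto simp: subset_pairs_def)
  have ran: "?u l ` {..<e} = fst l" "?v l ` {..<e} = snd l" if "l \<in> ?L" for l
  proof -
    have f: "finite (fst l)" "finite (snd l)" "card (fst l) = e" "card (snd l) = e"
      using that fin finite_subset by (auto simp: subset_pairs_def)
    show "?u l ` {..<e} = fst l"
      using f(1,3) set_conv_nth[of "sorted_list_of_set (fst l)"] by (auto simp: image_def)
    show "?v l ` {..<e} = snd l"
      using f(2,4) set_conv_nth[of "sorted_list_of_set (snd l)"] by (auto simp: image_def)
  qed
  have uinj: "i = j" if "l \<in> ?L" "i < e" "j < e" "?u l i = ?u l j" for l i j
    using that fin finite_subset nth_eq_iff_index_eq[of "sorted_list_of_set (fst l)" i j] by (auto simp: subset_pairs_def)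
  have vinj: "i = j" if "l \<in> ?L" "i < e" "j < e" "?v l i = ?v l j" for l i j
    using that fin finite_subset nth_eq_iff_index_eq[of "sorted_list_of_set (snd l)" i j] by (auto simp: subset_pairs_def)
  have ZV: "Z i j \<in> polys V" if "i \<in> A" "j \<in> B" for i j
    using that AB by (intro linear_entries_closed[OF Z AB]) auto
  have bc: "b l \<in> polys V" if "l \<in> ?L" for l using b that by auto
  \<comment> \<open>The positions used by the term that the permutation \<open>snd x\<close>
    contributes to the minor \<open>fst x\<close>.\<close>
  define U where "U x = (\<lambda>i. (?u (fst x) i, ?v (fst x) (snd x i))) ` {..<e}"
    for x :: "(nat set \<times> nat set) \<times> (nat \<Rightarrow> nat)"
  have lt: "\<pi> i < e" if "\<pi> \<in> ?S" "i < e" for \<pi> i using permutes_lessThan[of \<pi> e] that by auto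
  have UAB: "U x \<subseteq> A \<times> B" "finite (U x)" "card (U x) = e" if "x \<in> ?L \<times> ?S" for x
  proof -
    show "U x \<subseteq> A \<times> B" using that uA lt unfolding U_def by auto
    show "finite (U x)" unfolding U_def by simp
    have "inj_on (\<lambda>i. (?u (fst x) i, ?v (fst x) (snd x i))) {..<e}"
      using that uinj[of "fst x"] unfolding inj_on_def by auto
    thus "card (U x) = e" unfolding U_def by (simp add: card_image)
  qed
  define c where "c x = (if evenperm (snd x) then b (fst x) else \<ominus>\<^bsub>poly_ring V\<^esub> b (fst x))" for x :: "(nat set \<times> nat set) \<times> (nat \<Rightarrow> nat)"
  have cc: "c x \<in> polys V" if "x \<in> ?L \<times> ?S" for x
    using that bc P.a_inv_closed unfolding c_def by (auto simp: poly_ring_simps(1))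
  have summand: "b l \<otimes>\<^bsub>poly_ring V\<^esub> P.signed_term e (\<lambda>i j. Z (?u l i) (?v l j)) \<pi> =
      indexed_mult R (entry_product V Z (U (l, \<pi>))) (c (l, \<pi>))" if l: "l \<in> ?L" and \<pi>: "\<pi> \<in> ?S" for l \<pi>
  proof -
    have "entry_product V Z (U (l, \<pi>)) = (\<Otimes>\<^bsub>poly_ring V\<^esub>i\<in>{..<e}. Z (?u l i) (?v l (\<pi> i)))"
      unfolding entry_product_def U_def
      using uA[OF l] lt[OF \<pi>] ZV uinj[OF l]
      by (subst P.finprod_reindex) (auto simp: inj_on_def poly_ring_simps(1))
    moreover have pc: "(\<Otimes>\<^bsub>poly_ring V\<^esub>i\<in>{..<e}. Z (?u l i) (?v l (\<pi> i))) \<in> carrier (poly_ring V)" (is "?p \<in> _")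
      using uA[OF l] lt[OF \<pi>] ZV by (intro P.finprod_closed) (auto simp: poly_ring_simps(1))
    moreover have bl: "b l \<in> carrier (poly_ring V)" using bc[OF l] by (simp add: poly_ring_simps(1))
    have "b l \<otimes>\<^bsub>poly_ring V\<^esub> P.signed_term e (\<lambda>i j. Z (?u l i) (?v l j)) \<pi> = ?p \<otimes>\<^bsub>poly_ring V\<^esub> c (l, \<pi>)"
      unfolding P.signed_term_def c_def using P.m_comm[OF bl pc] P.r_minus[OF bl pc] P.r_minus[OF pc bl] by simp
    ultimately show ?thesis by (simp add: poly_ring_simps(2))
  qed
  have stc: "P.signed_term e (\<lambda>i j. Z (?u l i) (?v l j)) \<pi> \<in> carrier (poly_ring V)" if "l \<in> ?L" "\<pi> \<in> ?S" for l \<pi>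
    using that uA[OF that(1)] ZV by (intro P.signed_term_closed) (auto simp: poly_ring_simps(1))
  let ?T = "\<lambda>x. indexed_mult R (entry_product V Z (U x)) (c x)"
  have Tc: "?T x \<in> polys V" if "x \<in> ?L \<times> ?S" for x
    using that UAB[OF that] ZV cc[OF that] by (intro polys_mult entry_product_closed) auto
  have finL: "finite ?L" "finite ?S" "finite (?L \<times> ?S)"
    using finite_subset_pairs[OF fin] by (auto simp: finite_permutations)
  have "(\<Oplus>\<^bsub>poly_ring V\<^esub>x\<in>?L \<times> ?S. ?T x) = (\<Oplus>\<^bsub>poly_ring V\<^esub>l\<in>?L. \<Oplus>\<^bsub>poly_ring V\<^esub>\<pi>\<in>?S. ?T (l, \<pi>))"
    using Tc finL by (intro P.finsum_product) (auto simp: poly_ring_simps(1))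
  also have "\<dots> = (\<Oplus>\<^bsub>poly_ring V\<^esub>l\<in>?L. b l \<otimes>\<^bsub>poly_ring V\<^esub> P.subset_minor Z e l)"
  proof (rule P.finsum_cong'[OF refl])
    have "P.subset_minor Z e l \<in> carrier (poly_ring V)" if "l \<in> ?L" for l
      unfolding P.subset_minor_def using uA[OF that] ZV by (intro P.det_ring_closed) (auto simp: poly_ring_simps(1))
    thus "(\<lambda>l. b l \<otimes>\<^bsub>poly_ring V\<^esub> P.subset_minor Z e l) \<in> ?L \<rightarrow> carrier (poly_ring V)"
      using bc by (intro Pi_I P.m_closed) (simp_all add: poly_ring_simps(1))
    fix l assume l: "l \<in> ?L"
    have "(\<Oplus>\<^bsub>poly_ring V\<^esub>\<pi>\<in>?S. ?T (l, \<pi>)) =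
        (\<Oplus>\<^bsub>poly_ring V\<^esub>\<pi>\<in>?S. b l \<otimes>\<^bsub>poly_ring V\<^esub> P.signed_term e (\<lambda>i j. Z (?u l i) (?v l j)) \<pi>)"
      using summand[OF l] Tc l by (intro P.finsum_cong') (auto simp: poly_ring_simps(1))
    also have "\<dots> = b l \<otimes>\<^bsub>poly_ring V\<^esub> P.subset_minor Z e l"
      unfolding P.subset_minor_def P.det_ring_signed_term
      using stc[OF l] bc[OF l] finL by (intro P.finsum_rdistr[symmetric]) (auto simp: poly_ring_simps(1))
    finally show "(\<Oplus>\<^bsub>poly_ring V\<^esub>\<pi>\<in>?S. ?T (l, \<pi>)) = b l \<otimes>\<^bsub>poly_ring V\<^esub> P.subset_minor Z e l" .
  qed
  finally have sum0: "(\<Oplus>\<^bsub>poly_ring V\<^esub>x\<in>?L \<times> ?S. ?T x) = (\<lambda>_. \<zero>)"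
    unfolding rel poly_ring_simps(5) .
  define vs where "vs = map (\<lambda>i. (?u l0 i, ?v l0 i)) [0..<e]"
  have vs: "set vs = U (l0, id)" "length vs = e" "distinct vs"
    using uinj[OF l0] by (auto simp: vs_def U_def distinct_map inj_on_def)
  have x0: "(l0, id) \<in> ?L \<times> ?S" using l0 by (auto simp: permutes_id)
  have vsAB: "set vs \<subseteq> A \<times> B" unfolding vs(1) by (rule UAB(1)[OF x0])
  have Zp': "\<forall>v\<in>A \<times> B. Z (fst v) (snd v) \<in> p" using Zp by auto
  note derivs = partial_derivs_entry_product[OF Z AB p Zp' d vsAB vs(3)]
  \<comment> \<open>The position set determines the term: its projections are the rows and columns
    of the minor, and within these it is the graph of the permutation. No other term can match the
    diagonal of \<open>l0\<close>.\<close>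
  have other: "U x \<noteq> set vs" if x: "x \<in> ?L \<times> ?S" "x \<noteq> (l0, id)" for x
  proof
    assume eq: "U x = set vs"
    obtain l \<pi> where lp: "x = (l, \<pi>)" "l \<in> ?L" "\<pi> \<in> ?S" using x(1) by auto
    have "fst ` U x = fst l" using ran(1)[OF lp(2)] by (auto simp: U_def lp(1) image_image)
    moreover have "fst ` set vs = fst l0" unfolding vs(1) using ran(1)[OF l0] by (auto simp: U_def image_image)
    moreover have "snd ` U x = ?v l ` (\<pi> ` {..<e})" by (auto simp: U_def lp(1) image_image)
    moreover have "\<pi> ` {..<e} = {..<e}" using lp(3) by (simp add: permutes_image)
    moreover have "snd ` set vs = snd l0" unfolding vs(1) using ran(2)[OF l0] by (auto simp: U_def image_image)
    ultimately have l: "l = l0" using eq ran(2)[OF lp(2)] by (simp add: prod_eq_iff)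
    have "\<pi> i = i" for i
    proof (cases "i < e")
      case True
      have "(?u l0 i, ?v l0 (\<pi> i)) \<in> U (l0, id)" using eq True unfolding vs(1) lp(1) l by (auto simp: U_def)
      then obtain k where k: "k < e" "?u l0 i = ?u l0 k" "?v l0 (\<pi> i) = ?v l0 k" by (auto simp: U_def)
      have "i = k" using uinj[OF l0 True k(1,2)] .
      thus ?thesis using vinj[OF l0 lt[OF lp(3) True] k(1,3)] by simp
    next
      case False
      thus ?thesis using lp(3) by (simp add: permutes_def)
    qed
    hence "\<pi> = id" by auto
    thus False using x(2) lp l by simp
  qed
  let ?D = "\<lambda>x. partial_derivs vs (?T x)"
  have Dc: "?D x \<in> carrier (poly_ring V)" if "x \<in> ?L \<times> ?S" for x
    using partial_derivs_closed[OF Tc[OF that]] by (simp add: poly_ring_simps(1))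
  let ?R = "?L \<times> ?S - {(l0, id)}"
  have "(\<Oplus>\<^bsub>poly_ring V\<^esub>x\<in>?R. ?D x) \<in> p"
  proof (rule P.finsum_ideal_closed[OF p.is_ideal])
    fix x assume x: "x \<in> ?R"
    hence x': "x \<in> ?L \<times> ?S" "x \<noteq> (l0, id)" by auto
    show "?D x \<in> p" using derivs[OF UAB(2,1)[OF x'(1)] cc[OF x'(1)]] other[OF x'] UAB(3)[OF x'(1)] vs(2) by simp
  qed (use finL in simp)
  moreover have "(\<Oplus>\<^bsub>poly_ring V\<^esub>x\<in>?R. ?D x) \<oplus>\<^bsub>poly_ring V\<^esub> ?D (l0, id) \<in> p"
  proof -
    have ins: "?L \<times> ?S = insert (l0, id) ?R" using x0 by auto
    have "(\<Oplus>\<^bsub>poly_ring V\<^esub>x\<in>?L \<times> ?S. ?D x) = (\<lambda>_. \<zero>)"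
    proof -
      have "partial_derivs vs (\<Oplus>\<^bsub>poly_ring V\<^esub>x\<in>?L \<times> ?S. ?T x) = (\<Oplus>\<^bsub>poly_ring V\<^esub>x\<in>?L \<times> ?S. ?D x)"
        by (rule partial_derivs_finsum[OF finL(3)]) (rule Tc)
      thus ?thesis unfolding sum0 partial_derivs_zero by (rule sym)
    qed
    moreover have "(\<Oplus>\<^bsub>poly_ring V\<^esub>x\<in>insert (l0, id) ?R. ?D x) = ?D (l0, id) \<oplus>\<^bsub>poly_ring V\<^esub> (\<Oplus>\<^bsub>poly_ring V\<^esub>x\<in>?R. ?D x)"
      using finL Dc x0 by (intro P.finsum_insert) auto
    moreover have "(\<Oplus>\<^bsub>poly_ring V\<^esub>x\<in>?R. ?D x) \<in> carrier (poly_ring V)" using Dc by (intro P.finsum_closed) auto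
    ultimately show ?thesis
      using p.zero_mem Dc[OF x0] P.a_comm unfolding ins[symmetric] by (simp add: poly_ring_simps(5))
  qed
  ultimately have "?D (l0, id) \<in> p" by (rule p.add_cancel_mem[OF _ Dc[OF x0]])
  hence "c (l0, id) \<in> p" using derivs[OF UAB(2,1)[OF x0] cc[OF x0]] vs(1) by simp
  thus ?thesis by (simp add: c_def)
qed

section \<open>Elimination at a prime ideal\<close>

lemma poly_ring_minus:
  assumes "f \<in> polys V" "g \<in> polys V"
  shows "f \<ominus>\<^bsub>poly_ring V\<^esub> g = indexed_padd f (\<lambda>m. \<ominus> \<one> \<otimes> g m)"
proof -
  interpret P: cring "poly_ring V" by (rule poly_ring_cring)
  have "\<ominus>\<^bsub>poly_ring V\<^esub> g = (\<lambda>m. \<ominus> \<one> \<otimes> g m)"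
  proof (rule P.minus_equality)
    show "(\<lambda>m. \<ominus> \<one> \<otimes> g m) \<oplus>\<^bsub>poly_ring V\<^esub> g = \<zero>\<^bsub>poly_ring V\<^esub>"
      using polys_closed[OF assms(2)] by (auto simp: poly_ring_simps indexed_padd_def l_minus l_neg)
  qed (use assms polys_scale[OF assms(2), of "\<ominus> \<one>"] in \<open>simp_all add: poly_ring_simps\<close>)
  thus ?thesis by (simp add: P.minus_eq poly_ring_simps)
qed

lemma tuple_minors_mono:
  assumes "x \<in> tuple_minors M A B t" "A \<subseteq> A'" "B \<subseteq> B'"
  shows "x \<in> tuple_minors M A' B' t"
proof (rule tuple_minorsE[OF assms(1)])
  fix \<rho> \<gamma> assume x: "x = det_ring R t (\<lambda>i j. M (\<rho> i) (\<gamma> j))"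
    "\<And>i. i < t \<Longrightarrow> \<rho> i \<in> A" "\<And>j. j < t \<Longrightarrow> \<gamma> j \<in> B"
  show ?thesis unfolding x(1) by (rule tuple_minorsI) (use x(2,3) assms(2,3) in blast)+
qed

abbreviation vars :: "nat \<Rightarrow> nat \<Rightarrow> (nat \<times> nat) set" where
  "vars m n \<equiv> {..<m} \<times> {..<n}"

text \<open>The state after \<open>k\<close> fraction-free elimination steps: \<open>Z\<close> is the remaining matrix, with rows
  \<open>A\<close> and columns \<open>B\<close>, and \<open>\<delta>\<close> the product of the pivots used so far.\<close>

definition pivot_state ::
    "nat \<Rightarrow> nat \<Rightarrow> nat \<Rightarrow> nat \<Rightarrow> nat set \<Rightarrow> nat set \<Rightarrow> (nat \<Rightarrow> nat \<Rightarrow> (nat \<times> nat) multiset \<Rightarrow> 'a) \<Rightarrow>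
      ((nat \<times> nat) multiset \<Rightarrow> 'a) \<Rightarrow> bool" where
  "pivot_state m n t k A B Z \<delta> \<longleftrightarrow>
     k \<le> t \<and> A \<subseteq> {..<m} \<and> B \<subseteq> {..<n} \<and> card A = m - k \<and> card B = n - k \<and>
     linear_entries (vars m n) A B Z \<delta> \<and>
     cring.power_multiplies_into (poly_ring (vars m n)) \<delta>
       (cring.tuple_minors (poly_ring (vars m n)) (\<lambda>i j. indexed_var (i, j)) {..<m} {..<n} t)
       (cring.tuple_minors (poly_ring (vars m n)) Z A B (t - k)) \<and>
     cring.power_multiplies_into (poly_ring (vars m n)) \<delta>
       (cring.tuple_minors (poly_ring (vars m n)) Z A B (t - k))
       (cring.tuple_minors (poly_ring (vars m n)) (\<lambda>i j. indexed_var (i, j)) {..<m} {..<n} t)"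

lemma pivot_state_initial:
  "pivot_state m n t 0 {..<m} {..<n} (\<lambda>i j. indexed_var (i, j)) (indexed_const \<one>)"
proof -
  let ?V = "vars m n"
  interpret P: cring "poly_ring ?V" by (rule poly_ring_cring)
  have X: "indexed_var (i, j) \<in> carrier (poly_ring ?V)" if "i \<in> {..<m}" "j \<in> {..<n}" for i j
    using polys_var[of "(i, j)" ?V] that by (simp add: poly_ring_simps)
  have c: "P.tuple_minors (\<lambda>i j. indexed_var (i, j)) {..<m} {..<n} t \<subseteq> carrier (poly_ring ?V)"
    using X by (rule P.tuple_minors_carrier)
  have "P.power_multiplies_into (indexed_const \<one>) (P.tuple_minors (\<lambda>i j. indexed_var (i, j)) {..<m} {..<n} t)
      (P.tuple_minors (\<lambda>i j. indexed_var (i, j)) {..<m} {..<n} t)"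
    unfolding P.power_multiplies_into_def
  proof (intro exI[of _ 0] ballI)
    fix x assume x: "x \<in> P.tuple_minors (\<lambda>i j. indexed_var (i, j)) {..<m} {..<n} t"
    have "x \<in> carrier (poly_ring ?V)" using x c by blast
    hence "\<one>\<^bsub>poly_ring ?V\<^esub> \<otimes>\<^bsub>poly_ring ?V\<^esub> x = x" by (rule P.l_one)
    thus "indexed_const \<one> [^]\<^bsub>poly_ring ?V\<^esub> (0::nat) \<otimes>\<^bsub>poly_ring ?V\<^esub> x \<in>
        Idl\<^bsub>poly_ring ?V\<^esub> P.tuple_minors (\<lambda>i j. indexed_var (i, j)) {..<m} {..<n} t"
      using subsetD[OF P.genideal_self[OF c] x] by simp
  qed
  moreover have "linear_entries ?V {..<m} {..<n} (\<lambda>i j. indexed_var (i, j)) (indexed_const \<one>)"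
    unfolding linear_entries_def
  proof (intro conjI ballI)
    fix i j assume "i \<in> {..<m}" "j \<in> {..<n}"
    have "indexed_var (i, j) = indexed_padd (indexed_pmult (indexed_const \<one>) (i, j)) (\<lambda>_. \<zero>)"
      using polys_closed[OF polys_var[of "(i, j)" UNIV]] by (auto simp: indexed_padd_def indexed_var_def)
    thus "\<exists>g\<in>polys (?V - ?V). indexed_var (i, j) = indexed_padd (indexed_pmult (indexed_const \<one>) (i, j)) g"
      using polys_zero by blast
  qed (rule polys_const, simp)
  ultimately show ?thesis unfolding pivot_state_def by simp
qed

text \<open>In Z_ab Z_ij - Z_aj Z_ib the variable of (i, j) has coefficient \<delta> Z_ab, and
  everything else avoids the smaller block, since the variables of row a and column b have left it.
  The two pivoting lemmas compare the minors before and after the step, so powers of the new pivot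
  are absorbed into \<delta>.\<close>

lemma pivot_state_step:
  assumes st: "pivot_state m n t k A B Z \<delta>" and k: "k < t" and ab: "a \<in> A" "b \<in> B"
  shows "pivot_state m n t (Suc k) (A - {a}) (B - {b}) (cring.pivoted (poly_ring (vars m n)) Z a b)
    (indexed_mult R \<delta> (Z a b))"
proof -
  let ?V = "vars m n" and ?A = "A - {a}" and ?B = "B - {b}"
  interpret P: cring "poly_ring ?V" by (rule poly_ring_cring)
  let ?X = "P.tuple_minors (\<lambda>i j. indexed_var (i, j)) {..<m} {..<n} t"
  let ?Z = "P.pivoted Z a b"
  have AB: "A \<subseteq> {..<m}" "B \<subseteq> {..<n}" "card A = m - k" "card B = n - k" and lin: "linear_entries ?V A B Z \<delta>"
    and pm: "P.power_multiplies_into \<delta> ?X (P.tuple_minors Z A B (t - k))"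
      "P.power_multiplies_into \<delta> (P.tuple_minors Z A B (t - k)) ?X"
    using st unfolding pivot_state_def by auto
  have fin: "finite A" "finite B" using AB finite_subset by blast+
  have ABV: "A \<times> B \<subseteq> ?V" using AB by auto
  let ?W = "?V - ?A \<times> ?B"
  have sub: "?V - A \<times> B \<subseteq> ?W" "?W \<subseteq> ?V" by auto
  have ZV: "Z i j \<in> polys ?V" if "i \<in> A" "j \<in> B" for i j
    using that ABV by (intro linear_entries_closed[OF lin ABV]) auto
  have ZP: "Z i j \<in> carrier (poly_ring ?V)" if "i \<in> A" "j \<in> B" for i j
    using ZV[OF that] by (simp add: poly_ring_simps(1))
  have ZW: "Z i j \<in> polys ?W" if "i \<in> A" "j \<in> B" "i = a \<or> j = b" for i j
    using that ABV by (intro linear_entries_closed[OF lin ABV]) auto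
  have dW: "\<delta> \<in> polys ?W" using lin polys_mono[OF _ sub(1)] unfolding linear_entries_def by blast
  have dV: "\<delta> \<in> polys ?V" using polys_mono[OF dW sub(2)] .
  have lin': "linear_entries ?V ?A ?B ?Z (indexed_mult R \<delta> (Z a b))"
    unfolding linear_entries_def
  proof (intro conjI ballI)
    show "indexed_mult R \<delta> (Z a b) \<in> polys ?W" using polys_mult[OF dW ZW[OF ab]] by simp
    fix i j assume ij: "i \<in> ?A" "j \<in> ?B"
    hence ijAB: "i \<in> A" "j \<in> B" by auto
    have ijV: "(i, j) \<in> ?V" using ijAB ABV by auto
    obtain g where g: "g \<in> polys (?V - A \<times> B)" "Z i j = indexed_padd (indexed_pmult \<delta> (i, j)) g"
      using lin ijAB unfolding linear_entries_def by blast
    have gW: "g \<in> polys ?W" using polys_mono[OF g(1) sub(1)] .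
    have gV: "g \<in> polys ?V" using polys_mono[OF gW sub(2)] .
    let ?h = "indexed_mult R (Z a j) (Z i b)"
    have hW: "?h \<in> polys ?W" using ZW ijAB ab by (intro polys_mult) auto
    have hV: "?h \<in> polys ?V" using polys_mono[OF hW sub(2)] .
    let ?g = "indexed_padd (indexed_mult R (Z a b) g) (\<lambda>m. \<ominus> \<one> \<otimes> ?h m)"
    have zg: "indexed_mult R (Z a b) g \<in> polys ?V" using polys_mult[OF ZV[OF ab] gV] .
    have "?g \<in> polys ?W"
      using polys_mult[OF ZW[OF ab] gW] polys_scale[OF hW, of "\<ominus> \<one>"] by (intro indexed_pset.indexed_padd) auto
    moreover have "?Z i j = indexed_padd (indexed_pmult (indexed_mult R \<delta> (Z a b)) (i, j)) ?g"
    proof -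
      have pmd: "indexed_pmult \<delta> (i, j) \<in> polys ?V" using dV ijV by (rule indexed_pset.indexed_pmult)
      have "indexed_mult R (Z a b) (Z i j) = indexed_mult R (Z i j) (Z a b)"
        using indexed_mult_comm[OF polys_coeff[OF ZV[OF ab]] polys_coeff[OF ZV[OF ijAB]]] .
      also have "\<dots> = indexed_padd (indexed_pmult (indexed_mult R \<delta> (Z a b)) (i, j)) (indexed_mult R g (Z a b))"
        unfolding g(2) using polys_coeff[OF pmd] polys_coeff[OF dV] polys_coeff[OF gV] polys_coeff[OF ZV[OF ab]]
        by (simp add: indexed_mult_padd_left indexed_mult_pmult_left)
      also have "indexed_mult R g (Z a b) = indexed_mult R (Z a b) g"
        using indexed_mult_comm[OF polys_coeff[OF gV] polys_coeff[OF ZV[OF ab]]] .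
      finally have e: "indexed_mult R (Z a b) (Z i j) =
          indexed_padd (indexed_pmult (indexed_mult R \<delta> (Z a b)) (i, j)) (indexed_mult R (Z a b) g)" .
      have "?Z i j = indexed_padd (indexed_mult R (Z a b) (Z i j)) (\<lambda>m. \<ominus> \<one> \<otimes> ?h m)"
        unfolding P.pivoted_def
        using poly_ring_minus[OF polys_mult[OF ZV[OF ab] ZV[OF ijAB]] hV] by (simp add: poly_ring_simps(2))
      also have "\<dots> = indexed_padd (indexed_pmult (indexed_mult R \<delta> (Z a b)) (i, j)) ?g"
      proof
        fix x
        have pz: "indexed_pmult (indexed_mult R \<delta> (Z a b)) (i, j) \<in> polys ?V"
          using polys_mult[OF dV ZV[OF ab]] ijV by (rule indexed_pset.indexed_pmult)
        show "indexed_padd (indexed_mult R (Z a b) (Z i j)) (\<lambda>m. \<ominus> \<one> \<otimes> ?h m) x =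
            indexed_padd (indexed_pmult (indexed_mult R \<delta> (Z a b)) (i, j)) ?g x"
          unfolding e using polys_closed[OF zg, of x] polys_closed[OF hV, of x] polys_closed[OF pz, of x]
          by (simp add: indexed_padd_def a_assoc)
      qed
      finally show ?thesis .
    qed
    ultimately show "\<exists>g\<in>polys ?W. ?Z i j = indexed_padd (indexed_pmult (indexed_mult R \<delta> (Z a b)) (i, j)) g" by blast
  qed
  define s where "s = t - Suc k"
  have s: "t - k = Suc s" using k by (simp add: s_def)
  have ZP': "?Z i j \<in> carrier (poly_ring ?V)" if "i \<in> ?A" "j \<in> ?B" for i j
    using P.pivoted_closed[of A B Z a b i j] ZP ab that by blast
  have XP: "indexed_var (i, j) \<in> carrier (poly_ring ?V)" if "i \<in> {..<m}" "j \<in> {..<n}" for i j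
    using polys_var[of "(i, j)" ?V] that by (simp add: poly_ring_simps(1))
  have pc: "P.tuple_minors Z A B (Suc s) \<subseteq> carrier (poly_ring ?V)" "?X \<subseteq> carrier (poly_ring ?V)"
    "P.tuple_minors ?Z ?A ?B s \<subseteq> carrier (poly_ring ?V)"
    by (rule P.tuple_minors_carrier[OF ZP], assumption+)
      (rule P.tuple_minors_carrier[OF XP], assumption+, rule P.tuple_minors_carrier[OF ZP'], assumption+)
  have dP: "\<delta> \<in> carrier (poly_ring ?V)" using dV by (simp add: poly_ring_simps(1))
  have 1: "P.power_multiplies_into (Z a b) (P.tuple_minors Z A B (Suc s)) (P.tuple_minors ?Z ?A ?B s)"
    unfolding P.power_multiplies_into_def
    using P.minor_times_pivot_power[of A B Z a b _ s] ZP ab by (intro exI[of _ "Suc s"]) auto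
  \<comment> \<open>In this direction a single factor of the pivot suffices, and minors on the
    smaller index sets are also minors on A and B.\<close>
  have 2: "P.power_multiplies_into (Z a b) (P.tuple_minors ?Z ?A ?B s) (P.tuple_minors Z A B (Suc s))"
    unfolding P.power_multiplies_into_def
  proof (intro exI[of _ 1] ballI)
    fix x assume x: "x \<in> P.tuple_minors ?Z ?A ?B s"
    hence "x \<in> P.tuple_minors ?Z A B s" by (rule P.tuple_minors_mono) auto
    hence "Z a b \<otimes>\<^bsub>poly_ring ?V\<^esub> x \<in> Idl\<^bsub>poly_ring ?V\<^esub> P.tuple_minors Z A B (Suc s)"
      using ZP ab by (intro P.pivot_times_pivoted_minor) auto
    thus "Z a b [^]\<^bsub>poly_ring ?V\<^esub> (1::nat) \<otimes>\<^bsub>poly_ring ?V\<^esub> x \<in> Idl\<^bsub>poly_ring ?V\<^esub> P.tuple_minors Z A B (Suc s)"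
      using ZP[OF ab] by simp
  qed
  have "P.power_multiplies_into (\<delta> \<otimes>\<^bsub>poly_ring ?V\<^esub> Z a b) ?X (P.tuple_minors ?Z ?A ?B s)"
    using pm(1) 1 unfolding s by (rule P.power_multiplies_into_trans[OF pc(2,1,3) dP ZP[OF ab]])
  moreover have "P.power_multiplies_into (Z a b \<otimes>\<^bsub>poly_ring ?V\<^esub> \<delta>) (P.tuple_minors ?Z ?A ?B s) ?X"
    using 2 pm(2) unfolding s by (rule P.power_multiplies_into_trans[OF pc(3,1,2) ZP[OF ab] dP])
  moreover have "Z a b \<otimes>\<^bsub>poly_ring ?V\<^esub> \<delta> = \<delta> \<otimes>\<^bsub>poly_ring ?V\<^esub> Z a b"
    using ZP[OF ab] dP by (rule P.m_comm)
  ultimately show ?thesis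
    unfolding pivot_state_def using k AB ab fin lin' s_def
    by (auto simp: poly_ring_simps(2) card_Diff_singleton)
qed

section \<open>A chain of primes obtained by freeing variables\<close>

text \<open>The head of the list is extended last, so dropping initial elements of the list enlarges
  the ideal.\<close>

fun var_extensions :: "'c set \<Rightarrow> ('c multiset \<Rightarrow> 'a) set \<Rightarrow> 'c list \<Rightarrow> ('c multiset \<Rightarrow> 'a) set" where
  "var_extensions V p [] = p"
| "var_extensions V p (v # vs) = var_extension V v (var_extensions V p vs)"

text \<open>A polynomial free of all listed variables is its own only coefficient at every stage, so
  freeing these variables does not affect its membership.\<close>

lemma var_extensions_prime:
  assumes p: "primeideal p (poly_ring V)" and "set vs \<subseteq> V"
  shows "primeideal (var_extensions V p vs) (poly_ring V)" "var_extensions V p vs \<subseteq> p"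
    "h \<in> polys (V - set vs) \<Longrightarrow> h \<in> var_extensions V p vs \<longleftrightarrow> h \<in> p"
proof -
  have "primeideal (var_extensions V p vs) (poly_ring V) \<and> var_extensions V p vs \<subseteq> p \<and>
      (\<forall>h\<in>polys (V - set vs). h \<in> var_extensions V p vs \<longleftrightarrow> h \<in> p)"
    using assms(2)
  proof (induction vs)
    case Nil
    then show ?case using p by simp
  next
    case (Cons v vs)
    have IH: "primeideal (var_extensions V p vs) (poly_ring V)" "var_extensions V p vs \<subseteq> p"
      "\<forall>h\<in>polys (V - set vs). h \<in> var_extensions V p vs \<longleftrightarrow> h \<in> p" and v: "v \<in> V" using Cons by auto
    note Qi = primeideal.axioms(1)[OF IH(1)]
    have "h \<in> var_extensions V p (v # vs) \<longleftrightarrow> h \<in> p" if h: "h \<in> polys (V - set (v # vs))" for h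
    proof -
      have "h \<in> polys (V - {v})" "h \<in> polys (V - set vs)"
        using polys_mono[OF h, of "V - {v}"] polys_mono[OF h, of "V - set vs"] by auto
      thus ?thesis using free_mem_var_extension_iff[OF Qi] IH(3) by simp
    qed
    thus ?case using var_extension_prime[OF IH(1) v] var_extension_subset[OF Qi v] IH(2) by auto
  qed
  thus "primeideal (var_extensions V p vs) (poly_ring V)" "var_extensions V p vs \<subseteq> p"
    "h \<in> polys (V - set vs) \<Longrightarrow> h \<in> var_extensions V p vs \<longleftrightarrow> h \<in> p" by auto
qed

lemma var_coeff_Suc_0_linear:
  assumes "\<delta> \<in> polys W" "g \<in> polys W" "v \<notin> W"
  shows "var_coeff v (Suc 0) (indexed_padd (indexed_pmult \<delta> v) g) = \<delta>"
  using polys_closed[OF assms(1)]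
  unfolding var_coeff_padd var_coeff_Suc_pmult var_coeff_free[OF assms(1,3)] var_coeff_free[OF assms(2,3)]
  by (simp add: indexed_padd_def)

text \<open>The inclusions are strict because of the entry of Z at the variable freed next: it is
  free of the variables treated before and stays in the larger prime, but in the smaller one its
  coefficient \<delta> would have to lie in the larger, although \<delta> is outside p.\<close>

lemma krull_dim_ge_linear_entries:
  assumes lin: "linear_entries V A B Z \<delta>" and AB: "A \<times> B \<subseteq> V" "finite A" "finite B"
    and p: "primeideal p (poly_ring V)" and Zp: "\<And>i j. i \<in> A \<Longrightarrow> j \<in> B \<Longrightarrow> Z i j \<in> p" and d: "\<delta> \<notin> p"
  shows "enat (card A * card B) \<le> krull_dim (localization (poly_ring V) p)"
proof -
  interpret p: primeideal p "poly_ring V" by (rule p)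
  obtain vs where vs: "set vs = A \<times> B" "distinct vs" using finite_distinct_list[of "A \<times> B"] AB by blast
  have len: "length vs = card A * card B" using vs by (metis card_cartesian_product distinct_card)
  let ?c = "\<lambda>i. var_extensions V p (drop i vs)"
  have sub: "set (drop i vs) \<subseteq> V" for i using set_drop_subset[of i vs] vs AB by auto
  have dV: "\<delta> \<in> polys (V - A \<times> B)" using lin unfolding linear_entries_def by blast
  have "enat (length vs) \<le> krull_dim p.loc"
  proof (rule p.krull_dim_loc_ge[of _ ?c])
    fix i
    show "primeideal (?c i) (poly_ring V)" "?c i \<subseteq> p" using var_extensions_prime[OF p sub] by auto
    assume i: "i < length vs"
    let ?v = "vs ! i" and ?vs = "drop (Suc i) vs"
    have eq: "drop i vs = ?v # ?vs" using i by (simp add: Cons_nth_drop_Suc)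
    have v: "?v \<in> A \<times> B" using i vs nth_mem by blast
    have vn: "?v \<notin> set ?vs" using vs(2) eq distinct_drop[of vs i] by auto
    note Q = var_extensions_prime[OF p sub[of "Suc i"]]
    obtain g where g: "g \<in> polys (V - A \<times> B)" "Z (fst ?v) (snd ?v) = indexed_padd (indexed_pmult \<delta> ?v) g"
      using lin v unfolding linear_entries_def by (metis mem_Times_iff prod.collapse)
    let ?z = "Z (fst ?v) (snd ?v)"
    have W: "V - A \<times> B \<subseteq> V - set ?vs" using vs(1) set_drop_subset[of "Suc i" vs] by auto
    have "?z \<in> polys (V - set ?vs)"
      using v AB(1) W vn by (intro linear_entries_closed[OF lin AB(1)]) auto
    hence z: "?z \<in> ?c (Suc i)" using Q(3) Zp v by auto
    have "\<delta> \<notin> ?c (Suc i)" using Q(3)[OF polys_mono[OF dV W]] d by simp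
    moreover have "var_coeff ?v (Suc 0) ?z = \<delta>"
      unfolding g(2) using v by (intro var_coeff_Suc_0_linear[OF dV g(1)]) auto
    ultimately have "?z \<notin> ?c i" unfolding eq by (auto simp: var_extension_def)
    moreover have "?c i \<subseteq> ?c (Suc i)"
      unfolding eq using v AB(1) by (simp, intro var_extension_subset primeideal.axioms(1) Q(1)) auto
    ultimately show "?c i \<subset> ?c (Suc i)" using z by blast
  qed
  thus ?thesis unfolding len .
qed

section \<open>The determinantal ideal at a prime\<close>

lemma generic_ideal_eq:
  "generic_determinantal_ideal R m n t =
    Idl\<^bsub>poly_ring (vars m n)\<^esub> (cring.tuple_minors (poly_ring (vars m n)) (\<lambda>i j. indexed_var (i, j)) {..<m} {..<n} t)"
proof -
  interpret P: cring "poly_ring (vars m n)" by (rule poly_ring_cring)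
  have "(\<lambda>i j. indexed_var (i, j)) = generic_matrix R" by (auto simp: generic_matrix_def fun_eq_iff)
  thus ?thesis
    unfolding generic_determinantal_ideal_def determinantal_ideal_def generic_ring_def
    using polys_var[of _ "vars m n"]
    by (subst P.Idl_minors) (auto simp: poly_ring_simps(1) generic_matrix_def)
qed

lemma pivot_state_facts:
  assumes "pivot_state m n t k A B Z \<delta>"
  shows "A \<times> B \<subseteq> vars m n" "finite A" "finite B" "card A = m - k" "card B = n - k" "linear_entries (vars m n) A B Z \<delta>"
    "\<And>i j. i \<in> A \<Longrightarrow> j \<in> B \<Longrightarrow> Z i j \<in> polys (vars m n)" "\<delta> \<in> polys (vars m n)"
proof -
  show AB: "A \<times> B \<subseteq> vars m n" and "card A = m - k" "card B = n - k" and lin: "linear_entries (vars m n) A B Z \<delta>"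
    using assms unfolding pivot_state_def by auto
  show "finite A" "finite B" using assms finite_subset unfolding pivot_state_def by blast+
  show "Z i j \<in> polys (vars m n)" if "i \<in> A" "j \<in> B" for i j
    using that AB by (intro linear_entries_closed[OF lin AB]) auto
  show "\<delta> \<in> polys (vars m n)"
    using lin polys_mono[of \<delta> "vars m n - A \<times> B" "vars m n"] unfolding linear_entries_def by blast
qed

text \<open>At p the element \<delta> becomes a unit, so the two comparisons up to powers of
  \<delta> in \<open>pivot_state\<close> become equality of the localized ideals.\<close>

lemma localized_generic_ideal:
  assumes st: "pivot_state m n t k A B Z \<delta>" and p: "primeideal p (poly_ring (vars m n))" and d: "\<delta> \<notin> p"
  shows "localized_ideal (poly_ring (vars m n)) p (generic_determinantal_ideal R m n t) =
    Idl\<^bsub>localization (poly_ring (vars m n)) p\<^esub> (primeideal.emb p (poly_ring (vars m n)) `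
       cring.subset_minor (poly_ring (vars m n)) Z (t - k) ` subset_pairs A B (t - k))"
proof -
  let ?V = "vars m n"
  interpret P: cring "poly_ring ?V" by (rule poly_ring_cring)
  interpret p: primeideal p "poly_ring ?V" by (rule p)
  note F = pivot_state_facts[OF st]
  let ?X = "P.tuple_minors (\<lambda>i j. indexed_var (i, j)) {..<m} {..<n} t"
  let ?T = "P.tuple_minors Z A B (t - k)" and ?S = "P.subset_minor Z (t - k) ` subset_pairs A B (t - k)"
  have ZP: "Z i j \<in> carrier (poly_ring ?V)" if "i \<in> A" "j \<in> B" for i j using F(7)[OF that] by (simp add: poly_ring_simps(1))
  have Xc: "?X \<subseteq> carrier (poly_ring ?V)"
    using polys_var[of _ ?V] by (intro P.tuple_minors_carrier) (auto simp: poly_ring_simps(1))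
  have Tc: "?T \<subseteq> carrier (poly_ring ?V)" using ZP by (rule P.tuple_minors_carrier)
  have TS: "Idl\<^bsub>poly_ring ?V\<^esub> ?T = Idl\<^bsub>poly_ring ?V\<^esub> ?S" using F(2,3) ZP by (rule P.Idl_tuple_minors)
  have Sc: "?S \<subseteq> carrier (poly_ring ?V)" using P.subset_minor_tuple[OF F(2,3)] Tc by blast
  have dP: "\<delta> \<in> carrier (poly_ring ?V)" using F(8) by (simp add: poly_ring_simps(1))
  obtain K where K: "\<And>x. x \<in> ?X \<Longrightarrow> \<delta> [^]\<^bsub>poly_ring ?V\<^esub> (K::nat) \<otimes>\<^bsub>poly_ring ?V\<^esub> x \<in> Idl\<^bsub>poly_ring ?V\<^esub> ?T"
    using st unfolding pivot_state_def P.power_multiplies_into_def by blast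
  obtain L where L: "\<And>x. x \<in> ?T \<Longrightarrow> \<delta> [^]\<^bsub>poly_ring ?V\<^esub> (L::nat) \<otimes>\<^bsub>poly_ring ?V\<^esub> x \<in> Idl\<^bsub>poly_ring ?V\<^esub> ?X"
    using st unfolding pivot_state_def P.power_multiplies_into_def by blast
  interpret I: ideal "Idl\<^bsub>poly_ring ?V\<^esub> ?X" "poly_ring ?V" using Xc by (rule P.genideal_ideal)
  have Ic: "Idl\<^bsub>poly_ring ?V\<^esub> ?X \<subseteq> carrier (poly_ring ?V)" by (rule I.a_subset)
  have II: "Idl\<^bsub>poly_ring ?V\<^esub> (Idl\<^bsub>poly_ring ?V\<^esub> ?X) = Idl\<^bsub>poly_ring ?V\<^esub> ?X"
    using P.genideal_minimal[OF I.is_ideal order_refl] P.genideal_self[OF Ic] by blast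
  have 1: "localized_ideal (poly_ring ?V) p (Idl\<^bsub>poly_ring ?V\<^esub> ?X) \<subseteq> Idl\<^bsub>p.loc\<^esub> (p.emb ` ?S)"
  proof (rule p.localized_ideal_mono[OF Sc Ic])
    fix x assume x: "x \<in> Idl\<^bsub>poly_ring ?V\<^esub> ?X"
    have "\<delta> [^]\<^bsub>poly_ring ?V\<^esub> K \<otimes>\<^bsub>poly_ring ?V\<^esub> x \<in> Idl\<^bsub>poly_ring ?V\<^esub> ?T"
      by (rule P.multiplies_into_ideal[OF Tc Xc P.nat_pow_closed[OF dP] _ x]) (rule K)
    thus "\<exists>u\<in>p.loc_denominators. u \<otimes>\<^bsub>poly_ring ?V\<^esub> x \<in> Idl\<^bsub>poly_ring ?V\<^esub> ?S"
      unfolding TS using p.pow_notin_prime[OF dP d] by blast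
  qed
  have "localized_ideal (poly_ring ?V) p ?S \<subseteq> Idl\<^bsub>p.loc\<^esub> (p.emb ` (Idl\<^bsub>poly_ring ?V\<^esub> ?X))"
  proof (rule p.localized_ideal_mono[OF Ic Sc])
    fix x assume "x \<in> ?S"
    hence "x \<in> ?T" using P.subset_minor_tuple[OF F(2,3)] by blast
    from L[OF this] show "\<exists>u\<in>p.loc_denominators. u \<otimes>\<^bsub>poly_ring ?V\<^esub> x \<in> Idl\<^bsub>poly_ring ?V\<^esub> (Idl\<^bsub>poly_ring ?V\<^esub> ?X)"
      unfolding II using p.pow_notin_prime[OF dP d] by blast
  qed
  thus ?thesis using 1 unfolding generic_ideal_eq localized_ideal_def by (rule equalityI[rotated])
qed

text \<open>Every prime containing the determinantal ideal is reached by some state whose remaining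
  entries all lie in it: eliminate as long as a pivot outside the prime is available.\<close>

lemma prime_over_generic_ideal:
  assumes p: "primeideal p (poly_ring (vars m n))" and I: "generic_determinantal_ideal R m n t \<subseteq> p"
  shows "\<exists>k<t. min_gens (localization (poly_ring (vars m n)) p)
        (localized_ideal (poly_ring (vars m n)) p (generic_determinantal_ideal R m n t))
        \<le> enat (((m - k) choose (t - k)) * ((n - k) choose (t - k))) \<and>
     enat ((m - k) * (n - k)) \<le> krull_dim (localization (poly_ring (vars m n)) p)"
proof -
  let ?V = "vars m n"
  interpret P: cring "poly_ring ?V" by (rule poly_ring_cring)
  interpret p: primeideal p "poly_ring ?V" by (rule p)
  let ?Q = "\<lambda>k. \<exists>A B Z \<delta>. pivot_state m n t k A B Z \<delta> \<and> \<delta> \<notin> p"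
  define k where "k = (GREATEST k. ?Q k)"
  have Q0: "?Q 0" using pivot_state_initial poly_primeidealD(1)[OF p] by blast
  have bound: "k \<le> t" if "?Q k" for k using that unfolding pivot_state_def by blast
  have "?Q k" unfolding k_def using Q0 bound by (rule GreatestI_nat)
  then obtain A B Z \<delta> where st: "pivot_state m n t k A B Z \<delta>" and d: "\<delta> \<notin> p" by blast
  have max: "\<not> ?Q (Suc k)" using Greatest_le_nat[of ?Q "Suc k" t] bound unfolding k_def by auto
  note F = pivot_state_facts[OF st]
  let ?X = "P.tuple_minors (\<lambda>i j. indexed_var (i, j)) {..<m} {..<n} t"
  \<comment> \<open>After t steps the remaining minors have size 0 and equal 1, so a power of
    \<delta> would lie in the ideal and hence in p.\<close>
  have k: "k < t"
  proof (rule ccontr)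
    assume "\<not> k < t"
    hence "k = t" using st unfolding pivot_state_def by simp
    hence "\<one>\<^bsub>poly_ring ?V\<^esub> \<in> P.tuple_minors Z A B (t - k)"
      unfolding P.tuple_minors_def by (auto simp: P.det_ring_0)
    then obtain K :: nat where "\<delta> [^]\<^bsub>poly_ring ?V\<^esub> K \<otimes>\<^bsub>poly_ring ?V\<^esub> \<one>\<^bsub>poly_ring ?V\<^esub> \<in> Idl\<^bsub>poly_ring ?V\<^esub> ?X"
      using st unfolding pivot_state_def P.power_multiplies_into_def by blast
    hence "\<delta> [^]\<^bsub>poly_ring ?V\<^esub> K \<otimes>\<^bsub>poly_ring ?V\<^esub> \<one>\<^bsub>poly_ring ?V\<^esub> \<in> p"
      using I unfolding generic_ideal_eq by blast
    moreover have "\<delta> [^]\<^bsub>poly_ring ?V\<^esub> K \<in> carrier (poly_ring ?V)"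
      using F(8) by (intro P.nat_pow_closed) (simp add: poly_ring_simps(1))
    ultimately have "\<delta> [^]\<^bsub>poly_ring ?V\<^esub> K \<in> p" by (simp only: P.r_one)
    thus False using p.pow_notin_prime[of \<delta> K] F(8) d by (simp add: poly_ring_simps(1))
  qed
  have Zp: "Z i j \<in> p" if "i \<in> A" "j \<in> B" for i j
  proof (rule ccontr)
    assume "Z i j \<notin> p"
    hence "indexed_mult R \<delta> (Z i j) \<notin> p" using poly_primeidealD(2)[OF p F(8) F(7)[OF that]] d by blast
    thus False using max pivot_state_step[OF st k that] by blast
  qed
  have dim: "enat ((m - k) * (n - k)) \<le> krull_dim (localization (poly_ring ?V) p)"
    using krull_dim_ge_linear_entries[OF F(6,1,2,3) p Zp d] F(4,5) by simp
  have "P.subset_minor Z (t - k) l \<in> carrier (poly_ring ?V)" if "l \<in> subset_pairs A B (t - k)" for l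
    using P.subset_minor_tuple[OF F(2,3) that] P.tuple_minors_carrier[of A B Z "t - k"] F(7)
    by (auto simp: poly_ring_simps(1))
  hence "min_gens p.loc (localized_ideal (poly_ring ?V) p (generic_determinantal_ideal R m n t))
      \<le> enat (card (subset_pairs A B (t - k)))"
    unfolding localized_generic_ideal[OF st p d]
    using finite_subset_pairs[OF F(2,3)] by (intro p.min_gens_loc_le) auto
  also have "card (subset_pairs A B (t - k)) = ((m - k) choose (t - k)) * ((n - k) choose (t - k))"
    using card_subset_pairs[OF F(2,3)] F(4,5) by simp
  finally show ?thesis using k dim by blast
qed

end

section \<open>Primes attaining the bounds\<close>

text \<open>In a Noetherian ring the union of a nonempty chain of ideals belongs to the chain, hence
  is proper if the members are, and Zorn's lemma applies to the proper ideals.\<close>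

lemma (in cring) exists_maximal_ideal:
  assumes "noetherian_ring R" "carrier R \<noteq> {\<zero>}"
  shows "\<exists>M. maximalideal M R"
proof -
  interpret N: noetherian_ring R by fact
  let ?A = "{I. ideal I R \<and> I \<noteq> carrier R}"
  have "?A \<noteq> {}" using zeroideal assms(2) by blast
  moreover have "(\<Union>C) \<in> ?A" if "C \<noteq> {}" "subset.chain ?A C" for C
  proof -
    have "subset.chain {I. ideal I R} C" using that(2) unfolding subset_chain_def by blast
    hence "(\<Union>C) \<in> C" using that(1) by (intro N.ideal_chain_is_trivial)
    thus ?thesis using that(2) unfolding subset_chain_def by blast
  qed
  ultimately obtain M where M: "M \<in> ?A" "\<forall>J\<in>?A. M \<subseteq> J \<longrightarrow> J = M" using subset_Zorn_nonempty[of ?A] by blast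
  have "maximalideal M R"
  proof (rule maximalidealI)
    show "ideal M R" "carrier R \<noteq> M" using M(1) by auto
    show "J = M \<or> J = carrier R" if "ideal J R" "M \<subseteq> J" for J using M(2) that by blast
  qed
  thus ?thesis ..
qed

text \<open>Zorn's lemma is applied to complements, which turns minimal primes into maximal
  elements. A union of complements corresponds to the intersection of a chain of primes, and this is
  prime because two elements outside it are both outside a single member.\<close>

lemma (in cring) exists_minimal_prime:
  assumes "primeideal M R"
  shows "\<exists>q. primeideal q R \<and> (\<forall>q'. primeideal q' R \<longrightarrow> q' \<subseteq> q \<longrightarrow> q' = q)"
proof -
  let ?A = "{carrier R - q | q. primeideal q R}"
  have sub: "q \<subseteq> carrier R" if "primeideal q R" for q
    using that by (meson additive_subgroup.a_subset ideal.axioms(1) primeideal.axioms(1))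
  have "(\<Union>C) \<in> ?A" if C: "C \<noteq> {}" "subset.chain ?A C" for C
  proof -
    let ?q = "carrier R - \<Union>C"
    have CA: "C \<subseteq> ?A" and lin: "\<And>x y. x \<in> C \<Longrightarrow> y \<in> C \<Longrightarrow> x \<subseteq> y \<or> y \<subseteq> x"
      using C(2) unfolding subset_chain_def by blast+
    have pr: "primeideal (carrier R - x) R" "x \<subseteq> carrier R" if x: "x \<in> C" for x
    proof -
      obtain q where q: "x = carrier R - q" "primeideal q R" using CA x by blast
      have "carrier R - x = q" using q sub[OF q(2)] by blast
      thus "primeideal (carrier R - x) R" "x \<subseteq> carrier R" using q by auto
    qed
    have q_eq: "?q = \<Inter>((\<lambda>x. carrier R - x) ` C)" using C(1) by auto
    have "ideal ?q R" unfolding q_eq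
      using C(1) pr(1) primeideal.axioms(1) by (intro i_Intersect) auto
    moreover have "\<one> \<notin> ?q"
    proof -
      obtain x where x: "x \<in> C" using C(1) by blast
      interpret pc: primeideal "carrier R - x" R by (rule pr(1)[OF x])
      have "\<one> \<in> x" using pc.one_imp_carrier pc.I_notcarr one_closed by blast
      thus ?thesis using x by blast
    qed
    moreover have "a \<in> ?q \<or> b \<in> ?q" if ab: "a \<in> carrier R" "b \<in> carrier R" "a \<otimes> b \<in> ?q" for a b
    proof (rule ccontr)
      assume "\<not> ?thesis"
      then obtain x y where xy: "x \<in> C" "a \<in> x" "y \<in> C" "b \<in> y" using ab by blast
      then obtain z where z: "z \<in> C" "a \<in> z" "b \<in> z" using lin[OF xy(1,3)] by blast
      interpret pc: primeideal "carrier R - z" R by (rule pr(1)[OF z(1)])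
      show False using pc.I_prime[OF ab(1,2)] ab(3) z by blast
    qed
    ultimately have "primeideal ?q R" using is_cring by (intro primeidealI) auto
    moreover have "carrier R - ?q = \<Union>C" using pr(2) by blast
    ultimately show ?thesis by blast
  qed
  moreover have "?A \<noteq> {}" using assms by blast
  ultimately obtain D where D: "D \<in> ?A" "\<forall>D'\<in>?A. D \<subseteq> D' \<longrightarrow> D' = D" using subset_Zorn_nonempty[of ?A] by blast
  then obtain q where q: "D = carrier R - q" "primeideal q R" by blast
  have "q' = q" if "primeideal q' R" "q' \<subseteq> q" for q'
  proof -
    have "carrier R - q' \<in> ?A" using that(1) by blast
    hence "D \<subseteq> carrier R - q' \<longrightarrow> carrier R - q' = D" by (rule bspec[OF D(2)])
    moreover have "D \<subseteq> carrier R - q'" using that(2) q(1) by auto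
    ultimately have "carrier R - q' = carrier R - q" using q(1) by simp
    thus ?thesis using sub[OF that(1)] sub[OF q(2)] by blast
  qed
  thus ?thesis using q(2) by blast
qed

context cring begin

text \<open>Expansion along a row; t must be positive because the empty minor is 1.\<close>

lemma det_ring_entries_in_ideal:
  assumes I: "ideal I R" and A: "\<And>i j. i < t \<Longrightarrow> j < t \<Longrightarrow> A i j \<in> I" and t: "0 < t"
  shows "det_ring R t A \<in> I"
proof -
  interpret I: ideal I R by fact
  obtain s where s: "t = Suc s" using t by (cases t) auto
  have cl: "A i j \<in> carrier R" if "i < t" "j < t" for i j using A[OF that] I.a_subset by blast
  have tr: "transpose s b j < t" if "b < t" "j < t" for b j
    using that s by (auto simp: transpose_def)
  have "(\<Oplus>b\<in>{..<t}. (if b = s then \<one> else \<ominus> \<one>) \<otimes> (A s b \<otimes> det_ring R s (\<lambda>i j. A i (transpose s b j)))) \<in> I"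
  proof (rule finsum_ideal_closed[OF I])
    fix b assume b: "b \<in> {..<t}"
    have "det_ring R s (\<lambda>i j. A i (transpose s b j)) \<in> carrier R"
      using cl tr b s by (intro det_ring_closed) auto
    moreover have "A s b \<in> I" using A b s by auto
    ultimately have "A s b \<otimes> det_ring R s (\<lambda>i j. A i (transpose s b j)) \<in> I" by (intro I.I_r_closed)
    thus "(if b = s then \<one> else \<ominus> \<one>) \<otimes> (A s b \<otimes> det_ring R s (\<lambda>i j. A i (transpose s b j))) \<in> I"
      by (rule I.I_l_closed) simp
  qed simp
  thus ?thesis using det_ring_laplace[of s A] cl unfolding s by simp
qed

text \<open>At the extension of q no choice of pivot fails: an entry of Z inside this prime would
  force its coefficient \<delta> into it as well. Since t \<le> m and t \<le> n, rows and columns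
  last for k \<le> t steps.\<close>

lemma pivot_state_generic:
  assumes q: "primeideal q R" and t: "t \<le> m" "t \<le> n" and k: "k \<le> t"
  shows "\<exists>A B Z \<delta>. pivot_state m n t k A B Z \<delta> \<and> \<delta> \<notin> coeff_ideal (vars m n) q"
  using k
proof (induction k)
  case 0
  have "primeideal (coeff_ideal (vars m n) q) (poly_ring (vars m n))"
    using q by (intro coeff_ideal_prime) auto
  thus ?case using pivot_state_initial poly_primeidealD(1) by blast
next
  case (Suc k)
  let ?V = "vars m n" and ?P0 = "coeff_ideal (vars m n) q"
  interpret q: primeideal q R by (rule q)
  have P0: "primeideal ?P0 (poly_ring ?V)" using q by (intro coeff_ideal_prime) auto
  obtain A B Z \<delta> where st: "pivot_state m n t k A B Z \<delta>" and d: "\<delta> \<notin> ?P0" using Suc by auto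
  note F = pivot_state_facts[OF st]
  have "A \<noteq> {}" "B \<noteq> {}" using F(4,5) Suc.prems t by auto
  then obtain a b where ab: "a \<in> A" "b \<in> B" by blast
  obtain g where g: "g \<in> polys (?V - A \<times> B)" "Z a b = indexed_padd (indexed_pmult \<delta> (a, b)) g"
    using F(6) ab unfolding linear_entries_def by blast
  have dW: "\<delta> \<in> polys (?V - A \<times> B)" using F(6) unfolding linear_entries_def by blast
  have "Z a b \<notin> ?P0"
  proof
    assume z: "Z a b \<in> ?P0"
    have "var_coeff (a, b) (Suc 0) (Z a b) = \<delta>"
      unfolding g(2) using ab by (intro var_coeff_Suc_0_linear[OF dW g(1)]) auto
    moreover have "var_coeff (a, b) (Suc 0) (Z a b) m' \<in> q" for m'
      using z q.zero_mem by (auto simp: var_coeff_def coeff_ideal_def)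
    ultimately have "\<delta> \<in> ?P0" using F(8) by (simp add: coeff_ideal_def)
    thus False using d by simp
  qed
  hence "indexed_mult R \<delta> (Z a b) \<notin> ?P0" using poly_primeidealD(2)[OF P0 F(8) F(7)[OF ab]] d by blast
  moreover have "k < t" using Suc.prems by simp
  ultimately show ?case using pivot_state_step[OF st _ ab] by blast
qed

text \<open>Solving \<open>Z i j = 0\<close> for the variables outside the pivot rows and columns gives a prime over
  which those in the pivot rows and columns stay independent.\<close>

lemma exists_prime_killing_entries:
  assumes q: "primeideal q R" and st: "pivot_state m n t k A B Z \<delta>" and d: "\<delta> \<notin> coeff_ideal (vars m n) q"
  shows "\<exists>p. primeideal p (poly_ring (vars m n)) \<and> \<delta> \<notin> p \<and> (\<forall>i\<in>A. \<forall>j\<in>B. Z i j \<in> p) \<and>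
    (\<forall>f\<in>polys (vars m n - A \<times> B). f \<in> p \<longrightarrow> (\<forall>x. f x \<in> q))"
proof -
  let ?V = "vars m n" and ?W = "vars m n - A \<times> B" and ?P0 = "coeff_ideal (vars m n) q"
  have P0: "primeideal ?P0 (poly_ring ?V)" using q by (intro coeff_ideal_prime) auto
  interpret P0: primeideal ?P0 "poly_ring ?V" by (rule P0)
  interpret h: ring_hom_cring "poly_ring ?V" P0.loc P0.emb by (rule P0.emb_hom)
  interpret M: primeideal "P0.extended_prime ?P0" P0.loc by (rule P0.extended_prime_self)
  note F = pivot_state_facts[OF st]
  have dW: "\<delta> \<in> polys ?W" using F(6) unfolding linear_entries_def by blast
  have mem: "P0.emb f \<in> P0.extended_prime ?P0 \<longleftrightarrow> f \<in> ?P0" if "f \<in> polys ?V" for f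
    using P0.frac_mem_extended_prime_iff[OF P0 order_refl, of f "\<one>\<^bsub>poly_ring ?V\<^esub>"] that P0.one_denominator
    by (simp add: poly_ring_simps(1))
  have "\<forall>v\<in>A \<times> B. \<exists>g. g \<in> polys ?W \<and> Z (fst v) (snd v) = indexed_padd (indexed_pmult \<delta> v) g"
    using F(6) unfolding linear_entries_def by auto
  from bchoice[OF this] obtain g where
    g: "\<forall>v\<in>A \<times> B. g v \<in> polys ?W \<and> Z (fst v) (snd v) = indexed_padd (indexed_pmult \<delta> v) (g v)" ..
  have WV: "f \<in> polys ?V" if "f \<in> polys ?W" for f using polys_mono[OF that] by blast
  have dden: "\<delta> \<in> P0.loc_denominators" using d F(8) by (simp add: poly_ring_simps(1))
  \<comment> \<open>The solution of \<delta> x + g = 0 in the localization at the extension of q,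
    where \<delta> is a unit; the variables outside the block are kept.\<close>
  define a where "a v = (if v \<in> A \<times> B then P0.frac (\<ominus>\<^bsub>poly_ring ?V\<^esub> g v) \<delta> else P0.emb (indexed_var v))" for v
  define \<sigma> where "\<sigma> = P0.emb \<circ> indexed_const"
  have gP: "g v \<in> carrier (poly_ring ?V)" if "v \<in> A \<times> B" for v
    using bspec[OF g that] WV by (simp add: poly_ring_simps(1))
  have "\<sigma> \<in> ring_hom R P0.loc"
    unfolding \<sigma>_def using ring_hom_cring.homh[OF indexed_const_hom] h.homh by (rule ring_hom_trans)
  hence \<sigma>: "ring_hom_cring R P0.loc \<sigma>" by (rule ring_hom_cringI[OF is_cring P0.loc_cring])
  have ac: "a v \<in> carrier P0.loc" if "v \<in> ?V" for v
  proof (cases "v \<in> A \<times> B")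
    case True
    have "P0.frac (\<ominus>\<^bsub>poly_ring ?V\<^esub> g v) \<delta> \<in> carrier P0.loc"
      using gP[OF True] dden by (intro P0.frac_closed) auto
    thus ?thesis unfolding a_def using True by simp
  next
    case False
    have "P0.emb (indexed_var v) \<in> carrier P0.loc"
      using polys_var[OF that] by (intro P0.emb_closed) (simp add: poly_ring_simps(1))
    thus ?thesis unfolding a_def using False by simp
  qed
  interpret E: poly_evaluation R P0.loc \<sigma> ?V a
    using \<sigma> ac unfolding poly_evaluation_def poly_evaluation_axioms_def by blast
  let ?\<phi> = "poly_eval R P0.loc \<sigma> a"
  interpret \<phi>: ring_hom_cring "poly_ring ?V" P0.loc ?\<phi> by (rule E.eval_hom)
  \<comment> \<open>On polynomials in the kept variables the substitution is the canonical map, so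
    such a polynomial lies in the prime below only if its coefficients lie in q.\<close>
  have \<phi>W: "?\<phi> f = P0.emb f" if "f \<in> polys ?W" for f
    using that
  proof (induction rule: polys_induct)
    case (const c)
    have "?\<phi> (indexed_const c) = \<sigma> c" using const by (rule E.eval_const)
    also have "\<dots> = P0.emb (indexed_const c)" by (simp add: \<sigma>_def)
    finally show ?case .
  next
    case (add f f')
    have "?\<phi> (indexed_padd f f') = ?\<phi> f \<oplus>\<^bsub>P0.loc\<^esub> ?\<phi> f'" using E.eval_padd[OF WV WV] add(1,2) by blast
    also have "\<dots> = P0.emb (f \<oplus>\<^bsub>poly_ring ?V\<^esub> f')"
      unfolding add(3,4) using WV[OF add(1)] WV[OF add(2)] by (intro h.hom_add[symmetric]) (simp_all add: poly_ring_simps(1))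
    finally show ?case by (simp add: poly_ring_simps(3))
  next
    case (pmult f v)
    have v: "v \<in> ?V" "v \<notin> A \<times> B" using pmult(2) by auto
    have "?\<phi> (indexed_pmult f v) = a v \<otimes>\<^bsub>P0.loc\<^esub> ?\<phi> f" using E.eval_pmult[OF WV[OF pmult(1)] v(1)] .
    also have "\<dots> = P0.emb (indexed_var v \<otimes>\<^bsub>poly_ring ?V\<^esub> f)"
      unfolding pmult(3) a_def using v WV[OF pmult(1)] polys_var[OF v(1)]
        h.hom_mult[of "indexed_var v" f] by (simp add: poly_ring_simps(1))
    finally show ?case using pmult_eq_mult_var(2)[OF WV[OF pmult(1)], of v] by (simp add: poly_ring_simps(2))
  qed
  \<comment> \<open>The preimage of the maximal ideal of the localization; every
    \<open>Z i j\<close> belongs to it because it is mapped to zero.\<close>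
  let ?p = "{f \<in> carrier (poly_ring ?V). ?\<phi> f \<in> P0.extended_prime ?P0}"
  have "primeideal ?p (poly_ring ?V)"
    by (rule ring_hom_ring.primeideal_vimage[OF \<phi>.ring.ring_hom_ring_axioms poly_ring_cring M.primeideal_axioms])
  moreover have "\<delta> \<notin> ?p" using \<phi>W[OF dW] mem[OF F(8)] d by simp
  moreover have "Z i j \<in> ?p" if ij: "i \<in> A" "j \<in> B" for i j
  proof -
    have v: "(i, j) \<in> A \<times> B" "(i, j) \<in> ?V" using ij F(1) by auto
    have gij: "g (i, j) \<in> polys ?W" "Z i j = indexed_padd (indexed_pmult \<delta> (i, j)) (g (i, j))" using bspec[OF g v(1)] by simp_all
    have gc: "g (i, j) \<in> carrier (poly_ring ?V)" using gP[OF v(1)] .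
    have pm: "indexed_pmult \<delta> (i, j) \<in> polys ?V" using F(8) v(2) by (rule indexed_pset.indexed_pmult)
    have "?\<phi> (Z i j) = ?\<phi> (indexed_pmult \<delta> (i, j)) \<oplus>\<^bsub>P0.loc\<^esub> ?\<phi> (g (i, j))"
      unfolding gij(2) by (rule E.eval_padd[OF pm WV[OF gij(1)]])
    also have "?\<phi> (indexed_pmult \<delta> (i, j)) = a (i, j) \<otimes>\<^bsub>P0.loc\<^esub> P0.emb \<delta>"
      using E.eval_pmult[OF F(8) v(2)] \<phi>W[OF dW] by simp
    also have "\<dots> = P0.emb \<delta> \<otimes>\<^bsub>P0.loc\<^esub> P0.frac (\<ominus>\<^bsub>poly_ring ?V\<^esub> g (i, j)) \<delta>"
      using ac[OF v(2)] P0.emb_closed[of \<delta>] F(8) v(1) h.S.m_comm by (simp add: a_def poly_ring_simps(1))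
    also have "\<dots> = P0.emb (\<ominus>\<^bsub>poly_ring ?V\<^esub> g (i, j))"
      using gc dden by (intro P0.emb_denominator_mult) auto
    also have "?\<phi> (g (i, j)) = P0.emb (g (i, j))" by (rule \<phi>W[OF gij(1)])
    also have "P0.emb (\<ominus>\<^bsub>poly_ring ?V\<^esub> g (i, j)) \<oplus>\<^bsub>P0.loc\<^esub> P0.emb (g (i, j)) = \<zero>\<^bsub>P0.loc\<^esub>"
      using gc P0.emb_closed[OF gc] h.S.l_neg by simp
    finally show ?thesis using M.zero_mem F(7)[OF ij] by (simp add: poly_ring_simps(1))
  qed
  moreover have "f x \<in> q" if f: "f \<in> polys ?W" "f \<in> ?p" for f x
  proof -
    have "f \<in> ?P0" using f \<phi>W[OF f(1)] mem[OF WV[OF f(1)]] by simp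
    thus ?thesis by (simp add: coeff_ideal_def)
  qed
  ultimately show ?thesis by (intro exI[of _ ?p]) blast
qed

text \<open>Independence of the minors of Z at p forces the number of generators, while the
  variables outside \<open>A \<times> B\<close> remain independent modulo p and leave room for only
  \<open>card (A \<times> B)\<close> steps in a chain below p. Minimality of q prevents R itself
  from contributing to such a chain.\<close>

lemma exists_prime_with_many_generators:
  assumes q: "primeideal q R" "\<And>q'. primeideal q' R \<Longrightarrow> q' \<subseteq> q \<Longrightarrow> q' = q"
    and t: "t \<le> m" "t \<le> n" and k: "k < t"
  shows "\<exists>p. primeideal p (poly_ring (vars m n)) \<and> generic_determinantal_ideal R m n t \<subseteq> p \<and>
    enat (((m - k) choose (t - k)) * ((n - k) choose (t - k))) \<le>
      min_gens (localization (poly_ring (vars m n)) p)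
        (localized_ideal (poly_ring (vars m n)) p (generic_determinantal_ideal R m n t)) \<and>
    krull_dim (localization (poly_ring (vars m n)) p) \<le> enat ((m - k) * (n - k))"
proof -
  let ?V = "vars m n"
  interpret P: cring "poly_ring ?V" by (rule poly_ring_cring)
  obtain A B Z \<delta> where st: "pivot_state m n t k A B Z \<delta>" and d0: "\<delta> \<notin> coeff_ideal ?V q"
    using pivot_state_generic[OF q(1) t, of k] k by auto
  note F = pivot_state_facts[OF st]
  obtain p where p: "primeideal p (poly_ring ?V)" and d: "\<delta> \<notin> p" and Zp: "\<And>i j. i \<in> A \<Longrightarrow> j \<in> B \<Longrightarrow> Z i j \<in> p"
    and indep: "\<And>f x. f \<in> polys (?V - A \<times> B) \<Longrightarrow> f \<in> p \<Longrightarrow> f x \<in> q"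
    using exists_prime_killing_entries[OF q(1) st d0] by blast
  interpret p: primeideal p "poly_ring ?V" by (rule p)
  let ?X = "P.tuple_minors (\<lambda>i j. indexed_var (i, j)) {..<m} {..<n} t" and ?T = "P.tuple_minors Z A B (t - k)"
  have ZP: "Z i j \<in> carrier (poly_ring ?V)" if "i \<in> A" "j \<in> B" for i j using F(7)[OF that] by (simp add: poly_ring_simps(1))
  have XP: "indexed_var (i, j) \<in> carrier (poly_ring ?V)" if "i \<in> {..<m}" "j \<in> {..<n}" for i j
    using polys_var[of "(i, j)" ?V] that by (simp add: poly_ring_simps(1))
  have Tc: "?T \<subseteq> carrier (poly_ring ?V)" by (rule P.tuple_minors_carrier) (rule ZP)
  have Xc: "?X \<subseteq> carrier (poly_ring ?V)" using XP by (rule P.tuple_minors_carrier)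
  have dP: "\<delta> \<in> carrier (poly_ring ?V)" using F(8) by (simp add: poly_ring_simps(1))
  have "?T \<subseteq> p"
  proof
    fix x assume x: "x \<in> ?T"
    show "x \<in> p"
    proof (rule P.tuple_minorsE[OF x])
      fix \<rho> \<gamma> assume x: "x = det_ring (poly_ring ?V) (t - k) (\<lambda>i j. Z (\<rho> i) (\<gamma> j))"
        "\<And>i. i < t - k \<Longrightarrow> \<rho> i \<in> A" "\<And>j. j < t - k \<Longrightarrow> \<gamma> j \<in> B"
      show "x \<in> p" unfolding x(1)
        by (rule P.det_ring_entries_in_ideal[OF p.is_ideal]) (use x(2,3) Zp k in auto)
    qed
  qed
  hence Tp: "Idl\<^bsub>poly_ring ?V\<^esub> ?T \<subseteq> p" by (rule P.genideal_minimal[OF p.is_ideal])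
  obtain K where K: "\<And>x. x \<in> ?X \<Longrightarrow> \<delta> [^]\<^bsub>poly_ring ?V\<^esub> (K::nat) \<otimes>\<^bsub>poly_ring ?V\<^esub> x \<in> Idl\<^bsub>poly_ring ?V\<^esub> ?T"
    using st unfolding pivot_state_def P.power_multiplies_into_def by blast
  \<comment> \<open>The minors of Z lie in p because their size t - k is positive; cancelling the
    power of \<delta>, which is outside p, moves the minors of X into p.\<close>
  have "?X \<subseteq> p"
  proof
    fix x assume x: "x \<in> ?X"
    have "x \<in> carrier (poly_ring ?V)" using x Xc by blast
    moreover have "\<delta> [^]\<^bsub>poly_ring ?V\<^esub> K \<otimes>\<^bsub>poly_ring ?V\<^esub> x \<in> p" using K[OF x] Tp by blast
    ultimately show "x \<in> p" using p.I_prime p.pow_notin_prime[OF dP d, of K] by blast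
  qed
  hence I: "generic_determinantal_ideal R m n t \<subseteq> p"
    unfolding generic_ideal_eq by (rule P.genideal_minimal[OF p.is_ideal])
  let ?L = "subset_pairs A B (t - k)"
  have "enat (card ?L) \<le> min_gens p.loc (localized_ideal (poly_ring ?V) p (generic_determinantal_ideal R m n t))"
    unfolding localized_generic_ideal[OF st p d]
  proof (rule p.min_gens_loc_ge)
    show "finite ?L" by (rule finite_subset_pairs[OF F(2,3)])
    show "P.subset_minor Z (t - k) l \<in> carrier (poly_ring ?V)" if "l \<in> ?L" for l
      by (rule subsetD[OF Tc P.subset_minor_tuple[OF F(2,3) that]])
    fix b l assume b: "b \<in> ?L \<rightarrow> carrier (poly_ring ?V)"
      "(\<Oplus>\<^bsub>poly_ring ?V\<^esub>l\<in>?L. b l \<otimes>\<^bsub>poly_ring ?V\<^esub> P.subset_minor Z (t - k) l) = \<zero>\<^bsub>poly_ring ?V\<^esub>" "l \<in> ?L"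
    show "b l \<in> p"
      by (rule subset_minors_independent[OF F(6,1,2,3) p _ d b(1)[unfolded poly_ring_simps(1)] b(2,3)]) (rule Zp)
  qed
  moreover have "card ?L = ((m - k) choose (t - k)) * ((n - k) choose (t - k))"
    using card_subset_pairs[OF F(2,3)] F(4,5) by simp
  moreover have "krull_dim p.loc \<le> enat ((m - k) * (n - k))"
  proof (rule p.krull_dim_loc_le)
    fix l c assume c: "\<And>i. i \<le> l \<Longrightarrow> primeideal (c i) (poly_ring ?V)" "\<And>i. i \<le> l \<Longrightarrow> c i \<subseteq> p" "\<And>i. i < l \<Longrightarrow> c i \<subset> c (Suc i)"
    have "l + card (?V - A \<times> B) \<le> card ?V"
    proof (rule prime_chain_length_le[where p = p and q = q and c = c])
      show "infinite (UNIV :: (nat \<times> nat) set)" by (simp add: finite_prod)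
      show "finite ?V" "?V - A \<times> B \<subseteq> ?V" "primeideal q R" using q(1) by auto
      show "q' = q" if "primeideal q' R" "q' \<subseteq> q" for q' by (rule q(2)[OF that])
      show "f x \<in> q" if "f \<in> polys (?V - A \<times> B)" "f \<in> p" for f x by (rule indep[OF that])
      show "primeideal (c i) (poly_ring ?V)" "c i \<subseteq> p" if "i \<le> l" for i by (rule c(1)[OF that], rule c(2)[OF that])
      show "c i \<subset> c (Suc i)" if "i < l" for i by (rule c(3)[OF that])
    qed
    moreover have "card (?V - A \<times> B) = card ?V - card (A \<times> B)" using F(1,2,3) by (intro card_Diff_subset) auto
    moreover have "card (A \<times> B) \<le> card ?V" using F(1) by (intro card_mono) auto
    ultimately have "l \<le> card (A \<times> B)" by linarith
    thus "l \<le> (m - k) * (n - k)" using F(4,5) by (simp add: card_cartesian_product)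
  qed
  ultimately show ?thesis using p I by auto
qed

lemma satisfies_G_generic_iff:
  assumes "noetherian_ring R" "carrier R \<noteq> {\<zero>}" and t: "t \<le> m" "t \<le> n"
  shows "satisfies_G (generic_ring R m n) (generic_determinantal_ideal R m n t) s \<longleftrightarrow>
    (\<forall>k<t. ((m - k) choose (t - k)) * ((n - k) choose (t - k)) \<le> (m - k) * (n - k) \<or> s \<le> (m - k) * (n - k))"
    (is "?L \<longleftrightarrow> (\<forall>k<t. ?N k \<le> ?D k \<or> s \<le> ?D k)")
proof -
  let ?P = "poly_ring (vars m n)" and ?I = "generic_determinantal_ideal R m n t"
  show ?thesis
    unfolding generic_ring_def satisfies_G_def
  proof (intro iffI allI impI)
    fix p assume *: "\<forall>k<t. ?N k \<le> ?D k \<or> s \<le> ?D k"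
      and p: "primeideal p ?P \<and> ?I \<subseteq> p \<and> krull_dim (localization ?P p) + 1 \<le> enat s"
    obtain k where k: "k < t" "min_gens (localization ?P p) (localized_ideal ?P p ?I) \<le> enat (?N k)"
      "enat (?D k) \<le> krull_dim (localization ?P p)" using prime_over_generic_ideal p by blast
    \<comment> \<open>Otherwise dim + 1 \<le> s \<le> D \<le> dim, which is impossible since the
      bound by s makes the dimension finite.\<close>
    have "\<not> s \<le> ?D k"
    proof
      assume "s \<le> ?D k"
      have "krull_dim (localization ?P p) + 1 \<le> enat (?D k)"
        using p \<open>s \<le> ?D k\<close> order_trans enat_ord_simps(1) by blast
      also have "\<dots> \<le> krull_dim (localization ?P p)" by (rule k(3))
      finally show False using p by (cases "krull_dim (localization ?P p)") (auto simp: one_enat_def)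
    qed
    hence "?N k \<le> ?D k" using * k(1) by blast
    hence "enat (?N k) \<le> enat (?D k)" by simp
    thus "min_gens (localization ?P p) (localized_ideal ?P p ?I) \<le> krull_dim (localization ?P p)"
      using k(2,3) by (meson order_trans)
  next
    fix k assume *: "\<forall>p. primeideal p ?P \<and> ?I \<subseteq> p \<and> krull_dim (localization ?P p) + 1 \<le> enat s \<longrightarrow>
        min_gens (localization ?P p) (localized_ideal ?P p ?I) \<le> krull_dim (localization ?P p)" and k: "k < t"
    obtain M where "maximalideal M R" using exists_maximal_ideal[OF assms(1,2)] by blast
    hence "primeideal M R" by (rule maximalideal_prime)
    then obtain q where q: "primeideal q R" "\<And>q'. primeideal q' R \<Longrightarrow> q' \<subseteq> q \<Longrightarrow> q' = q"
      using exists_minimal_prime by blast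
    obtain p where p: "primeideal p ?P" "?I \<subseteq> p" "enat (?N k) \<le> min_gens (localization ?P p) (localized_ideal ?P p ?I)"
      "krull_dim (localization ?P p) \<le> enat (?D k)"
      using exists_prime_with_many_generators[OF q t k] by blast
    show "?N k \<le> ?D k \<or> s \<le> ?D k"
    proof (rule ccontr)
      assume n: "\<not> ?thesis"
      have "krull_dim (localization ?P p) + 1 \<le> enat (?D k) + 1" using p(4) by (rule add_right_mono)
      also have "\<dots> \<le> enat s" using n by (simp add: one_enat_def)
      finally have "min_gens (localization ?P p) (localized_ideal ?P p ?I) \<le> krull_dim (localization ?P p)"
        using * p by blast
      hence "enat (?N k) \<le> enat (?D k)" using p(3,4) by (meson order_trans)
      thus False using n by simp
    qed
  qed
qed

end

section \<open>The numerical conditions\<close>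

lemma double_choose_add_two: "2 * ((e + 2) choose e) = (e + 2) * (e + 1 :: nat)"
proof -
  have "(e + 2) choose e = (e + 2) choose 2" using binomial_symmetric[of e "e + 2"] by simp
  thus ?thesis by (simp add: choose_two)
qed

text \<open>Four times the product of the binomials is (a+2)(b+2) times (a+1)(b+1); this is where
  the threshold 4 comes from.\<close>

lemma choose_two_product_gt:
  assumes "4 < (a + 1) * (b + 1 :: nat)"
  shows "(a + 2) * (b + 2) < ((a + 2) choose 2) * ((b + 2) choose 2)"
proof -
  have "2 * ((a + 2) choose 2) = (a + 2) * (a + 1)" "2 * ((b + 2) choose 2) = (b + 2) * (b + 1)"
    by (simp_all add: choose_two)
  hence "2 * ((a + 2) choose 2) * (2 * ((b + 2) choose 2)) = ((a + 2) * (a + 1)) * ((b + 2) * (b + 1))"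
    by (simp only:)
  hence "4 * (((a + 2) choose 2) * ((b + 2) choose 2)) = ((a + 2) * (b + 2)) * ((a + 1) * (b + 1))"
    by (simp only: mult.assoc mult.commute mult.left_commute mult_numeral_left_semiring_numeral) (simp add: algebra_simps)
  moreover have "((a + 2) * (b + 2)) * 4 < ((a + 2) * (b + 2)) * ((a + 1) * (b + 1))"
    using assms by (intro mult_strict_left_mono) auto
  ultimately show ?thesis by linarith
qed


text \<open>For e = 1 both sides agree. For the pairs (0,0), (0,1), (0,2), (1,1) the comparison is
  of 1, e+1, (e+1)(e+2)/2, (e+1)^2 with e^2, e(e+1), e(e+2), (e+1)^2, and (0,3) with e = 2 gives 10
  = 10.\<close>

lemma choose_product_le:
  assumes "(a = b \<and> b \<le> 1) \<or> (a = 0 \<and> b \<le> 2) \<or> e = 1 \<or> (a = 0 \<and> b = 3 \<and> e \<le> 2)" and "1 \<le> e"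
  shows "((a + e) choose e) * ((b + e) choose e) \<le> (a + e) * (b + e :: nat)"
proof -
  have "1 * 1 \<le> e * e" using assms(2) by (intro mult_le_mono) auto
  moreover have "1 * e \<le> e * e" using assms(2) by (intro mult_le_mono) auto
  moreover have "e = 1 \<or> e = 2" if "e \<le> 2" using that assms(2) by auto
  moreover have "((2 + e) choose e) * 2 = (e + 2) * (e + 1)" using double_choose_add_two[of e] by (simp add: ac_simps)
  moreover have "5 choose 2 = (10 :: nat)" by (simp add: choose_two)
  moreover have "a = 0 \<and> b = 0 \<or> a = 0 \<and> b = 1 \<or> a = 0 \<and> b = 2 \<or> a = 1 \<and> b = 1 \<or> e = 1 \<or> a = 0 \<and> b = 3 \<and> e \<le> 2"
    using assms(1) by auto
  ultimately show ?thesis using assms(2) by (auto simp: algebra_simps numeral_2_eq_2[symmetric])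
qed

lemma mult_add_mono: "c \<le> e \<Longrightarrow> (a + c) * (b + c) \<le> (a + e) * (b + e :: nat)"
  by (intro mult_le_mono) auto

text \<open>As (a+e)(b+e) increases with e, only the smallest e that violates the binomial
  inequality matters: there is none in the first part, it is 3 in the second and 2 in the
  third.\<close>

lemma threshold_cases:
  fixes a b t :: nat
  assumes ab: "a \<le> b" and t: "1 \<le> t"
    and sat: "\<And>s. sat s \<longleftrightarrow>
      (\<forall>e. 1 \<le> e \<longrightarrow> e \<le> t \<longrightarrow> ((a + e) choose e) * ((b + e) choose e) \<le> (a + e) * (b + e) \<or> s \<le> (a + e) * (b + e))"
  shows "t = 1 \<or> (a = b \<and> b \<le> 1) \<or> (a = 0 \<and> b \<le> 2) \<or> (a = 0 \<and> b = 3 \<and> t = 2) \<Longrightarrow> sat s"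
    and "a = 0 \<Longrightarrow> b = 3 \<Longrightarrow> 3 \<le> t \<Longrightarrow> sat s \<longleftrightarrow> s \<le> 18"
    and "t \<noteq> 1 \<Longrightarrow> 4 < (a + 1) * (b + 1) \<Longrightarrow> sat s \<longleftrightarrow> s \<le> (a + 2) * (b + 2)"
proof -
  assume *: "t = 1 \<or> (a = b \<and> b \<le> 1) \<or> (a = 0 \<and> b \<le> 2) \<or> (a = 0 \<and> b = 3 \<and> t = 2)"
  show "sat s" unfolding sat
  proof (intro allI impI disjI1)
    fix e assume "1 \<le> e" "e \<le> t"
    thus "((a + e) choose e) * ((b + e) choose e) \<le> (a + e) * (b + e)"
      using * by (intro choose_product_le) auto
  qed
next
  assume ab: "a = 0" "b = 3" and t: "3 \<le> t"
  have "(6 choose 3 :: nat) = 20" by (simp add: numeral_eq_Suc)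
  hence "s \<le> 18" if "sat s" using that t unfolding sat ab by (auto dest!: spec[of _ 3])
  moreover have "sat s" if s: "s \<le> 18" unfolding sat
  proof (intro allI impI)
    fix e assume e: "1 \<le> e" "e \<le> t"
    show "((a + e) choose e) * ((b + e) choose e) \<le> (a + e) * (b + e) \<or> s \<le> (a + e) * (b + e)"
    proof (cases "e \<le> 2")
      case True
      thus ?thesis using e ab by - (rule disjI1, rule choose_product_le, auto)
    next
      case False
      hence "(0 + 3) * (3 + 3) \<le> (0 + e) * (3 + e)" by (intro mult_add_mono) auto
      thus ?thesis using s ab by simp
    qed
  qed
  ultimately show "sat s \<longleftrightarrow> s \<le> 18" by blast
next
  assume t1: "t \<noteq> 1" and ab: "4 < (a + 1) * (b + 1)"
  \<comment> \<open>The instance e = 2 is available because 1 \<le> t and t \<noteq> 1.\<close>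
  have "s \<le> (a + 2) * (b + 2)" if "sat s"
    using that choose_two_product_gt[OF ab] t t1 unfolding sat by (auto dest!: spec[of _ 2])
  moreover have "sat s" if s: "s \<le> (a + 2) * (b + 2)" unfolding sat
  proof (intro allI impI)
    fix e assume e: "1 \<le> e" "e \<le> t"
    show "((a + e) choose e) * ((b + e) choose e) \<le> (a + e) * (b + e) \<or> s \<le> (a + e) * (b + e)"
    proof (cases "e = 1")
      case True
      thus ?thesis using e by - (rule disjI1, rule choose_product_le, auto)
    next
      case False
      hence "(a + 2) * (b + 2) \<le> (a + e) * (b + e)" using e by (intro mult_add_mono) auto
      thus ?thesis using s by linarith
    qed
  qed
  ultimately show "sat s \<longleftrightarrow> s \<le> (a + 2) * (b + 2)" by blast
qed

theorem corollary3p3: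
  fixes S :: "('a, 'b) ring_scheme" and m n t :: nat
  assumes "cring S" and "noetherian_ring S" and "carrier S \<noteq> {\<zero>\<^bsub>S\<^esub>}"
    and "1 \<le> t" and "t \<le> m" and "m \<le> n"
  shows "let R = generic_ring S m n;
             I = generic_determinantal_ideal S m n t;
             G_inf_case =
               (t = 1
                \<or> (t = m \<and> m = n)
                \<or> (m = n \<and> t = n - 1)
                \<or> (n = m + 1 \<and> t = m)
                \<or> (n = m + 2 \<and> t = m)
                \<or> (m = 2 \<and> n = 5 \<and> t = 2));
             case_18 = (3 \<le> t \<and> t = m \<and> n = m + 3)
         in (satisfies_G_infinity R I \<longleftrightarrow> G_inf_case)
            \<and> (case_18 \<longrightarrow> maximal_G R I 18)
            \<and> (\<not> G_inf_case \<and> \<not> case_18 \<longrightarrow> maximal_G R I ((m - t + 2) * (n - t + 2)))"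
proof -
  interpret S: cring S by fact
  \<comment> \<open>An elimination step takes one row, one column and one from the size of the
    minors, so the differences a and b are the same for all k.\<close>
  define a b where ab: "a = m - t" "b = n - t"
  have le: "a \<le> b" "m = t + a" "n = t + b" using assms(5,6) ab by auto
  let ?R = "generic_ring S m n" and ?I = "generic_determinantal_ideal S m n t"
  have sat: "satisfies_G ?R ?I s \<longleftrightarrow> (\<forall>e. 1 \<le> e \<longrightarrow> e \<le> t \<longrightarrow>
      ((a + e) choose e) * ((b + e) choose e) \<le> (a + e) * (b + e) \<or> s \<le> (a + e) * (b + e))" for s
  proof -
    have *: "m - k = a + (t - k)" "n - k = b + (t - k)" if "k < t" for k using that le by auto
    have "satisfies_G ?R ?I s \<longleftrightarrow> (\<forall>k<t. ((a + (t - k)) choose (t - k)) * ((b + (t - k)) choose (t - k))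
        \<le> (a + (t - k)) * (b + (t - k)) \<or> s \<le> (a + (t - k)) * (b + (t - k)))"
      using S.satisfies_G_generic_iff[OF assms(2,3,5), of n s] assms(5,6) * by simp
    also have "\<dots> \<longleftrightarrow> (\<forall>e. 1 \<le> e \<longrightarrow> e \<le> t \<longrightarrow>
      ((a + e) choose e) * ((b + e) choose e) \<le> (a + e) * (b + e) \<or> s \<le> (a + e) * (b + e))" (is "(\<forall>k<t. ?Q (t - k)) \<longleftrightarrow> _")
    proof (intro iffI allI impI)
      fix e assume h: "\<forall>k<t. ?Q (t - k)" and e: "1 \<le> e" "e \<le> t"
      have "?Q (t - (t - e))" using spec[OF h, of "t - e"] e by simp
      thus "?Q e" using e by simp
    next
      fix k assume h: "\<forall>e. 1 \<le> e \<longrightarrow> e \<le> t \<longrightarrow> ?Q e" and k: "k < t"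
      show "?Q (t - k)" using spec[OF h, of "t - k"] k by (simp only: diff_le_self zero_less_diff One_nat_def Suc_le_eq simp_thms)
    qed
    finally show ?thesis .
  qed
  note threshold = threshold_cases[OF le(1) assms(4), where sat = "satisfies_G ?R ?I", OF sat]
  have mn: "m - t + 2 = a + 2" "n - t + 2 = b + 2" using ab by auto
  \<comment> \<open>The six cases in terms of a and b. With m = n, the case t = n - 1 means a = b =
    1, without truncation since t \<ge> 1, and the 2 x 5 case is a = 0, b = 3, t = 2.\<close>
  define good where "good \<longleftrightarrow> t = 1 \<or> (a = b \<and> b \<le> 1) \<or> (a = 0 \<and> b \<le> 2) \<or> (a = 0 \<and> b = 3 \<and> t = 2)"
  have good: "good \<longleftrightarrow> t = 1 \<or> (t = m \<and> m = n) \<or> (m = n \<and> t = n - 1) \<or> (n = m + 1 \<and> t = m)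
      \<or> (n = m + 2 \<and> t = m) \<or> (m = 2 \<and> n = 5 \<and> t = 2)"
    unfolding good_def using le assms(4) by auto
  have c18: "3 \<le> t \<and> t = m \<and> n = m + 3 \<longleftrightarrow> a = 0 \<and> b = 3 \<and> 3 \<le> t" using le by auto
  have other: "4 < (a + 1) * (b + 1)" "t \<noteq> 1" if "\<not> good" "\<not> (a = 0 \<and> b = 3 \<and> 3 \<le> t)"
  proof -
    show "t \<noteq> 1" using that(1) by (simp add: good_def)
    \<comment> \<open>Excluding the listed pairs leaves these two families, where (a+1)(b+1) is at
      least 5 and 6.\<close>
    have "a = 0 \<and> 4 \<le> b \<or> 1 \<le> a \<and> 2 \<le> b"
      using that le(1) assms(4) unfolding good_def by auto
    moreover have "2 * 3 \<le> (a + 1) * (b + 1)" if "1 \<le> a" "2 \<le> b" using that by (intro mult_le_mono) auto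
    ultimately show "4 < (a + 1) * (b + 1)" by auto
  qed
  \<comment> \<open>If the condition holds exactly for s \<le> d, then d is maximal and
    \<open>Suc d\<close> refutes the condition for all s.\<close>
  have maximal: "maximal_G ?R ?I d \<and> \<not> satisfies_G_infinity ?R ?I"
    if "\<And>s. satisfies_G ?R ?I s \<longleftrightarrow> s \<le> d" for d
    unfolding maximal_G_def satisfies_G_infinity_def using that by (auto intro: exI[of _ "Suc d"])
  have "satisfies_G_infinity ?R ?I" if good
    using threshold(1) that unfolding satisfies_G_infinity_def good_def by blast
  moreover have "maximal_G ?R ?I 18 \<and> \<not> satisfies_G_infinity ?R ?I" if "a = 0 \<and> b = 3 \<and> 3 \<le> t"
    using threshold(2) that by (intro maximal) blast
  moreover have "maximal_G ?R ?I ((a + 2) * (b + 2)) \<and> \<not> satisfies_G_infinity ?R ?I"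
    if "\<not> good" "\<not> (a = 0 \<and> b = 3 \<and> 3 \<le> t)"
    using threshold(3) other[OF that] by (intro maximal) blast
  ultimately show ?thesis unfolding Let_def good[symmetric] c18 mn by blast
qed

end
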